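(* $E(\mathcal{S}_{\le1})^\perp\subset\overline{E(\mathcal{F}(\mathcal{S}_{\le1}))}$ (orthogonal complement and closure in $L^2((0,\infty),du)$) if and only if the Riemann Hypothesis holds.
   Context: $\mathcal{S}_{\le1}$ is the vector space of smooth even functions on $\mathbb{R}$ with support in $[-1,1]$, and $\mathcal{F}$ is the Fourier transform $\mathcal{F}(\varphi)(x)=\int_{\mathbb{R}}\varphi(y)e^{2\pi i xy}\,dy$, so $\mathcal{F}(\mathcal{S}_{\le1})$ consists of even Schwartz functions. For an even Schwartz function $\varphi$ and $u>0$, $E(\varphi)(u)=\sum_{n\ge1}\varphi(nu)-\frac{\int_0^\infty\varphi(x)\,dx}{u}$, an element of $L^2((0,\infty),du)$. The Riemann Hypothesis asserts that the Riemann zeta function has no zeros with $\mathrm{Re}(s)>\frac12$. *)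

theory Defs
  imports "HOL-Complex_Analysis.Complex_Analysis"
begin

text \<open>Square-integrable functions are handled through representatives: the elements of
  \<open>L2 M\<close> are functions rather than classes modulo equality almost everywhere.
  Both \<open>L2_orth M A\<close> and \<open>L2_closure M A\<close> are saturated under equality almost everywhere, so an
  inclusion between them is the same as the inclusion of the corresponding sets of classes.\<close>

definition L2 :: "'a measure \<Rightarrow> ('a \<Rightarrow> complex) set" where
  "L2 M = {f \<in> borel_measurable M. integrable M (\<lambda>x. (norm (f x))\<^sup>2)}"

definition L2_inner :: "'a measure \<Rightarrow> ('a \<Rightarrow> complex) \<Rightarrow> ('a \<Rightarrow> complex) \<Rightarrow> complex" where
  "L2_inner M f g = (LINT x|M. f x * cnj (g x))"

definition L2_norm :: "'a measure \<Rightarrow> ('a \<Rightarrow> complex) \<Rightarrow> real" where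
  "L2_norm M f = sqrt (LINT x|M. (norm (f x))\<^sup>2)"

definition L2_orth :: "'a measure \<Rightarrow> ('a \<Rightarrow> complex) set \<Rightarrow> ('a \<Rightarrow> complex) set" where
  "L2_orth M A = {g \<in> L2 M. \<forall>f\<in>A. L2_inner M f g = 0}"

definition L2_closure :: "'a measure \<Rightarrow> ('a \<Rightarrow> complex) set \<Rightarrow> ('a \<Rightarrow> complex) set" where
  "L2_closure M A = {g \<in> L2 M. \<forall>\<epsilon>>0. \<exists>f\<in>A. L2_norm M (\<lambda>x. g x - f x) < \<epsilon>}"

definition smooth :: "(real \<Rightarrow> complex) \<Rightarrow> bool" where
  "smooth \<phi> \<longleftrightarrow>
     (\<exists>D :: nat \<Rightarrow> real \<Rightarrow> complex. D 0 = \<phi> \<and>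
        (\<forall>n x. (D n has_vector_derivative D (Suc n) x) (at x)))"

definition S_le1 :: "(real \<Rightarrow> complex) set" where
  "S_le1 = {\<phi>. smooth \<phi> \<and> (\<forall>x. \<phi> (- x) = \<phi> x) \<and> closure {x. \<phi> x \<noteq> 0} \<subseteq> {-1..1}}"

definition fourier :: "(real \<Rightarrow> complex) \<Rightarrow> real \<Rightarrow> complex" where
  "fourier \<phi> x = (LINT y|lborel. \<phi> y * exp (2 * of_real pi * \<i> * of_real x * of_real y))"

text \<open>Only the values of \<open>E_map \<phi>\<close> at \<open>u > 0\<close> are meaningful.\<close>

definition E_map :: "(real \<Rightarrow> complex) \<Rightarrow> real \<Rightarrow> complex" where
  "E_map \<phi> u = (\<Sum>n. \<phi> (real (Suc n) * u)) - (LINT x:{0<..}|lborel. \<phi> x) / of_real u"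

text \<open>The analytic continuation of the Dirichlet series to the plane without the point \<open>1\<close>.
  It is unique there by the identity theorem; the value at the pole is unspecified,
  which is why \<open>riemann_hypothesis\<close> excludes it.\<close>

definition riemann_zeta :: "complex \<Rightarrow> complex" where
  "riemann_zeta = (SOME f. f holomorphic_on - {1} \<and>
     (\<forall>s. Re s > 1 \<longrightarrow> f s = (\<Sum>n. 1 / of_nat (Suc n) powr s)))"

definition riemann_hypothesis :: bool where
  "riemann_hypothesis \<longleftrightarrow> (\<forall>s. s \<noteq> 1 \<and> Re s > 1/2 \<longrightarrow> riemann_zeta s \<noteq> 0)"

end

theory Submission imports Defs begin

text \<open>
  The change of variables \<open>u \<mapsto> 1/u\<close> defines a unitary involution \<open>U f(u) = f(1/u)/u\<close>, and the
  Poisson summation formula says that \<open>E \<circ> \<F> = U \<circ> E\<close> on the test functions. Since \<open>E(\<phi>)\<close> is a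
  multiple of \<open>1/u\<close> on \<open>(1,\<infinity>)\<close>, the functions \<open>E(\<F>(\<phi>))\<close> are constant on \<open>(0,1)\<close>.
  The Mellin transform of \<open>E(\<phi>)\<close> is \<open>\<zeta>(s)\<close> times that of \<open>\<phi>\<close>; hence a zero \<open>\<rho>\<close> to the right of the
  critical line yields an element of the orthogonal complement of \<open>E(S)\<close> that equals the complex
  conjugate of \<open>u powr (\<rho>-1)\<close> on \<open>(0,1)\<close>, and this is not in the closure of functions constant there.

  Conversely, it suffices to show that, under the Riemann Hypothesis, every \<open>g\<close> orthogonal to \<open>E(S)\<close>
  vanishes on \<open>(0,1)\<close>: an \<open>h\<close> orthogonal to \<open>E(S)\<close> and a \<open>q\<close> orthogonal to \<open>U(E(S))\<close> then have
  disjoint supports, so that they are orthogonal. Put \<open>k(s) = \<integral> g(u) u powr (-s) du\<close> over \<open>(0,1)\<close>, a function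
  on \<open>Re s < 1/2\<close>. Orthogonality to the dilates of \<open>\<phi>\<close> shows that \<open>(s-1) \<zeta>(s) k(s)\<close> continues to
  \<open>Re s > 0\<close>; by the hypothesis \<open>k\<close> continues with it, the zeros on the critical line causing no poles
  because \<open>k(s)\<close> is only of the order of \<open>(1/2 - Re s) powr (-1/2)\<close> to their left. Dividing out the zeros of
  \<open>\<zeta>\<close> in discs and applying the Borel-Caratheodory inequality bounds the entire function \<open>k\<close> by
  a polynomial. As \<open>k\<close> tends to 0 at \<open>-\<infinity>\<close>, it vanishes, and so do all moments of \<open>g\<close> on \<open>(0,1)\<close>.
\<close>


section \<open>Holomorphic functions\<close>

text \<open>The Mellin identity for \<open>E_map\<close>, taken over all test functions at once,
  does double duty. For every \<open>s\<close> there is a bump whose transform is nonzero at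
  \<open>s\<close>, so \<open>Z s\<close>, the entire function \<open>s - 1\<close> times zeta, can
  be obtained by division near each point; and the bump can be adapted to \<open>s\<close> so that
  the division costs only polynomial factors, which bounds \<open>Z\<close>. The product of
  \<open>Z\<close> with \<open>k\<close> has the same form, with the pairings \<open>T\<close> in
  place of \<open>E_map\<close>, and is continued and bounded in the same way. The obstacle is the
  division by \<open>Z\<close>: the quotient must be bounded in the critical strip, where no lower
  bound for \<open>Z\<close> is at hand. Discs centred on \<open>Re s = 3\<close>, where the
  Dirichlet series stays away from 0, reach far enough to the left to cover
  \<open>1/4 < Re s\<close>; for \<open>Re s \<le> 1/4\<close> the Cauchy-Schwarz inequality bounds
  \<open>k\<close> directly. The Riemann Hypothesis enters only in making the quotient entire, and
  the growth estimate holds for whatever entire quotient there is.\<close>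

lemma holomorphic_on_integral_param:
  fixes f :: "'a \<Rightarrow> complex \<Rightarrow> complex"
  assumes U: "open U"
    and hol: "\<And>x. x \<in> space M \<Longrightarrow> f x holomorphic_on U"
    and meas: "\<And>s. s \<in> U \<Longrightarrow> (\<lambda>x. f x s) \<in> borel_measurable M"
    and dom: "\<And>s0. s0 \<in> U \<Longrightarrow> \<exists>r>0. \<exists>h. integrable M h \<and>
                (\<forall>s\<in>ball s0 r \<inter> U. \<forall>x\<in>space M. norm (f x s) \<le> h x)"
  shows "(\<lambda>s. LINT x|M. f x s) holomorphic_on U"
  unfolding holomorphic_on_open[OF U]
proof
  fix s0 assume s0: "s0 \<in> U"
  obtain r h where r: "r > 0" and h: "integrable M h"
    and bd: "\<And>s x. s \<in> ball s0 r \<inter> U \<Longrightarrow> x \<in> space M \<Longrightarrow> norm (f x s) \<le> h x"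
    using dom[OF s0] by blast
  obtain e where e: "e > 0" "ball s0 e \<subseteq> U" using U s0 openE by blast
  \<comment> \<open>The factor 3 leaves room for a disc of radius \<open>d\<close> about every point
    of \<open>cball s0 d\<close>. Cauchy's inequality on these discs turns the dominating function
    \<open>h\<close> of the integrand into \<open>h x / d\<close> for its derivative, and this
    dominates the difference quotients.\<close>
  define d where "d = min r e / 3"
  have d: "d > 0" "3 * d \<le> r" "3 * d \<le> e" using r e by (auto simp: d_def)
  have sub: "cball s d \<subseteq> ball s0 r \<inter> U" if "s \<in> cball s0 d" for s
  proof
    fix z assume "z \<in> cball s d"
    then have "dist s0 z \<le> d + d" using that dist_triangle[of s0 z s] by auto
    then have "dist s0 z < r" "dist s0 z < e" using d by auto
    then show "z \<in> ball s0 r \<inter> U" using e by auto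
  qed
  have dbd: "norm (deriv (f x) s) \<le> h x / d" if "s \<in> cball s0 d" "x \<in> space M" for s x
  proof -
    have "norm ((deriv ^^ 1) (f x) s) \<le> fact 1 * h x / d ^ 1"
    proof (rule Cauchy_inequality)
      show "f x holomorphic_on ball s d" "continuous_on (cball s d) (f x)"
        using sub[OF that(1)] holomorphic_on_subset[OF hol[OF that(2)]]
        by (force intro: holomorphic_on_imp_continuous_on)+
    qed (use d sub[OF that(1)] that bd in \<open>auto simp: dist_norm subset_eq\<close>)
    then show ?thesis by simp
  qed
  have ddbd: "norm (f x s - f x s0) \<le> h x / d * norm (s - s0)"
    if "s \<in> cball s0 d" "x \<in> space M" for s x
  proof (rule field_differentiable_bound[where S = "cball s0 d" and f' = "deriv (f x)"])
    fix z assume z: "z \<in> cball s0 d"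
    then have "z \<in> U" using sub[of z] d by (auto simp: subset_eq)
    then show "(f x has_field_derivative deriv (f x) z) (at z within cball s0 d)"
      using hol[OF that(2)] U holomorphic_derivI has_field_derivative_at_within by blast
    show "norm (deriv (f x) z) \<le> h x / d" using dbd z that by blast
  qed (use that d in auto)
  have fint: "integrable M (\<lambda>x. f x s)" if "s \<in> cball s0 d" for s
  proof (rule Bochner_Integration.integrable_bound[OF h])
    have "s \<in> ball s0 r \<inter> U" using sub[OF that] d by (auto simp: subset_eq)
    then show "(\<lambda>x. f x s) \<in> borel_measurable M" "AE x in M. norm (f x s) \<le> norm (h x)"
      using meas bd by (auto intro!: AE_I2 order_trans[OF bd])
  qed
  have lim: "((\<lambda>s. (LINT x|M. f x s) - (LINT x|M. f x s0)) has_field_derivative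
      (LINT x|M. deriv (f x) s0)) (at s0)"
  proof -
    have "((\<lambda>s. ((LINT x|M. f x s) - (LINT x|M. f x s0)) / (s - s0)) \<longlongrightarrow> (LINT x|M. deriv (f x) s0)) (at s0)"
      unfolding tendsto_at_iff_sequentially
    proof (intro allI impI)
      fix X assume X: "\<forall>i. X i \<in> UNIV - {s0}" "X \<longlonglongrightarrow> s0"
      have ev: "eventually (\<lambda>i. X i \<in> cball s0 d) sequentially"
        using X(2) d(1) unfolding tendsto_iff by (force elim!: eventually_mono simp: dist_commute)
      define q where "q i x = (if X i \<in> cball s0 d then (f x (X i) - f x s0) / (X i - s0) else deriv (f x) s0)" for i x
      have ptw: "(\<lambda>i. (f x (X i) - f x s0) / (X i - s0)) \<longlonglongrightarrow> deriv (f x) s0" if "x \<in> space M" for x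
      proof -
        have "(f x has_field_derivative deriv (f x) s0) (at s0)"
          using hol[OF that] U s0 holomorphic_derivI by blast
        then have "((\<lambda>s. (f x s - f x s0) / (s - s0)) \<longlongrightarrow> deriv (f x) s0) (at s0)"
          by (simp add: has_field_derivative_iff)
        then show ?thesis unfolding tendsto_at_iff_sequentially comp_def using X by blast
      qed
      obtain N where N: "\<And>i. i \<ge> N \<Longrightarrow> X i \<in> cball s0 d"
        using ev unfolding eventually_sequentially by blast
      have inU: "X (i+N) \<in> U" for i using N[of "i+N"] sub[of "X (i+N)"] d by (auto simp: subset_eq)
      have lint: "(\<lambda>i. LINT x|M. (f x (X (i+N)) - f x s0) / (X (i+N) - s0)) \<longlonglongrightarrow> (LINT x|M. deriv (f x) s0)"
      proof (rule integral_dominated_convergence[where w = "\<lambda>x. h x / d"])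
        show "integrable M (\<lambda>x. h x / d)" using h by simp
        show m: "\<And>i. (\<lambda>x. (f x (X (i+N)) - f x s0) / (X (i+N) - s0)) \<in> borel_measurable M"
          by (intro borel_measurable_divide borel_measurable_diff meas inU s0 borel_measurable_const)
        show "AE x in M. (\<lambda>i. (f x (X (i+N)) - f x s0) / (X (i+N) - s0)) \<longlonglongrightarrow> deriv (f x) s0"
          using LIMSEQ_ignore_initial_segment[OF ptw] by (auto intro!: AE_I2)
        show "AE x in M. norm ((f x (X (i+N)) - f x s0) / (X (i+N) - s0)) \<le> h x / d" for i
        proof (intro AE_I2)
          fix x assume "x \<in> space M"
          then have "norm (f x (X (i+N)) - f x s0) \<le> h x / d * norm (X (i+N) - s0)"
            using ddbd[OF N] by simp
          moreover have "norm (X (i+N) - s0) > 0" using X(1) by auto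
          ultimately show "norm ((f x (X (i+N)) - f x s0) / (X (i+N) - s0)) \<le> h x / d"
            unfolding norm_divide by (subst pos_divide_le_eq)
        qed
        show "(\<lambda>x. deriv (f x) s0) \<in> borel_measurable M"
          by (rule borel_measurable_LIMSEQ_metric[where f = "\<lambda>i x. (f x (X (i+N)) - f x s0) / (X (i+N) - s0)"])
             (use m LIMSEQ_ignore_initial_segment[OF ptw] in auto)
      qed
      have eq: "(LINT x|M. (f x (X (i+N)) - f x s0) / (X (i+N) - s0)) =
          ((LINT x|M. f x (X (i+N))) - (LINT x|M. f x s0)) / (X (i+N) - s0)" for i
        using fint[OF N[of "i+N"]] fint[of s0] d
        by (simp add: Bochner_Integration.integral_diff integral_divide_zero)
      have "(\<lambda>i. ((LINT x|M. f x (X (i+N))) - (LINT x|M. f x s0)) / (X (i+N) - s0)) \<longlonglongrightarrow> (LINT x|M. deriv (f x) s0)"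
        using lint unfolding eq .
      from LIMSEQ_offset[OF this]
      show "((\<lambda>s. ((LINT x|M. f x s) - (LINT x|M. f x s0)) / (s - s0)) \<circ> X) \<longlonglongrightarrow> (LINT x|M. deriv (f x) s0)"
        by (simp add: comp_def)
    qed
    then show ?thesis by (simp add: has_field_derivative_iff)
  qed
  from DERIV_add[OF lim DERIV_const[of "LINT x|M. f x s0"]]
  show "\<exists>f'. ((\<lambda>s. LINT x|M. f x s) has_field_derivative f') (at s0)" by auto
qed

text \<open>On \<open>V\<close> every \<open>f i\<close> is the same \<open>n\<close> times
  \<open>m i\<close>, so the identity theorem applied to the cross products makes all quotients
  \<open>f i / m i\<close> agree on \<open>U\<close>. At each point some \<open>m i\<close> is
  nonzero, hence no singularity ever has to be examined. With Mellin transforms of test functions as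
  \<open>m i\<close> this continues zeta, and later its product with \<open>k\<close>.\<close>

lemma glue_holomorphic:
  fixes f m :: "'i \<Rightarrow> complex \<Rightarrow> complex"
  assumes U: "open U" "connected U" and V: "open V" "V \<noteq> {}" "V \<subseteq> U"
    and f: "\<And>i. i \<in> I \<Longrightarrow> f i holomorphic_on U" and m: "\<And>i. i \<in> I \<Longrightarrow> m i holomorphic_on U"
    and ex: "\<And>s. s \<in> U \<Longrightarrow> \<exists>i\<in>I. m i s \<noteq> 0"
    and eq: "\<And>i s. i \<in> I \<Longrightarrow> s \<in> V \<Longrightarrow> f i s = n s * m i s"
  shows "\<exists>N. N holomorphic_on U \<and> (\<forall>s\<in>V. N s = n s) \<and> (\<forall>i\<in>I. \<forall>s\<in>U. f i s = N s * m i s)"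
proof -
  have cross: "f i s * m j s = f j s * m i s" if "i \<in> I" "j \<in> I" "s \<in> U" for i j s
    by (rule analytic_continuation_open[of V U "\<lambda>s. f i s * m j s" "\<lambda>s. f j s * m i s"])
       (use U V that f m eq in \<open>auto intro!: holomorphic_intros simp: mult_ac\<close>)
  from ex obtain c where c: "\<And>s. s \<in> U \<Longrightarrow> c s \<in> I" "\<And>s. s \<in> U \<Longrightarrow> m (c s) s \<noteq> 0" by metis
  define N where "N s = f (c s) s / m (c s) s" for s
  have N: "f i s = N s * m i s" if "i \<in> I" "s \<in> U" for i s
    using cross[OF that(1) c(1)[OF that(2)] that(2)] c(2)[OF that(2)] by (simp add: N_def field_simps)
  have "N holomorphic_on U"
    unfolding holomorphic_on_open[OF U(1)]
  proof
    fix s assume s: "s \<in> U"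
    let ?i = "c s"
    obtain e where e: "e > 0" "\<And>z. dist z s < e \<Longrightarrow> m ?i z \<noteq> 0"
      using continuous_at_avoid[of s "m ?i" 0] m[OF c(1)[OF s]] c(2)[OF s] U s
        holomorphic_on_imp_continuous_on continuous_on_eq_continuous_at dist_commute by metis
    obtain e2 where e2: "e2 > 0" "ball s e2 \<subseteq> U" using U s openE by blast
    define e3 where "e3 = min e e2"
    have e3: "e3 > 0" "e3 \<le> e" "e3 \<le> e2" using e e2 by (auto simp: e3_def)
    let ?B = "ball s e3"
    have B: "?B \<subseteq> U" using e2 e3 by auto
    have "(\<lambda>z. f ?i z / m ?i z) holomorphic_on ?B"
    proof (rule holomorphic_on_divide)
      show "m ?i z \<noteq> 0" if "z \<in> ?B" for z using that e3 by (intro e(2)) (auto simp: dist_commute)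
    qed (use holomorphic_on_subset[OF f[OF c(1)[OF s]] B] holomorphic_on_subset[OF m[OF c(1)[OF s]] B] in auto)
    then have "N holomorphic_on ?B"
    proof (rule holomorphic_transform)
      fix z assume z: "z \<in> ?B"
      then have "z \<in> U" "m ?i z \<noteq> 0" using e(2)[of z] e3 B by (auto simp: dist_commute)
      then show "f ?i z / m ?i z = N z" using N[OF c(1)[OF s], of z] by simp
    qed
    then show "\<exists>f'. (N has_field_derivative f') (at s)"
      using e3 by (subst (asm) holomorphic_on_open) auto
  qed
  moreover have "N s = n s" if "s \<in> V" for s
  proof -
    have "s \<in> U" using that V by auto
    then show ?thesis using N[OF c(1), of s] eq[OF c(1) that, of s] c(2)[of s] by simp
  qed
  ultimately show ?thesis using N by blast
qed

text \<open>The cofactor is glued from the local one at \<open>a\<close> and the plain quotient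
  elsewhere. The order \<open>n\<close> may be 0, so zeros and nonzeros of \<open>Z\<close> are
  treated alike.\<close>

lemma holomorphic_factor_zero_global:
  assumes Z: "Z holomorphic_on S" and S: "open S" "connected S" "a \<in> S"
    and nz: "\<exists>z\<in>S. Z z \<noteq> 0"
  obtains h n where "h holomorphic_on S" "\<And>z. z \<in> S \<Longrightarrow> Z z = (z - a) ^ n * h z" "h a \<noteq> 0"
proof (cases "Z a = 0")
  case False
  then show ?thesis using that[of Z 0] Z by simp
next
  case True
  have nc: "\<not> Z constant_on S" unfolding constant_on_def by (metis nz True S(3))
  obtain g r n where g: "0 < n" "0 < r" "ball a r \<subseteq> S" "g holomorphic_on ball a r"
     "\<And>w. w \<in> ball a r \<Longrightarrow> Z w = (w - a)^n * g w" "\<And>w. w \<in> ball a r \<Longrightarrow> g w \<noteq> 0"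
    by (rule holomorphic_factor_zero_nonconstant[OF Z S(1,2,3) True nc]) (rule that)
  define h where "h z = (if z = a then g a else Z z / (z - a)^n)" for z
  have hg: "h z = g z" if "z \<in> ball a r" for z using g(5)[OF that] by (auto simp: h_def)
  have h1: "h holomorphic_on ball a r" using g(4) by (rule holomorphic_transform) (simp add: hg)
  have "(\<lambda>z. Z z / (z - a)^n) holomorphic_on (S - {a})"
    by (intro holomorphic_intros holomorphic_on_subset[OF Z]) auto
  then have h2: "h holomorphic_on (S - {a})"
    by (rule holomorphic_transform) (auto simp: h_def)
  have "h holomorphic_on (ball a r \<union> (S - {a}))"
    by (rule holomorphic_on_Un[OF h1 h2]) (use S in \<open>auto intro: open_delete\<close>)
  moreover have "ball a r \<union> (S - {a}) = S" using g by auto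
  ultimately have "h holomorphic_on S" by simp
  then show ?thesis using that[of h n] g True hg[of a] by (force simp: h_def)
qed

text \<open>If \<open>Z\<close> had a zero of larger order than \<open>N\<close> at \<open>a\<close>, the quotient would have a pole there, and the
  limit could not vanish along any filter converging to \<open>a\<close>: approach from one side is enough.\<close>

lemma holomorphic_quotient_extend:
  assumes N: "N holomorphic_on S" and Z: "Z holomorphic_on S" and S: "open S" "connected S"
    and nz: "\<exists>z\<in>S. Z z \<noteq> 0"
    and lim: "\<And>a. a \<in> S \<Longrightarrow> Z a = 0 \<Longrightarrow>
       \<exists>F. F \<noteq> bot \<and> F \<le> at a \<and> ((\<lambda>z. (z - a) * (N z / Z z)) \<longlongrightarrow> 0) F"
  shows "\<exists>K. K holomorphic_on S \<and> (\<forall>z\<in>S. N z = K z * Z z)"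
proof (cases "\<exists>z\<in>S. N z \<noteq> 0")
  case False
  then show ?thesis by (intro exI[of _ "\<lambda>_. 0"]) auto
next
  case True
  have loc: "\<exists>r K. r > 0 \<and> ball a r \<subseteq> S \<and> K holomorphic_on ball a r \<and> (\<forall>z\<in>ball a r. N z = K z * Z z)
      \<and> (\<forall>z\<in>ball a r - {a}. Z z \<noteq> 0)" if a: "a \<in> S" for a
  proof -
    obtain h n where h: "h holomorphic_on S" "\<And>z. z \<in> S \<Longrightarrow> Z z = (z - a) ^ n * h z" "h a \<noteq> 0"
      using holomorphic_factor_zero_global[OF Z S a nz] by blast
    obtain g m where g: "g holomorphic_on S" "\<And>z. z \<in> S \<Longrightarrow> N z = (z - a) ^ m * g z" "g a \<noteq> 0"
      using holomorphic_factor_zero_global[OF N S a True] by blast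
    have cont: "continuous (at a) h" "continuous (at a) g"
      using h g S a holomorphic_on_imp_continuous_on continuous_on_eq_continuous_at by metis+
    obtain e where e: "e > 0" "\<And>z. dist a z < e \<Longrightarrow> h z \<noteq> 0"
      using continuous_at_avoid[OF cont(1) h(3)] by blast
    obtain e2 where e2: "e2 > 0" "ball a e2 \<subseteq> S" using S a openE by blast
    define r where "r = min e e2"
    have r: "r > 0" "ball a r \<subseteq> S" "\<And>z. z \<in> ball a r \<Longrightarrow> h z \<noteq> 0" using e e2 by (auto simp: r_def)
    have mn: "n \<le> m"
    proof (rule ccontr)
      assume "\<not> n \<le> m"
      \<comment> \<open>With \<open>k = n - m - 1\<close>, multiplying
        \<open>(z - a) * (N z / Z z)\<close> by \<open>(z - a) ^ k\<close> leaves exactly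
        \<open>g z / h z\<close>, whose limit \<open>g a / h a\<close> is not 0.\<close>
      then obtain k where k: "n = Suc m + k" using less_imp_Suc_add[of m n] by fastforce
      have "Z a = 0" using h(2)[OF a] k by simp
      then obtain F where F: "F \<noteq> bot" "F \<le> at a" "((\<lambda>z. (z - a) * (N z / Z z)) \<longlongrightarrow> 0) F"
        using lim[OF a] by blast
      have tz: "((\<lambda>z. (z - a)^k) \<longlongrightarrow> (a - a)^k) F"
        using F(2) by (intro tendsto_intros tendsto_mono[OF F(2)])
      have "((\<lambda>z. (z - a) ^ k * ((z - a) * (N z / Z z))) \<longlongrightarrow> (a - a)^k * 0) F"
        by (intro tendsto_mult tz F)
      moreover have "eventually (\<lambda>z. (z - a) ^ k * ((z - a) * (N z / Z z)) = g z / h z) (at a)"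
        unfolding eventually_at
      proof (intro exI conjI ballI impI)
        fix z assume z: "z \<noteq> a \<and> dist z a < r"
        then have "z \<in> S" "h z \<noteq> 0" using r by (auto simp: dist_commute subset_eq)
        then show "(z - a) ^ k * ((z - a) * (N z / Z z)) = g z / h z"
          using z by (simp add: h(2)[of z] g(2)[of z] k power_add)
      qed (rule r)
      ultimately have "((\<lambda>z. g z / h z) \<longlongrightarrow> 0) F"
        using filter_leD[OF F(2)] by (auto elim: Lim_transform_eventually)
      moreover have "((\<lambda>z. g z / h z) \<longlongrightarrow> g a / h a) F"
        by (intro tendsto_intros h(3) tendsto_mono[OF F(2)]) (use cont in \<open>auto simp: continuous_at\<close>)
      ultimately have "g a / h a = 0" using F(1) tendsto_unique by blast
      then show False using g(3) h(3) by simp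
    qed
    have "(\<lambda>z. (z - a)^(m - n) * (g z / h z)) holomorphic_on ball a r"
      using r h g by (intro holomorphic_intros) (auto intro: holomorphic_on_subset)
    moreover have "N z = (z - a)^(m - n) * (g z / h z) * Z z" if "z \<in> ball a r" for z
    proof -
      have "z \<in> S" "h z \<noteq> 0" using r that by auto
      moreover have "(z - a) ^ m = (z - a)^(m-n) * (z - a)^n" using mn by (simp flip: power_add)
      ultimately show ?thesis using h(2)[of z] g(2)[of z] by (simp add: field_simps)
    qed
    moreover have "Z z \<noteq> 0" if "z \<in> ball a r - {a}" for z
    proof -
      have "z \<in> S" "h z \<noteq> 0" using r that by auto
      then show ?thesis using h(2)[of z] that by simp
    qed
    ultimately show ?thesis using r(1,2) by blast
  qed
  define P where "P a r K \<longleftrightarrow> r > 0 \<and> ball a r \<subseteq> S \<and> K holomorphic_on ball a r \<and> (\<forall>z\<in>ball a r. N z = K z * Z z)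
      \<and> (\<forall>z\<in>ball a r - {a}. Z z \<noteq> 0)" for a r K
  have "\<forall>a\<in>S. \<exists>r K. P a r K" using loc unfolding P_def by blast
  then obtain R K where "\<forall>a\<in>S. P a (R a) (K a)" by metis
  then have RK: "\<And>a. a \<in> S \<Longrightarrow> R a > 0" "\<And>a. a \<in> S \<Longrightarrow> ball a (R a) \<subseteq> S"
     "\<And>a. a \<in> S \<Longrightarrow> K a holomorphic_on ball a (R a)"
     "\<And>a z. a \<in> S \<Longrightarrow> z \<in> ball a (R a) \<Longrightarrow> N z = K a z * Z z"
     "\<And>a z. a \<in> S \<Longrightarrow> z \<in> ball a (R a) \<Longrightarrow> z \<noteq> a \<Longrightarrow> Z z \<noteq> 0"
    unfolding P_def by blast+
  \<comment> \<open>Each point takes its value from the disc centred at itself. The discs were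
    chosen with \<open>Z\<close> nonzero off their centres, so on \<open>ball a (R a)\<close> this
    diagonal choice coincides with the single holomorphic function \<open>K a\<close>.\<close>
  have eq: "K z z = K a z" if "a \<in> S" "z \<in> ball a (R a)" for a z
  proof (cases "z = a")
    case False
    then have "Z z \<noteq> 0" using RK(5) that by blast
    moreover have "z \<in> S" using RK(2) that by blast
    ultimately show ?thesis using RK(4)[OF that] RK(4)[of z z] RK(1)[of z] by simp
  qed simp
  have "(\<lambda>z. K z z) holomorphic_on S"
    unfolding holomorphic_on_open[OF S(1)]
  proof
    fix a assume a: "a \<in> S"
    have "(\<lambda>z. K z z) holomorphic_on ball a (R a)"
      using RK(3)[OF a] by (rule holomorphic_transform) (use eq[OF a] in simp)
    then show "\<exists>f'. ((\<lambda>z. K z z) has_field_derivative f') (at a)"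
      using RK(1)[OF a] by (subst (asm) holomorphic_on_open) auto
  qed
  then show ?thesis using RK(1,4) by (intro exI[of _ "\<lambda>z. K z z"]) auto
qed

text \<open>Without zeros, \<open>f = f 0 * exp L\<close> with \<open>L 0 = 0\<close> and
  \<open>Re L < A\<close>. The map \<open>w = L / (2 * A - L)\<close> sends the half-plane
  \<open>Re L < A\<close> into the unit disc and fixes 0, so Schwarz's lemma gives
  \<open>norm (w z) \<le> q\<close>; solving for \<open>L\<close> bounds its modulus, hence
  \<open>f\<close> from below.\<close>

lemma Borel_Caratheodory_inverse:
  fixes f :: "complex \<Rightarrow> complex"
  assumes f: "f holomorphic_on ball 0 1" and nz: "\<And>z. norm z < 1 \<Longrightarrow> f z \<noteq> 0"
    and B: "\<And>z. norm z < 1 \<Longrightarrow> norm (f z) \<le> B" and b: "0 < b" "b \<le> norm (f 0)"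
    and q: "norm z \<le> q" "q < 1"
  shows "norm (inverse (f z)) \<le> exp (2 * (ln (B / b) + 1) * q / (1 - q)) / b"
proof -
  have Bb: "b \<le> B" using B[of 0] b by simp
  \<comment> \<open>The summand 1 makes \<open>A\<close> positive and the inequality
    \<open>Re (L z) < A\<close> strict, also when \<open>B = b\<close>.\<close>
  define A where "A = ln (B / b) + 1"
  have A: "A \<ge> 1" using Bb b by (simp add: A_def)
  obtain g where g: "g holomorphic_on ball 0 1" "\<And>z. z \<in> ball 0 1 \<Longrightarrow> exp (g z) = f z"
    by (rule holomorphic_logarithm_exists[OF convex_ball open_ball f, of 0])
       (use nz that in auto)
  define L where "L z = g z - g 0" for z
  have L: "L holomorphic_on ball 0 1" unfolding L_def by (intro holomorphic_intros g)
  have eL: "exp (L z) = f z / f 0" if "norm z < 1" for z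
    using g(2)[of z] g(2)[of 0] that by (simp add: L_def exp_diff)
  have ReL: "Re (L z) < A" if "norm z < 1" for z
  proof -
    have "exp (Re (L z)) = norm (f z) / norm (f 0)"
      using eL[OF that] by (metis norm_divide norm_exp_eq_Re)
    also have "\<dots> \<le> B / b" using B[OF that] b Bb by (intro frac_le) auto
    finally have "Re (L z) \<le> ln (B / b)" using b Bb by (simp add: ln_ge_iff)
    then show ?thesis by (simp add: A_def)
  qed
  have lt: "norm (L z) < norm (2 * of_real A - L z)" if "norm z < 1" for z
  proof -
    have "(norm (L z))\<^sup>2 < (norm (2 * of_real A - L z))\<^sup>2"
      using ReL[OF that] A unfolding cmod_power2 by (simp add: power2_eq_square algebra_simps)
    then show ?thesis by (rule power2_less_imp_less) simp
  qed
  have ne: "2 * of_real A - L z \<noteq> 0" if "norm z < 1" for z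
    using lt[OF that] by fastforce
  define w where "w z = L z / (2 * of_real A - L z)" for z
  have z1: "norm z < 1" using q by simp
  have "norm (w z) \<le> norm z"
  proof (rule Schwarz_Lemma)
    show "w holomorphic_on ball 0 1" unfolding w_def using ne by (intro holomorphic_intros L) auto
    show "w 0 = 0" by (simp add: w_def L_def)
    show "norm (w z) < 1" if "norm z < 1" for z
      using lt[OF that] ne[OF that] by (simp add: w_def norm_divide)
  qed (rule z1)
  then have wq: "norm (w z) \<le> q" using q by simp
  have "L z = w z * (2 * of_real A - L z)" using ne[OF z1] by (simp add: w_def)
  then have "norm (L z) = norm (w z) * norm (2 * of_real A - L z)" by (metis norm_mult)
  also have "\<dots> \<le> q * (2 * A + norm (L z))"
    using wq A norm_triangle_ineq4[of "2 * of_real A" "L z"] order_trans[OF norm_ge_zero wq]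
    by (intro mult_mono) (auto simp: norm_mult)
  finally have "norm (L z) * (1 - q) \<le> 2 * A * q" by (simp add: algebra_simps)
  then have Lb: "norm (L z) \<le> 2 * A * q / (1 - q)" using q by (simp add: field_simps)
  have f0: "f 0 \<noteq> 0" using nz by simp
  have "inverse (f z) = exp (- L z) / f 0"
    using eL[OF z1] f0 nz[OF z1] by (simp add: exp_minus divide_simps)
  then have "norm (inverse (f z)) = exp (Re (- L z)) / norm (f 0)"
    by (metis norm_divide norm_exp_eq_Re)
  also have "\<dots> \<le> exp (2 * A * q / (1 - q)) / b"
    using b Lb abs_Re_le_cmod[of "L z"] by (intro frac_le) auto
  finally show ?thesis by (simp add: A_def)
qed

lemma norm_Blaschke:
  fixes a z :: complex
  assumes "norm z = 1" shows "norm (1 - cnj a * z) = norm (z - a)"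
proof -
  have "1 = cnj z * z" using assms by (simp add: complex_norm_square[symmetric] mult.commute)
  then have "1 - cnj a * z = cnj (z - a) * z" by (simp add: algebra_simps)
  then have "norm (1 - cnj a * z) = norm (cnj (z - a)) * norm z" by (metis norm_mult)
  then show ?thesis using assms unfolding complex_mod_cnj by simp
qed

text \<open>Replacing each factor \<open>z - a\<close> by \<open>1 - cnj a * z\<close> keeps the modulus on the unit circle and does not
  decrease it at the origin.\<close>

lemma divide_out_zeros:
  assumes S: "open S" "connected S" "cball 0 1 \<subseteq> S" and r: "r < 1"
    and K: "K holomorphic_on S" and Z: "Z holomorphic_on S"
    and A: "\<And>z. norm z = 1 \<Longrightarrow> norm (K z * Z z) \<le> A"
    and B: "\<And>z. norm z = 1 \<Longrightarrow> norm (Z z) \<le> B"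
    and b: "norm (Z 0) \<ge> b" "b > 0"
  shows "\<exists>Y. Y holomorphic_on S \<and> (\<forall>z\<in>cball 0 r. Y z \<noteq> 0) \<and> norm (Y 0) \<ge> b \<and>
     (\<forall>z. norm z = 1 \<longrightarrow> norm (K z * Y z) \<le> A) \<and> (\<forall>z. norm z = 1 \<longrightarrow> norm (Y z) \<le> B)"
  using Z A B b
\<comment> \<open>One step removes the full order of a zero \<open>a\<close>. The factor put in its
  place vanishes only at \<open>1 / cnj a\<close>, outside the closed unit disc, so no zero is
  created and the number of distinct zeros in \<open>cball 0 r\<close> drops.\<close>
proof (induction "card {z\<in>cball 0 r. Z z = 0}" arbitrary: Z rule: less_induct)
  case less
  have fin: "finite {z\<in>cball 0 r. Y z = 0}" if "Y holomorphic_on S" "norm (Y 0) \<ge> b" for Y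
  proof (cases "Y constant_on S")
    case True
    then obtain c where c: "\<And>z. z \<in> S \<Longrightarrow> Y z = c" unfolding constant_on_def by blast
    have "{z\<in>cball 0 r. Y z = 0} = {}" using that(2) c[of 0] c S r \<open>b > 0\<close> by (force simp: subset_eq)
    then show ?thesis by (metis finite.emptyI)
  qed (rule holomorphic_compact_finite_zeros, use that S r in \<open>auto simp: subset_eq\<close>)
  show ?case
  proof (cases "\<exists>a\<in>cball 0 r. Z a = 0")
    case False
    then show ?thesis using less.prems by (intro exI[of _ Z]) auto
  next
    case True
    then obtain a where a: "a \<in> cball 0 r" "Z a = 0" by blast
    have aS: "a \<in> S" "norm a < 1" using a r S by auto
    have S0: "0 \<in> S" using S by auto
    obtain h n where h: "h holomorphic_on S" "\<And>z. z \<in> S \<Longrightarrow> Z z = (z - a) ^ n * h z" "h a \<noteq> 0"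
      by (rule holomorphic_factor_zero_global[OF less.prems(1) S(1,2) aS(1)])
         (use less.prems(4,5) S0 in force, rule that)
    define Y where "Y z = (1 - cnj a * z) ^ n * h z" for z
    have n1: "norm (Y z) = norm (Z z)" if "norm z = 1" for z
    proof -
      have "z \<in> S" using S that by auto
      then show ?thesis using norm_Blaschke[OF that, of a] h(2)[of z]
        by (simp add: Y_def norm_mult norm_power)
    qed
    have bl: "1 - cnj a * z \<noteq> 0" if "norm z \<le> 1" for z
    proof -
      have "norm a * norm z \<le> norm a" using that by (simp add: mult_left_le)
      then have "norm a * norm z < 1" using aS(2) by linarith
      then have "norm (cnj a * z) < 1" by (simp add: norm_mult)
      then show ?thesis by (metis eq_iff_diff_eq_0 less_irrefl norm_one)
    qed
    have Y: "Y holomorphic_on S" unfolding Y_def by (intro holomorphic_intros h)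
    have "b \<le> norm (a ^ n) * norm (h 0)" using less.prems(4) h(2)[OF S0] by (simp add: norm_mult norm_power)
    also have "\<dots> \<le> 1 * norm (h 0)"
      using aS(2) by (intro mult_right_mono) (auto simp: norm_power power_le_one)
    finally have Yb: "norm (Y 0) \<ge> b" by (simp add: Y_def)
    have "{z\<in>cball 0 r. Y z = 0} \<subset> {z\<in>cball 0 r. Z z = 0}"
    proof
      show "{z\<in>cball 0 r. Y z = 0} \<subseteq> {z\<in>cball 0 r. Z z = 0}"
      proof clarify
        fix z assume z: "z \<in> cball 0 r" "Y z = 0"
        then have "norm z \<le> 1" using r by auto
        then have "z \<in> S" "h z = 0" using bl[of z] z S by (auto simp: Y_def)
        then show "Z z = 0" using h(2) by simp
      qed
      have "Y a \<noteq> 0" using bl[of a] aS h by (simp add: Y_def)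
      then show "{z\<in>cball 0 r. Y z = 0} \<noteq> {z\<in>cball 0 r. Z z = 0}" using a by auto
    qed
    then have "card {z\<in>cball 0 r. Y z = 0} < card {z\<in>cball 0 r. Z z = 0}"
      using fin[OF less.prems(1,4)] by (rule psubset_card_mono[rotated])
    from less.hyps[OF this Y _ _ Yb less.prems(5)] show ?thesis
      using n1 less.prems(2,3) by (auto simp: norm_mult)
  qed
qed

lemma maximum_modulus_unit:
  assumes "f holomorphic_on S" "cball 0 1 \<subseteq> S" "\<And>z. norm z = 1 \<Longrightarrow> norm (f z) \<le> B" "norm z \<le> 1"
  shows "norm (f z) \<le> B"
proof (rule maximum_modulus_frontier[of f "cball 0 1"])
  show "f holomorphic_on interior (cball 0 1)"
    by (rule holomorphic_on_subset[OF assms(1)]) (use assms(2) in auto)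
  show "continuous_on (closure (cball 0 1)) f"
    by (rule holomorphic_on_imp_continuous_on, rule holomorphic_on_subset[OF assms(1)]) (use assms(2) in auto)
qed (use assms in auto)

text \<open>\<open>divide_out_zeros\<close> replaces \<open>Z\<close> by a function \<open>Y\<close>
  that is zero-free on a smaller disc and satisfies the same bounds on the circle. The maximum
  modulus principle bounds \<open>K * Y\<close> by \<open>A\<close>, and the Borel-Caratheodory
  inequality bounds \<open>inverse Y\<close>.\<close>

lemma quotient_growth_unit:
  assumes S: "open S" "connected S" "cball 0 1 \<subseteq> S"
    and K: "K holomorphic_on S" and Z: "Z holomorphic_on S"
    and A: "\<And>z. norm z = 1 \<Longrightarrow> norm (K z * Z z) \<le> A"
    and B: "\<And>z. norm z = 1 \<Longrightarrow> norm (Z z) \<le> B"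
    and b: "norm (Z 0) \<ge> b" "b > 0"
    and r: "norm z \<le> r" "r < 1"
  shows "norm (K z) \<le> A * exp (8 / (1 - r) * (ln (B / b) + 1)) / b"
proof -
  have r0: "r \<ge> 0" using r norm_ge_zero order_trans by blast
  \<comment> \<open>The zeros are removed up to the midpoint radius \<open>R\<close>, because the
    Borel-Caratheodory inequality needs a zero-free disc strictly larger than that of radius
    \<open>r\<close>. After rescaling by \<open>R\<close>, \<open>2 * q / (1 - q)\<close> equals
    \<open>4 * r / (1 - r)\<close>, which is rounded up to \<open>8 / (1 - r)\<close>.\<close>
  define R where "R = (1 + r) / 2"
  have R: "r < R" "R < 1" "R > 0" using r r0 by (auto simp: R_def)
  obtain Y where Y: "Y holomorphic_on S" "\<And>z. z \<in> cball 0 R \<Longrightarrow> Y z \<noteq> 0" "norm (Y 0) \<ge> b"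
     "\<And>z. norm z = 1 \<Longrightarrow> norm (K z * Y z) \<le> A" "\<And>z. norm z = 1 \<Longrightarrow> norm (Y z) \<le> B"
    using divide_out_zeros[OF S R(2) K Z A B b] by blast
  have YB: "norm (Y z) \<le> B" if "norm z \<le> 1" for z
    by (rule maximum_modulus_unit[OF Y(1) S(3) Y(5) that])
  have KA: "norm (K z * Y z) \<le> A" if "norm z \<le> 1" for z
    using maximum_modulus_unit[of "\<lambda>z. K z * Y z" S A z, OF holomorphic_on_mult[OF K Y(1)] S(3)] Y(4) that
    by blast
  have sub: "R *\<^sub>R z \<in> S" "norm (R *\<^sub>R z) \<le> 1" if "norm z < 1" for z :: complex
  proof -
    show "norm (R *\<^sub>R z) \<le> 1" using that R by (simp add: mult_le_one)
    then show "R *\<^sub>R z \<in> S" using S by auto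
  qed
  define q where "q = r / R"
  have q: "q < 1" "q \<ge> 0" "1 - q = (1 - r) / (1 + r)" using R r0 by (auto simp: q_def R_def field_simps)
  have "norm (inverse ((\<lambda>z. Y (R *\<^sub>R z)) (z /\<^sub>R R))) \<le> exp (2 * (ln (B / b) + 1) * q / (1 - q)) / b"
  proof (rule Borel_Caratheodory_inverse[where f = "\<lambda>z. Y (R *\<^sub>R z)"])
    have "(\<lambda>z. Y (of_real R * z)) holomorphic_on ball 0 1"
    proof (rule holomorphic_on_compose_gen[OF _ Y(1), unfolded o_def])
      show "(*) (complex_of_real R) ` ball 0 1 \<subseteq> S" using sub(1) by (auto simp: scaleR_conv_of_real)
    qed (intro holomorphic_intros)
    then show "(\<lambda>z. Y (R *\<^sub>R z)) holomorphic_on ball 0 1" by (simp add: scaleR_conv_of_real)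
    show "Y (R *\<^sub>R z) \<noteq> 0" if "norm z < 1" for z
      using that R by (intro Y(2)) (auto simp: mult_left_le)
    show "norm (Y (R *\<^sub>R z)) \<le> B" if "norm z < 1" for z using YB sub[OF that] by blast
    show "norm (z /\<^sub>R R) \<le> q" using r R by (simp add: q_def field_simps)
  qed (use b Y q in auto)
  then have iY: "norm (inverse (Y z)) \<le> exp (2 * (ln (B / b) + 1) * q / (1 - q)) / b" using R by simp
  have z1: "norm z \<le> 1" using r by simp
  have "B \<ge> b" using YB[of 0] Y(3) by simp
  then have ln0: "ln (B / b) + 1 \<ge> 0" using b by simp
  have "q / (1 - q) = 2 * r / (1 - r)"
  proof -
    have "q = 2 * r / (1 + r)" by (simp add: q_def R_def)
    then show ?thesis unfolding q(3) using r r0 by simp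
  qed
  then have "2 * (ln (B / b) + 1) * q / (1 - q) = (ln (B / b) + 1) * (4 * r / (1 - r))"
    by (simp add: mult.assoc times_divide_eq_right[symmetric] del: times_divide_eq_right)
  also have "\<dots> \<le> (ln (B / b) + 1) * (8 / (1 - r))"
    using r ln0 by (intro mult_left_mono divide_right_mono) auto
  finally have e: "exp (2 * (ln (B / b) + 1) * q / (1 - q)) \<le> exp (8 / (1 - r) * (ln (B / b) + 1))"
    by (simp add: mult.commute)
  have Yz: "Y z \<noteq> 0" using Y(2) r R by auto
  have "norm (K z) = norm (K z * Y z) * norm (inverse (Y z))"
    using Yz by (simp add: norm_mult norm_inverse)
  also have "\<dots> \<le> A * (exp (8 / (1 - r) * (ln (B / b) + 1)) / b)"
  proof (intro mult_mono)
    show "norm (inverse (Y z)) \<le> exp (8 / (1 - r) * (ln (B / b) + 1)) / b"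
      using iY by (rule order_trans) (use e b in \<open>intro divide_right_mono, auto\<close>)
    show "0 \<le> A" using order_trans[OF norm_ge_zero KA[OF z1]] .
  qed (use KA[OF z1] in auto)
  finally show ?thesis by simp
qed

lemma quotient_growth:
  assumes S: "open S" "convex S" "cball c R \<subseteq> S" "R > 0"
    and K: "K holomorphic_on S" and Z: "Z holomorphic_on S"
    and A: "\<And>z. dist c z \<le> R \<Longrightarrow> norm (K z * Z z) \<le> A"
    and B: "\<And>z. dist c z \<le> R \<Longrightarrow> norm (Z z) \<le> B"
    and b: "norm (Z c) \<ge> b" "b > 0"
    and r: "dist c z \<le> r * R" "r < 1"
  shows "norm (K z) \<le> A * exp (8 / (1 - r) * (ln (B / b) + 1)) / b"
proof -
  define \<phi> where "\<phi> w = c + of_real R * w" for w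
  define T where "T = \<phi> -` S"
  have c\<phi>: "continuous_on UNIV \<phi>" unfolding \<phi>_def by (intro continuous_intros)
  have oT: "open T" unfolding T_def using open_vimage[OF S(1) c\<phi>] .
  have "T = (\<lambda>z. (z - c) / of_real R) ` S"
  proof (intro set_eqI iffI)
    fix w assume "w \<in> T"
    then show "w \<in> (\<lambda>z. (z - c) / of_real R) ` S"
      using S(4) by (intro image_eqI[of _ _ "\<phi> w"]) (auto simp: T_def \<phi>_def)
  qed (use S(4) in \<open>auto simp: T_def \<phi>_def\<close>)
  moreover have "connected ((\<lambda>z. (z - c) / of_real R) ` S)"
    using S(4) by (intro connected_continuous_image continuous_intros convex_connected S(2)) auto
  ultimately have cT: "connected T" by simp
  have d: "dist c (\<phi> w) = R * norm w" for w using S(4) by (simp add: \<phi>_def dist_norm norm_mult)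
  have sT: "cball 0 1 \<subseteq> T" using S(3,4) d by (auto simp: T_def subset_eq mult_left_le)
  have hol: "(\<lambda>w. f (\<phi> w)) holomorphic_on T" if "f holomorphic_on S" for f
    by (rule holomorphic_on_compose_gen[OF _ that, unfolded o_def])
       (auto simp: T_def \<phi>_def intro!: holomorphic_intros)
  define w where "w = (z - c) / of_real R"
  have w: "\<phi> w = z" using S(4) by (simp add: w_def \<phi>_def)
  have "norm (K (\<phi> w)) \<le> A * exp (8 / (1 - r) * (ln (B / b) + 1)) / b"
  proof (rule quotient_growth_unit[OF oT cT sT hol[OF K] hol[OF Z]])
    show "norm w \<le> r" using r(1) S(4) d[of w] w by (simp add: mult.commute)
  qed (use A B b r d S(4) in \<open>auto simp: \<phi>_def[of 0]\<close>)
  then show ?thesis using w by simp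
qed

section \<open>Smooth test functions\<close>

lemma has_vector_derivative_flat:
  fixes f :: "real \<Rightarrow> 'a::real_normed_vector"
  assumes "f x = 0" "\<And>y. norm (f y) \<le> C * (y - x)\<^sup>2"
  shows "(f has_vector_derivative 0) (at x)"
  unfolding has_vector_derivative_def has_derivative_at
proof
  have "((\<lambda>h::real. \<bar>C\<bar> * norm h) \<longlongrightarrow> \<bar>C\<bar> * norm (0::real)) (at 0)"
    by (intro tendsto_intros tendsto_ident_at)
  then have t: "((\<lambda>h::real. \<bar>C\<bar> * norm h) \<longlongrightarrow> 0) (at 0)" by simp
  show "(\<lambda>h. norm (f (x + h) - f x - h *\<^sub>R 0) / norm h) \<midarrow>0\<rightarrow> 0"
  proof (rule Lim_null_comparison[OF _ t])
    have "norm (norm (f (x + h) - f x - h *\<^sub>R 0) / norm h) \<le> \<bar>C\<bar> * norm h" for h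
    proof (cases "h = 0")
      case False
      have "norm (f (x + h)) \<le> C * h\<^sup>2" using assms(2)[of "x + h"] by simp
      also have "\<dots> \<le> \<bar>C\<bar> * h\<^sup>2" by (intro mult_right_mono) auto
      also have "\<dots> = \<bar>C\<bar> * norm h * norm h" by (simp add: power2_eq_square)
      finally show ?thesis using False assms(1) by (simp add: divide_le_eq)
    qed simp
    then show "\<forall>\<^sub>F h in at 0. norm (norm (f (x + h) - f x - h *\<^sub>R 0) / norm h) \<le> \<bar>C\<bar> * norm h"
      by simp
  qed
qed (simp add: bounded_linear_zero)

text \<open>The radius \<open>d x\<close> is half the distance to the nearer endpoint. Cauchy's
  inequality on these discs turns decay of \<open>F\<close> faster than every power of
  \<open>d x\<close> into the same decay of all derivatives, so their extensions by 0 are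
  differentiable at the endpoints; no formula for the derivatives is involved.\<close>

lemma smooth_flat_extension:
  fixes F :: "complex \<Rightarrow> complex" and a b :: real
  defines "d \<equiv> \<lambda>x. min (x - a) (b - x) / 2"
  assumes F: "F holomorphic_on U" "open U"
    and sub: "\<And>x. a < x \<Longrightarrow> x < b \<Longrightarrow> cball (of_real x) (d x) \<subseteq> U"
    and bd: "\<And>n. \<exists>C. \<forall>x. a < x \<longrightarrow> x < b \<longrightarrow> (\<forall>z\<in>cball (of_real x) (d x). norm (F z) \<le> C * d x ^ n)"
  shows "smooth (\<lambda>x. if a < x \<and> x < b then F (of_real x) else 0)"
  unfolding smooth_def
proof (intro exI conjI allI)
  define D where "D n x = (if a < x \<and> x < b then (deriv ^^ n) F (of_real x) else 0)" for n and x :: real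
  show "D 0 = (\<lambda>x. if a < x \<and> x < b then F (of_real x) else 0)" by (auto simp: D_def)
  fix n x
  show "(D n has_vector_derivative D (Suc n) x) (at x)"
  proof (cases "a < x \<and> x < b")
    case True
    have "d x > 0" using True by (simp add: d_def)
    then have xU: "of_real x \<in> U" using sub[of x] True centre_in_cball[of "of_real x" "d x"] by fastforce
    have "((deriv ^^ n) F has_field_derivative deriv ((deriv ^^ n) F) (of_real x)) (at (of_real x))"
      using holomorphic_higher_deriv[OF F, of n] F(2) xU by (rule holomorphic_derivI)
    then have "((\<lambda>x. (deriv ^^ n) F (of_real x)) has_vector_derivative D (Suc n) x) (at x)"
      using True by (simp add: D_def has_vector_derivative_real_field)
    then show ?thesis
      by (rule has_vector_derivative_transform_within_open[of _ _ _ "{a<..<b}"]) (use True in \<open>auto simp: D_def\<close>)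
  next
    case False
    \<comment> \<open>Cauchy's inequality for the \<open>n\<close>-th derivative costs
      \<open>n\<close> powers of \<open>d x\<close>; the other two give the quadratic flatness that
      makes the derivative at \<open>x\<close> vanish.\<close>
    obtain C where C: "\<And>x z. a < x \<Longrightarrow> x < b \<Longrightarrow> z \<in> cball (of_real x) (d x) \<Longrightarrow> norm (F z) \<le> C * d x ^ (n + 2)"
      using bd[of "n+2"] by blast
    have "norm (D n y) \<le> \<bar>fact n * C\<bar> * (y - x)\<^sup>2" for y
    proof (cases "a < y \<and> y < b")
      case True
      have dy: "d y > 0" using True by (simp add: d_def)
      have sy: "cball (of_real y) (d y) \<subseteq> U" using sub True by blast
      have "norm ((deriv ^^ n) F (of_real y)) \<le> fact n * (C * d y ^ (n+2)) / d y ^ n"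
      proof (rule Cauchy_inequality[OF _ _ dy])
        show "F holomorphic_on ball (of_real y) (d y)" "continuous_on (cball (of_real y) (d y)) F"
          using sy holomorphic_on_subset[OF F(1)] ball_subset_cball
          by (blast intro: holomorphic_on_imp_continuous_on)+
      qed (use C True in \<open>auto simp: dist_norm\<close>)
      also have "\<dots> = fact n * C * (d y)\<^sup>2" using dy by (simp add: power_add power2_eq_square)
      also have "\<dots> \<le> \<bar>fact n * C\<bar> * (d y)\<^sup>2" by (intro mult_right_mono) auto
      also have "(d y)\<^sup>2 \<le> (y - x)\<^sup>2"
      proof -
        have "d y \<le> \<bar>y - x\<bar>" using True False by (auto simp: d_def min_def)
        then show ?thesis using dy by (simp add: abs_le_square_iff[symmetric])
      qed
      finally show ?thesis using True by (simp add: D_def mult_left_mono)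

    qed (auto simp: D_def)
    moreover have "D n x = 0" "D (Suc n) x = 0" using False by (auto simp: D_def)
    ultimately show ?thesis using has_vector_derivative_flat[of "D n" x] by metis
  qed
qed

lemma smooth_add: "smooth f \<Longrightarrow> smooth g \<Longrightarrow> smooth (\<lambda>x. f x + g x)"
proof -
  assume "smooth f" "smooth g"
  then obtain D E where "D 0 = f" "\<And>n x. (D n has_vector_derivative D (Suc n) x) (at x)"
    "E 0 = g" "\<And>n x. (E n has_vector_derivative E (Suc n) x) (at x)" unfolding smooth_def by blast
  then show ?thesis unfolding smooth_def
    by (intro exI[of _ "\<lambda>n x. D n x + E n x"]) (auto intro!: has_vector_derivative_add)
qed

lemma smooth_cmult: "smooth f \<Longrightarrow> smooth (\<lambda>x. c * f x)"
proof -
  assume "smooth f"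
  then obtain D where "D 0 = f" "\<And>n x. (D n has_vector_derivative D (Suc n) x) (at x)"
    unfolding smooth_def by blast
  then show ?thesis unfolding smooth_def
    by (intro exI[of _ "\<lambda>n x. c * D n x"]) (auto intro!: has_vector_derivative_mult_right)
qed

lemma smooth_scale: "smooth f \<Longrightarrow> smooth (\<lambda>x. f (w * x))"
proof -
  assume "smooth f"
  then obtain D where D: "D 0 = f" "\<And>n x. (D n has_vector_derivative D (Suc n) x) (at x)"
    unfolding smooth_def by blast
  have "((\<lambda>x. of_real w ^ n * D n (w * x)) has_vector_derivative of_real w ^ Suc n * D (Suc n) (w * x)) (at x)" for n x
  proof -
    have "((D n \<circ> (\<lambda>x. w * x)) has_vector_derivative (w *\<^sub>R D (Suc n) (w * x))) (at x)"
      by (rule vector_diff_chain_at) (use D in \<open>auto intro!: derivative_eq_intros\<close>)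
    then have "((\<lambda>x. of_real w ^ n * D n (w * x)) has_vector_derivative of_real w ^ n * (w *\<^sub>R D (Suc n) (w * x))) (at x)"
      unfolding o_def by (rule has_vector_derivative_mult_right)
    then show ?thesis by (simp add: scaleR_conv_of_real mult_ac)
  qed
  then show ?thesis unfolding smooth_def using D(1)
    by (intro exI[of _ "\<lambda>n x. of_real w ^ n * D n (w * x)"]) auto
qed

lemma S_le1_zero:
  assumes "\<phi> \<in> S_le1" "1 < \<bar>x\<bar>"
  shows "\<phi> x = 0"
proof (rule ccontr)
  assume "\<phi> x \<noteq> 0"
  then have "x \<in> closure {x. \<phi> x \<noteq> 0}" by (intro subsetD[OF closure_subset]) simp
  moreover have "closure {x. \<phi> x \<noteq> 0} \<subseteq> {-1..1}" using assms(1) by (simp add: S_le1_def)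
  ultimately have "x \<in> {-1..1}" by blast
  then show False using assms(2) by auto
qed

lemma S_le1I:
  assumes "smooth \<phi>" "\<And>x. \<phi> (- x) = \<phi> x" "\<And>x. 1 < \<bar>x\<bar> \<Longrightarrow> \<phi> x = 0"
  shows "\<phi> \<in> S_le1"
proof -
  have "closure {x. \<phi> x \<noteq> 0} \<subseteq> {-1..1}"
  proof (rule closure_minimal)
    show "{x. \<phi> x \<noteq> 0} \<subseteq> {-1..1}" using assms(3) by force
  qed simp
  then show ?thesis using assms by (simp add: S_le1_def)
qed

lemma S_le1_even: "\<phi> \<in> S_le1 \<Longrightarrow> \<phi> (- x) = \<phi> x" by (simp add: S_le1_def)

lemma S_le1_smooth: "\<phi> \<in> S_le1 \<Longrightarrow> smooth \<phi>" by (simp add: S_le1_def)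

lemma S_le1_add: "f \<in> S_le1 \<Longrightarrow> g \<in> S_le1 \<Longrightarrow> (\<lambda>x. f x + g x) \<in> S_le1"
  by (rule S_le1I) (simp_all add: S_le1_even S_le1_zero S_le1_smooth smooth_add)

lemma S_le1_cmult: "f \<in> S_le1 \<Longrightarrow> (\<lambda>x. c * f x) \<in> S_le1"
  by (rule S_le1I) (simp_all add: S_le1_even S_le1_zero S_le1_smooth smooth_cmult)

lemma S_le1_scale:
  assumes "f \<in> S_le1" "w \<ge> 1" shows "(\<lambda>x. f (w * x)) \<in> S_le1"
proof (rule S_le1I)
  show "f (w * x) = 0" if "1 < \<bar>x\<bar>" for x
  proof (rule S_le1_zero[OF assms(1)])
    have "1 * \<bar>x\<bar> \<le> w * \<bar>x\<bar>" using assms(2) by (intro mult_right_mono) auto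
    then show "1 < \<bar>w * x\<bar>" using that assms(2) by (simp add: abs_mult)
  qed
  show "f (w * - x) = f (w * x)" for x using S_le1_even[OF assms(1), of "w * x"] by simp
qed (use assms in \<open>simp add: S_le1_smooth smooth_scale\<close>)

text \<open>The vanishing includes the boundary points \<open>1\<close> and \<open>-1\<close>, where
  it follows from the continuity of \<open>D n\<close> by approaching them from outside. This
  removes the boundary terms in all later integrations by parts.\<close>

lemma S_le1_derivs:
  assumes "\<phi> \<in> S_le1"
  obtains D where "D 0 = \<phi>" "\<And>n x. (D n has_vector_derivative D (Suc n) x) (at x)"
    "\<And>n x. 1 \<le> \<bar>x\<bar> \<Longrightarrow> D n x = 0"
proof -
  from assms obtain D where D: "D 0 = \<phi>" "\<And>n x. (D n has_vector_derivative D (Suc n) x) (at x)"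
    unfolding S_le1_def smooth_def by blast
  have op: "open {x::real. 1 < \<bar>x\<bar>}" by (intro open_Collect_less continuous_intros)
  have z: "D n x = 0" if "1 < \<bar>x\<bar>" for n x
    using that
  proof (induction n arbitrary: x)
    case 0 then show ?case using S_le1_zero[OF assms] D(1) by simp
  next
    case (Suc n)
    have "((\<lambda>_. 0) has_vector_derivative D (Suc n) x) (at x)"
      by (rule has_vector_derivative_transform_within_open[OF D(2)[of n x] op]) (use Suc in auto)
    then show ?case by (rule vector_derivative_unique_at) simp
  qed
  have "D n x = 0" if "1 \<le> \<bar>x\<bar>" for n x
  proof -
    have c: "continuous (at x) (D n)" using D(2) has_vector_derivative_continuous by blast
    have "((\<lambda>k. D n (x * (1 + inverse (real (Suc k))))) \<longlongrightarrow> D n x) sequentially"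
    proof (rule continuous_within_tendsto_compose'[OF c])
      have "(\<lambda>k. x * (1 + inverse (real (Suc k)))) \<longlonglongrightarrow> x * (1 + 0)"
        by (intro tendsto_intros LIMSEQ_inverse_real_of_nat)
      then show "(\<lambda>k. x * (1 + inverse (real (Suc k)))) \<longlonglongrightarrow> x" by simp
    qed auto
    moreover have "D n (x * (1 + inverse (real (Suc k)))) = 0" for k
    proof (rule z)
      have "1 * 1 < \<bar>x\<bar> * (1 + inverse (real (Suc k)))"
        using that by (intro mult_le_less_imp_less) auto
      then show "1 < \<bar>x * (1 + inverse (real (Suc k)))\<bar>" by (simp add: abs_mult)
    qed
    ultimately show ?thesis by (simp add: LIMSEQ_const_iff)
  qed
  with D that show ?thesis by blast
qed

section \<open>Bump functions: smoothness, size and first derivative\<close>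

lemma exp_minus_le_fact:
  fixes y :: real assumes y: "y > 0"
  shows "exp (- y) \<le> fact n / y ^ n"
proof -
  have "(\<Sum>k\<in>{n}. y^k /\<^sub>R fact k) \<le> exp y"
    unfolding sums_unique[OF exp_converges[of y]]
    by (rule sum_le_suminf[OF sums_summable[OF exp_converges]]) (use y in auto)
  then show ?thesis using y by (simp add: exp_minus field_simps)
qed

text \<open>The factor \<open>x powr (- \<i> * t)\<close> makes the Mellin integrand positive at all \<open>s\<close> with \<open>Im s = t\<close>.
  The support shrinks to 1 with \<open>\<eta>\<close>, which will be taken of the order of \<open>1/(1+|s|)\<close>, so that the Mellin
  transform at \<open>s\<close> is not exponentially small in \<open>Re s\<close>.\<close>

definition bump_fun :: "real \<Rightarrow> real \<Rightarrow> complex \<Rightarrow> complex" where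
  "bump_fun \<eta> t z = exp (- (of_real \<eta> / (z - of_real (1 - \<eta>))) - of_real \<eta> / (1 - z) - \<i> * of_real t * Ln z)"

definition bump :: "real \<Rightarrow> real \<Rightarrow> real \<Rightarrow> complex" where
  "bump \<eta> t x = (if 1 - \<eta> < \<bar>x\<bar> \<and> \<bar>x\<bar> < 1 then bump_fun \<eta> t (of_real \<bar>x\<bar>) else 0)"

text \<open>In the disc, \<open>Re w \<ge> p / 2\<close> and \<open>norm w \<le> 3 * p / 2\<close>,
  so the real part of \<open>1 / w\<close>, which is \<open>Re w\<close> over the squared modulus,
  is at least \<open>(p / 2) / (9 * p\<^sup>2 / 4) = 2 / (9 * p)\<close>.\<close>

lemma Re_divide_lower:
  fixes w :: complex
  assumes "norm (w - of_real p) \<le> p / 2" "p > 0" "\<eta> > 0"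
  shows "Re (of_real \<eta> / w) \<ge> 2 * \<eta> / (9 * p)"
proof -
  have "\<bar>Re w - p\<bar> \<le> p / 2" using abs_Re_le_cmod[of "w - of_real p"] assms by simp
  then have r: "Re w \<ge> p / 2" by linarith
  have "norm w \<le> 3 * p / 2" using norm_triangle_ineq2[of w "of_real p"] assms by simp
  then have "(norm w)\<^sup>2 \<le> (3 * p / 2)\<^sup>2" by (intro power_mono) auto
  then have n: "(norm w)\<^sup>2 \<le> 9 * p\<^sup>2 / 4" by (simp add: power2_eq_square)
  have w0: "(norm w)\<^sup>2 > 0" using r assms by auto
  have "2 * \<eta> / (9 * p) = \<eta> * (p / 2) / (9 * p\<^sup>2 / 4)" using assms by (simp add: power2_eq_square)
  also have "\<dots> \<le> \<eta> * Re w / (norm w)\<^sup>2"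
    using r n w0 assms by (intro frac_le mult_left_mono) auto
  also have "\<dots> = Re (of_real \<eta> / w)"
    by (simp add: Re_divide cmod_power2)
  finally show ?thesis .
qed

lemma smooth_half_bump:
  assumes \<eta>: "0 < \<eta>" "\<eta> \<le> 1/2"
  shows "smooth (\<lambda>x. if 1 - \<eta> < x \<and> x < 1 then bump_fun \<eta> t (of_real x) else 0)"
proof (rule smooth_flat_extension)
  let ?U = "{z::complex. 1 - \<eta> < Re z} \<inter> {z. Re z < 1}"
  let ?d = "\<lambda>x. min (x - (1 - \<eta>)) (1 - x) / 2"
  show "open ?U" by (intro open_Int open_halfspace_Re_gt open_halfspace_Re_lt)
  show "bump_fun \<eta> t holomorphic_on ?U" unfolding bump_fun_def
    using \<eta> by (intro holomorphic_intros) (auto elim!: nonpos_Reals_cases)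
  show "cball (of_real x) (?d x) \<subseteq> ?U" if x: "1 - \<eta> < x" "x < 1" for x
  proof
    fix z :: complex assume "z \<in> cball (of_real x) (?d x)"
    then have "\<bar>Re z - x\<bar> \<le> ?d x"
      using abs_Re_le_cmod[of "z - of_real x"] by (simp add: dist_norm norm_minus_commute)
    then have "\<bar>Re z - x\<bar> \<le> (x - (1 - \<eta>)) / 2" "\<bar>Re z - x\<bar> \<le> (1 - x) / 2"
      unfolding min_def by (auto split: if_splits)
    then show "z \<in> ?U" using x by (auto simp: abs_if split: if_splits)
  qed
  show "\<exists>C. \<forall>x. 1 - \<eta> < x \<longrightarrow> x < 1 \<longrightarrow> (\<forall>z\<in>cball (of_real x) (?d x). norm (bump_fun \<eta> t z) \<le> C * ?d x ^ n)" for n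
  proof (intro exI allI impI ballI)
    fix x z assume x: "1 - \<eta> < x" "x < 1" and z: "z \<in> cball (complex_of_real x) (?d x)"
    define d where "d = ?d x"
    have d: "d > 0" using x by (simp add: d_def)
    define p q where "p = x - (1 - \<eta>)" and "q = 1 - x"
    have pq: "p > 0" "q > 0" "d \<le> p / 2" "d \<le> q / 2" "p = 2 * d \<or> q = 2 * d"
      using x by (auto simp: p_def q_def d_def min_def)
    have nz: "norm (z - of_real x) \<le> d" using z by (simp add: d_def dist_norm norm_minus_commute)
    have "(z - of_real (1 - \<eta>)) - of_real p = z - of_real x" by (simp add: p_def)
    then have 1: "Re (of_real \<eta> / (z - of_real (1 - \<eta>))) \<ge> 2 * \<eta> / (9 * p)"
    proof (intro Re_divide_lower)
      show "norm (z - of_real (1 - \<eta>) - of_real p) \<le> p / 2"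
        unfolding \<open>(z - of_real (1 - \<eta>)) - of_real p = z - of_real x\<close> using nz pq by linarith
    qed (use pq \<eta> in auto)
    have "(1 - z) - of_real q = of_real x - z" by (simp add: q_def)
    then have 2: "Re (of_real \<eta> / (1 - z)) \<ge> 2 * \<eta> / (9 * q)"
    proof (intro Re_divide_lower)
      show "norm (1 - z - of_real q) \<le> q / 2"
        unfolding \<open>1 - z - of_real q = of_real x - z\<close> norm_minus_commute[of "of_real x" z] using nz pq by linarith
    qed (use pq \<eta> in auto)
    have "2 * \<eta> / (9 * p) \<ge> 0" "2 * \<eta> / (9 * q) \<ge> 0" using pq \<eta> by auto
    moreover have "2 * \<eta> / (9 * p) = \<eta> / (9 * d) \<or> 2 * \<eta> / (9 * q) = \<eta> / (9 * d)" using pq(5) by auto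
    \<comment> \<open>The endpoint nearer to \<open>x\<close> is at distance \<open>2 * d\<close>;
      its fraction alone contributes \<open>\<eta> / (9 * d)\<close>, and the other fraction has
      nonnegative real part.\<close>
    ultimately have 3: "Re (of_real \<eta> / (z - of_real (1 - \<eta>))) + Re (of_real \<eta> / (1 - z)) \<ge> \<eta> / (9 * d)"
      using 1 2 by linarith
    have z0: "z \<noteq> 0"
    proof
      assume "z = 0"
      then have "x \<le> d" using nz by (simp add: abs_le_iff)
      then show False using x \<eta> pq by (simp add: p_def)
    qed
    \<comment> \<open>Off the real axis the oscillating power of \<open>z\<close> no longer has
      modulus 1, but the argument of \<open>z\<close> is at most \<open>pi\<close>, so it costs only
      a constant independent of \<open>d\<close>.\<close>
    have "- Re (\<i> * of_real t * Ln z) = t * Im (Ln z)" by simp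
    also have "\<dots> \<le> \<bar>t\<bar> * \<bar>Im (Ln z)\<bar>" by (metis abs_ge_self abs_mult)
    also have "\<dots> \<le> \<bar>t\<bar> * pi"
      using mpi_less_Im_Ln[OF z0] Im_Ln_le_pi[OF z0] by (intro mult_left_mono) auto
    finally have 4: "- Re (\<i> * of_real t * Ln z) \<le> \<bar>t\<bar> * pi" .
    have "norm (bump_fun \<eta> t z) = exp (- (Re (of_real \<eta> / (z - of_real (1 - \<eta>))) + Re (of_real \<eta> / (1 - z))) - Re (\<i> * of_real t * Ln z))"
      unfolding bump_fun_def norm_exp_eq_Re minus_complex.simps uminus_complex.simps by (rule arg_cong[where f = exp]) linarith
    also have "\<dots> \<le> exp (- (\<eta> / (9 * d)) + \<bar>t\<bar> * pi)" using 3 4 by simp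
    also have "\<dots> = exp (- (\<eta> / (9 * d))) * exp (\<bar>t\<bar> * pi)" by (rule exp_add)
    also have "\<dots> \<le> fact n / (\<eta> / (9 * d)) ^ n * exp (\<bar>t\<bar> * pi)"
      using d \<eta> by (intro mult_right_mono exp_minus_le_fact) auto
    also have "\<dots> = (fact n * (9 / \<eta>) ^ n * exp (\<bar>t\<bar> * pi)) * d ^ n"
      using d \<eta> by (simp add: power_divide power_mult_distrib)
    finally show "norm (bump_fun \<eta> t z) \<le> (fact n * (9 / \<eta>) ^ n * exp (\<bar>t\<bar> * pi)) * ?d x ^ n"
      by (simp add: d_def)
  qed
qed

lemma bump_in_S_le1:
  assumes \<eta>: "0 < \<eta>" "\<eta> \<le> 1/2"
  shows "bump \<eta> t \<in> S_le1"
proof (rule S_le1I)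
  let ?f = "\<lambda>x. if 1 - \<eta> < x \<and> x < 1 then bump_fun \<eta> t (of_real x) else 0"
  have "bump \<eta> t = (\<lambda>x. ?f x + ?f (-1 * x))" using \<eta> by (auto simp: bump_def fun_eq_iff abs_if)
  then show "smooth (bump \<eta> t)" using smooth_add[OF smooth_half_bump[OF \<eta>, of t] smooth_scale[OF smooth_half_bump[OF \<eta>, of t], of "-1"]] by simp
qed (auto simp: bump_def)

lemma bump_eq:
  assumes "0 < \<eta>" "\<eta> \<le> 1/2" "1 - \<eta> < x" "x < 1"
  shows "bump \<eta> t x = of_real (exp (- (\<eta> / (x - (1 - \<eta>))) - \<eta> / (1 - x))) * of_real x powr (- \<i> * of_real t)"
proof -
  have x: "x > 0" using assms by simp
  have "bump \<eta> t x = exp (of_real (- (\<eta> / (x - (1 - \<eta>))) - \<eta> / (1 - x)) + (- \<i> * of_real t) * Ln (of_real x))"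
    using assms by (simp add: bump_def bump_fun_def)
  also have "\<dots> = exp (of_real (- (\<eta> / (x - (1 - \<eta>))) - \<eta> / (1 - x))) * exp ((- \<i> * of_real t) * Ln (of_real x))"
    by (rule exp_add)
  finally show ?thesis using x by (simp only: exp_of_real powr_def) simp
qed

lemma norm_bump_le_1:
  assumes "0 < \<eta>" "\<eta> \<le> 1/2"
  shows "norm (bump \<eta> t x) \<le> 1"
proof -
  have 1: "norm (bump \<eta> t x) \<le> 1" if "1 - \<eta> < x" "x < 1" for x
  proof -
    have "norm (of_real x powr (- \<i> * of_real t) :: complex) = 1"
      using that assms by (subst norm_powr_real) auto
    moreover have "exp (- (\<eta> / (x - (1 - \<eta>))) - \<eta> / (1 - x)) \<le> 1"
    proof -
      have "\<eta> / (x - (1 - \<eta>)) \<ge> 0" "\<eta> / (1 - x) \<ge> 0" using that assms by auto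
      then show ?thesis unfolding exp_le_one_iff by linarith
    qed
    ultimately show ?thesis using bump_eq[OF assms that, of t] by (simp add: norm_mult)
  qed
  have "bump \<eta> t x = bump \<eta> t \<bar>x\<bar>" by (simp add: bump_def)
  then show ?thesis using 1[of "\<bar>x\<bar>"] by (cases "1 - \<eta> < \<bar>x\<bar> \<and> \<bar>x\<bar> < 1") (auto simp: bump_def)
qed

lemma square_exp_bound: "\<eta> > 0 \<Longrightarrow> p > 0 \<Longrightarrow> exp (- (\<eta> / p)) * (\<eta> / p\<^sup>2) \<le> 2 / \<eta>" for \<eta> p :: real
proof -
  assume a: "\<eta> > 0" "p > 0"
  have "exp (- (\<eta> / p)) * (\<eta> / p\<^sup>2) \<le> fact 2 / (\<eta> / p)\<^sup>2 * (\<eta> / p\<^sup>2)"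
    using a by (intro mult_right_mono exp_minus_le_fact) auto
  also have "\<dots> = 2 / \<eta>" using a by (simp add: power2_eq_square)
  finally show ?thesis .
qed

text \<open>The logarithmic derivative has the singular terms \<open>\<eta> / p\<^sup>2\<close> and
  \<open>\<eta> / q\<^sup>2\<close>; each is absorbed by its own exponential factor, leaving
  \<open>2 / \<eta>\<close>. The power of \<open>x\<close> contributes at most
  \<open>2 * \<bar>t\<bar>\<close>, as \<open>x > 1/2\<close> on the support. The point is the
  merely linear growth in \<open>1 / \<eta>\<close> and \<open>t\<close>.\<close>

lemma bump_derivative:
  assumes \<eta>: "0 < \<eta>" "\<eta> \<le> 1/2"
    and D: "\<And>x. (bump \<eta> t has_vector_derivative D x) (at x)"
  shows "norm (D x) \<le> 4 / \<eta> + 2 * \<bar>t\<bar>"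
proof -
  have pos: "norm (D x) \<le> 4 / \<eta> + 2 * \<bar>t\<bar>" if x: "x > 0" for x
  proof (cases "1 - \<eta> < x \<and> x < 1")
    case True
    define p q where "p = x - (1 - \<eta>)" and "q = 1 - x"
    have pq: "p > 0" "q > 0" using True by (auto simp: p_def q_def)
    define c where "c = of_real \<eta> / (of_real p)\<^sup>2 - of_real \<eta> / (of_real q)\<^sup>2 - \<i> * of_real t / of_real x"
    have "(bump_fun \<eta> t has_field_derivative bump_fun \<eta> t (of_real x) * c) (at (of_real x))"
    proof -
      have e: "of_real x - of_real (1 - \<eta>) = (of_real p :: complex)" "1 - of_real x = (of_real q :: complex)"
        by (auto simp: p_def q_def)
      show ?thesis unfolding bump_fun_def c_def
        by (rule derivative_eq_intros refl | use x pq e in \<open>force simp: power2_eq_square divide_simps\<close>)+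
    qed
    then have "((\<lambda>x. bump_fun \<eta> t (of_real x)) has_vector_derivative bump_fun \<eta> t (of_real x) * c) (at x)"
      by (rule has_vector_derivative_real_field)
    then have "(bump \<eta> t has_vector_derivative bump_fun \<eta> t (of_real x) * c) (at x)"
      by (rule has_vector_derivative_transform_within_open[of _ _ _ "{1-\<eta><..<1}"]) (use True \<eta> in \<open>auto simp: bump_def\<close>)
    then have "D x = bump_fun \<eta> t (of_real x) * c" using D vector_derivative_unique_at by blast
    then have Dx: "D x = bump \<eta> t x * c" using True x by (simp add: bump_def)
    have "norm (of_real x powr (- \<i> * of_real t) :: complex) = 1"
      using x by (subst norm_powr_real) auto
    then have nb: "norm (bump \<eta> t x) = exp (- (\<eta> / p)) * exp (- (\<eta> / q))"
      using bump_eq[OF \<eta>, of x t] True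
      by (simp only: norm_mult norm_of_real abs_exp_cancel p_def q_def mult_exp_exp) simp
    have "norm c \<le> \<eta> / p\<^sup>2 + \<eta> / q\<^sup>2 + \<bar>t\<bar> / x"
      unfolding c_def using \<eta> x
      by (intro order_trans[OF norm_triangle_ineq4] add_mono) (auto simp: norm_divide norm_power norm_mult)
    then have "norm (D x) \<le> norm (bump \<eta> t x) * (\<eta> / p\<^sup>2 + \<eta> / q\<^sup>2 + \<bar>t\<bar> / x)"
      unfolding Dx norm_mult by (intro mult_left_mono) auto
    also have "\<dots> = norm (bump \<eta> t x) * (\<eta> / p\<^sup>2) + norm (bump \<eta> t x) * (\<eta> / q\<^sup>2) + norm (bump \<eta> t x) * (\<bar>t\<bar> / x)"
      by (simp add: algebra_simps)
    also have "\<dots> \<le> 2 / \<eta> + 2 / \<eta> + 1 * (\<bar>t\<bar> / x)"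
    proof (intro add_mono mult_right_mono)
      have "norm (bump \<eta> t x) * (\<eta> / p\<^sup>2) = exp (- (\<eta> / q)) * (exp (- (\<eta> / p)) * (\<eta> / p\<^sup>2))" by (simp add: nb)
      also have "\<dots> \<le> 1 * (2 / \<eta>)" using pq \<eta> by (intro mult_mono square_exp_bound) auto
      finally show "norm (bump \<eta> t x) * (\<eta> / p\<^sup>2) \<le> 2 / \<eta>" by simp
      have "norm (bump \<eta> t x) * (\<eta> / q\<^sup>2) = exp (- (\<eta> / p)) * (exp (- (\<eta> / q)) * (\<eta> / q\<^sup>2))" by (simp add: nb)
      also have "\<dots> \<le> 1 * (2 / \<eta>)" using pq \<eta> by (intro mult_mono square_exp_bound) auto
      finally show "norm (bump \<eta> t x) * (\<eta> / q\<^sup>2) \<le> 2 / \<eta>" by simp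
    qed (use norm_bump_le_1[OF \<eta>] x in auto)
    also have "\<dots> \<le> 4 / \<eta> + 2 * \<bar>t\<bar>"
    proof -
      have "1 \<le> 2 * x" using True \<eta> by simp
      then have "\<bar>t\<bar> * 1 \<le> \<bar>t\<bar> * (2 * x)" by (intro mult_left_mono) auto
      then have "\<bar>t\<bar> / x \<le> 2 * \<bar>t\<bar>" using x by (simp add: divide_le_eq mult_ac)
      then show ?thesis by simp
    qed
    finally show ?thesis .
  next
    case False
    obtain E where E: "E 0 = bump \<eta> t" "\<And>n x. (E n has_vector_derivative E (Suc n) x) (at x)"
      "\<And>n x. 1 \<le> \<bar>x\<bar> \<Longrightarrow> E n x = 0" using S_le1_derivs[OF bump_in_S_le1[OF \<eta>]] by metis
    have DE: "D x = E 1 x" for x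
      using D[of x] E(2)[of 0 x] E(1) vector_derivative_unique_at by simp
    have lt: "E 1 x = 0" if "\<bar>x\<bar> < 1 - \<eta>" for x
    proof -
      have "((\<lambda>_. 0) has_vector_derivative E 1 x) (at x)"
        by (rule has_vector_derivative_transform_within_open[where f = "E 0" and S = "{-(1-\<eta>)<..<1-\<eta>}"])
           (use that E(1) E(2)[of 0 x] in \<open>auto simp: bump_def\<close>)
      then show ?thesis by (rule vector_derivative_unique_at) simp
    qed
    have "E 1 x = 0"
    proof (cases "x \<ge> 1")
      case True then show ?thesis using E(3) by simp
    next
      case F2: False
      have c: "continuous (at x) (E 1)" using E(2) has_vector_derivative_continuous by blast
      have "((\<lambda>k. E 1 (x - x * inverse (real (Suc k)))) \<longlongrightarrow> E 1 x) sequentially"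
      proof (rule continuous_within_tendsto_compose'[OF c])
        have "(\<lambda>k. x - x * inverse (real (Suc k))) \<longlonglongrightarrow> x - x * 0"
          by (intro tendsto_intros LIMSEQ_inverse_real_of_nat)
        then show "(\<lambda>k. x - x * inverse (real (Suc k))) \<longlonglongrightarrow> x" by simp
      qed auto
      moreover have "E 1 (x - x * inverse (real (Suc k))) = 0" for k
      proof (rule lt)
        have "x * inverse (real (Suc k)) \<le> x" "x * inverse (real (Suc k)) > 0" using x by (auto simp: field_simps)
        then show "\<bar>x - x * inverse (real (Suc k))\<bar> < 1 - \<eta>" using F2 False x by linarith
      qed
      ultimately show ?thesis by (simp add: LIMSEQ_const_iff)
    qed
    then show ?thesis using DE \<eta> by simp
  qed
  have neg: "D (- x) = - D x" for x
  proof -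
    have "((bump \<eta> t \<circ> (\<lambda>x. -1 * x)) has_vector_derivative ((-1) *\<^sub>R D (-1 * x))) (at x)"
      by (rule vector_diff_chain_at) (use D in \<open>auto intro!: derivative_eq_intros\<close>)
    moreover have "bump \<eta> t \<circ> (\<lambda>x. -1 * x) = bump \<eta> t" by (auto simp: bump_def)
    ultimately have "(bump \<eta> t has_vector_derivative - D (- x)) (at x)" by simp
    then have "- D (- x) = D x" using D vector_derivative_unique_at by blast
    then show ?thesis by (simp add: minus_equation_iff)
  qed
  consider "x > 0" | "x < 0" | "x = 0" by linarith
  then show ?thesis
  proof cases
    case 2 then show ?thesis using pos[of "- x"] neg[of x] by simp
  next
    case 3
    have "2 * D 0 = 0" using neg[of 0] by (simp add: add_eq_0_iff)
    then show ?thesis using 3 \<eta> by simp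
  qed (use pos in auto)
qed

section \<open>Truncated Mellin transforms and the map \<open>E\<close>\<close>

lemma set_integrable_powr_01:
  assumes "a > -1" shows "set_integrable lborel {0<..<1} (\<lambda>u::real. u powr a)"
proof -
  have "((\<lambda>x. x powr a) has_integral (1 powr (a+1) / (a+1))) {0..1}"
    by (rule has_integral_powr_from_0) (use assms in auto)
  then have "(\<lambda>x. x powr a) absolutely_integrable_on {0..1}"
    by (intro nonnegative_absolutely_integrable_1) (auto simp: integrable_on_def)
  then have "set_integrable lborel {0..1} (\<lambda>u::real. u powr a)"
    unfolding set_integrable_def by (subst (asm) integrable_completion) auto
  then show ?thesis by (rule set_integrable_subset) auto
qed

lemma set_integrable_powr_1_inf:
  assumes "a < -1" shows "set_integrable lborel {1<..} (\<lambda>u::real. u powr a)"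
proof -
  have "((\<lambda>x. x powr a) has_integral - (1 powr (a+1)) / (a+1)) {1..}"
    by (rule has_integral_powr_to_inf) (use assms in auto)
  then have "(\<lambda>x. x powr a) absolutely_integrable_on {1..}"
    by (intro nonnegative_absolutely_integrable_1) (auto simp: integrable_on_def)
  then have "set_integrable lborel {1..} (\<lambda>u::real. u powr a)"
    unfolding set_integrable_def by (subst (asm) integrable_completion) auto
  then show ?thesis by (rule set_integrable_subset) auto
qed

lemma norm_powr_of_real: "u > 0 \<Longrightarrow> norm (of_real u powr s :: complex) = u powr Re s"
  by (simp add: norm_powr_real powr_def)

lemma isCont_powr_of_real: "u > 0 \<Longrightarrow> isCont (\<lambda>u::real. of_real u powr s :: complex) u"
  by (intro continuous_intros) (auto elim!: nonpos_Reals_cases)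

lemma measurable_powr_of_real [measurable]: "(\<lambda>u::real. of_real u powr s :: complex) \<in> borel_measurable borel"
  unfolding powr_def by measurable

lemma set_integrable_cpowr_01:
  assumes "Re s > -1" shows "set_integrable lborel {0<..<1} (\<lambda>u::real. of_real u powr s :: complex)"
  by (rule set_integrable_bound[OF set_integrable_powr_01[OF assms]])
     (auto simp: set_borel_measurable_def norm_powr_of_real)

lemma set_integrable_cpowr_1_inf:
  assumes "Re s < -1" shows "set_integrable lborel {1<..} (\<lambda>u::real. of_real u powr s :: complex)"
  by (rule set_integrable_bound[OF set_integrable_powr_1_inf[OF assms]])
     (auto simp: set_borel_measurable_def norm_powr_of_real)

lemma has_vector_derivative_cpowr:
  fixes s :: complex
  assumes "u > 0" "s \<noteq> -1"
  shows "((\<lambda>u::real. of_real u powr (s + 1) / (s + 1)) has_vector_derivative of_real u powr s) (at u)"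
proof -
  have "s + 1 \<noteq> 0" using assms(2) by (metis add.commute add_cancel_left_right add_eq_0_iff)
  then have "((\<lambda>z::complex. z powr (s + 1) / (s + 1)) has_field_derivative of_real u powr s) (at (of_real u))"
    using assms by (auto intro!: derivative_eq_intros elim!: nonpos_Reals_cases)
  then show ?thesis by (rule has_vector_derivative_real_field)
qed

lemma integral_cpowr_01:
  assumes "Re s > -1"
  shows "(LINT u:{0<..<1}|lborel. of_real u powr s) = 1 / (s + 1)"
proof -
  have s: "s \<noteq> -1" using assms by auto
  have "(LBINT u=ereal 0..ereal 1. of_real u powr s) = 1 / (s + 1) - 0"
  proof (rule interval_integral_FTC_integrable)
    show "set_integrable lborel (einterval (ereal 0) (ereal 1)) (\<lambda>u. of_real u powr s :: complex)"
      using set_integrable_cpowr_01[OF assms] by (simp add: einterval_eq)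
    have "isCont (\<lambda>u::real. of_real u powr (s+1) / (s+1) :: complex) 1"
      using s by (intro continuous_intros isCont_powr_of_real) (auto simp: add_eq_0_iff2)
    then have "((\<lambda>u::real. of_real u powr (s+1) / (s+1) :: complex) \<longlongrightarrow> of_real 1 powr (s+1) / (s+1)) (at_left 1)"
      by (simp add: isCont_def filterlim_at_split)
    then show "(((\<lambda>u::real. of_real u powr (s+1) / (s+1) :: complex) \<circ> real_of_ereal) \<longlongrightarrow> 1 / (s+1)) (at_left (ereal 1))"
      by (simp add: ereal_tendsto_simps)
    have "((\<lambda>u::real. u powr Re (s+1)) \<longlongrightarrow> 0 powr Re (s + 1)) (at_right 0)"
      using assms by (intro tendsto_powr' tendsto_intros) (auto intro: eventually_mono[OF eventually_at_right_less])
    then have L: "((\<lambda>u::real. u powr Re (s+1) / norm (s+1)) \<longlongrightarrow> 0 / norm (s+1)) (at_right 0)"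
      using s by (intro tendsto_divide) (auto simp: add_eq_0_iff2)
    have "((\<lambda>u::real. of_real u powr (s+1) / (s+1) :: complex) \<longlongrightarrow> 0) (at_right 0)"
    proof (rule Lim_null_comparison[of _ "\<lambda>u. u powr Re (s+1) / norm (s+1)"])
      show "\<forall>\<^sub>F u in at_right 0. norm (of_real u powr (s+1) / (s+1) :: complex) \<le> u powr Re (s+1) / norm (s+1)"
        using eventually_at_right_less[of "0::real"] by eventually_elim (simp add: norm_divide norm_powr_of_real)
    qed (use L in simp)
    then show "(((\<lambda>u::real. of_real u powr (s+1) / (s+1) :: complex) \<circ> real_of_ereal) \<longlongrightarrow> 0) (at_right (ereal 0))"
      by (simp add: ereal_tendsto_simps)
  qed (use s in \<open>auto intro!: has_vector_derivative_cpowr isCont_powr_of_real\<close>)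
  then show ?thesis by (simp add: interval_lebesgue_integral_def einterval_eq)
qed

lemma integral_cpowr_1_inf:
  assumes "Re s < -1"
  shows "(LINT u:{1<..}|lborel. of_real u powr s) = - 1 / (s + 1)"
proof -
  have s: "s \<noteq> -1" using assms by auto
  have "(LBINT u=ereal 1..\<infinity>. of_real u powr s) = 0 - 1 / (s + 1)"
  proof (rule interval_integral_FTC_integrable)
    show "set_integrable lborel (einterval (ereal 1) \<infinity>) (\<lambda>u. of_real u powr s :: complex)"
      using set_integrable_cpowr_1_inf[OF assms] by (simp add: einterval_eq)
    have "isCont (\<lambda>u::real. of_real u powr (s+1) / (s+1) :: complex) 1"
      using s by (intro continuous_intros isCont_powr_of_real) (auto simp: add_eq_0_iff2)
    then have "((\<lambda>u::real. of_real u powr (s+1) / (s+1) :: complex) \<longlongrightarrow> of_real 1 powr (s+1) / (s+1)) (at_right 1)"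
      by (simp add: isCont_def filterlim_at_split)
    then show "(((\<lambda>u::real. of_real u powr (s+1) / (s+1) :: complex) \<circ> real_of_ereal) \<longlongrightarrow> 1 / (s+1)) (at_right (ereal 1))"
      by (simp add: ereal_tendsto_simps)
    have "((\<lambda>u::real. u powr Re (s+1)) \<longlongrightarrow> 0) at_top"
      using assms by (intro tendsto_neg_powr filterlim_ident) auto
    then have L: "((\<lambda>u::real. u powr Re (s+1) / norm (s+1)) \<longlongrightarrow> 0 / norm (s+1)) at_top"
      using s by (intro tendsto_divide) (auto simp: add_eq_0_iff2)
    have "((\<lambda>u::real. of_real u powr (s+1) / (s+1) :: complex) \<longlongrightarrow> 0) at_top"
    proof (rule Lim_null_comparison[of _ "\<lambda>u. u powr Re (s+1) / norm (s+1)"])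
      show "\<forall>\<^sub>F u in at_top. norm (of_real u powr (s+1) / (s+1) :: complex) \<le> u powr Re (s+1) / norm (s+1)"
        using eventually_gt_at_top[of "0::real"] by eventually_elim (simp add: norm_divide norm_powr_of_real)
    qed (use L in simp)
    then show "(((\<lambda>u::real. of_real u powr (s+1) / (s+1) :: complex) \<circ> real_of_ereal) \<longlongrightarrow> 0) (at_left \<infinity>)"
      by (simp add: ereal_tendsto_simps)
  next
    fix x assume "ereal 1 < ereal x"
    then have "x > 0" by simp
    then show "((\<lambda>u::real. of_real u powr (s+1) / (s+1)) has_vector_derivative of_real x powr s) (at x)"
      "isCont (\<lambda>u::real. of_real u powr s :: complex) x"
      using s by (auto intro!: has_vector_derivative_cpowr isCont_powr_of_real)
  qed auto
  then show ?thesis by (simp add: interval_lebesgue_integral_def einterval_eq)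
qed

text \<open>Truncating at 1 loses nothing: test functions vanish beyond 1, and \<open>E_map\<close>
  of a test function is a multiple of \<open>1 / u\<close> there, whose Mellin integral is an
  explicit term with denominator \<open>s - 1\<close>.\<close>

definition mellin01 :: "(real \<Rightarrow> complex) \<Rightarrow> complex \<Rightarrow> complex" where
  "mellin01 G s = (LINT u:{0<..<1}|lborel. G u * of_real u powr (s - 1))"

lemma mellin01_integrable:
  assumes [measurable]: "G \<in> borel_measurable borel"
    and "set_integrable lborel {0<..<1} (\<lambda>u. norm (G u) * u powr (\<sigma> - 1))" "\<sigma> \<le> Re s"
  shows "set_integrable lborel {0<..<1} (\<lambda>u. G u * of_real u powr (s - 1))"
proof (rule set_integrable_bound[OF assms(2)])
  show "AE x in lborel. x \<in> {0<..<1} \<longrightarrow> norm (G x * of_real x powr (s - 1)) \<le> norm (norm (G x) * x powr (\<sigma> - 1))"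
    using assms(3) by (auto simp: norm_mult norm_powr_of_real intro!: mult_left_mono powr_mono')
qed (auto simp: set_borel_measurable_def)

lemma mellin01_holomorphic:
  assumes [measurable]: "G \<in> borel_measurable borel"
    and int: "\<And>\<sigma>. \<sigma> > \<sigma>0 \<Longrightarrow> set_integrable lborel {0<..<1} (\<lambda>u. norm (G u) * u powr (\<sigma> - 1))"
  shows "mellin01 G holomorphic_on {s. Re s > \<sigma>0}"
  unfolding mellin01_def set_lebesgue_integral_def
proof (rule holomorphic_on_integral_param)
  show "open {s. Re s > \<sigma>0}" by (rule open_halfspace_Re_gt)
  show "(\<lambda>s. indicator {0<..<1} x *\<^sub>R (G x * complex_of_real x powr (s - 1))) holomorphic_on {s. Re s > \<sigma>0}" for x
    by (cases "x > 0") (auto intro!: holomorphic_intros simp: indicator_def)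
next
  fix s0 assume s0: "s0 \<in> {s. Re s > \<sigma>0}"
  define r where "r = (Re s0 - \<sigma>0) / 2"
  define \<sigma> where "\<sigma> = Re s0 - r"
  have r: "r > 0" "\<sigma> > \<sigma>0" using s0 by (auto simp: r_def \<sigma>_def field_simps)
  show "\<exists>r>0. \<exists>h. integrable lborel h \<and> (\<forall>s\<in>ball s0 r \<inter> {s. Re s > \<sigma>0}. \<forall>x\<in>space lborel.
      norm (indicator {0<..<1} x *\<^sub>R (G x * complex_of_real x powr (s - 1))) \<le> h x)"
  proof (intro exI conjI ballI)
    show "r > 0" by (rule r)
    show "integrable lborel (\<lambda>u. indicator {0<..<1} u *\<^sub>R (norm (G u) * u powr (\<sigma> - 1)))"
      using int[OF r(2)] by (simp add: set_integrable_def)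
    fix s x assume s: "s \<in> ball s0 r \<inter> {s. Re s > \<sigma>0}"
    have "\<bar>Re (s0 - s)\<bar> < r" using s abs_Re_le_cmod[of "s0 - s"] by (simp add: dist_norm)
    then have "\<sigma> \<le> Re s" by (simp add: \<sigma>_def)
    then show "norm (indicator {0<..<1} x *\<^sub>R (G x * complex_of_real x powr (s - 1))) \<le> indicator {0<..<1} x *\<^sub>R (norm (G x) * x powr (\<sigma> - 1))"
      by (auto simp: norm_mult norm_powr_of_real indicator_def intro!: mult_left_mono powr_mono')
  qed
qed measurable

lemma bounded_mellin01_integrable:
  assumes [measurable]: "G \<in> borel_measurable borel"
    and "\<And>u. 0 < u \<Longrightarrow> u < 1 \<Longrightarrow> norm (G u) \<le> C * u powr a" "\<sigma> > - a"
  shows "set_integrable lborel {0<..<1} (\<lambda>u. norm (G u) * u powr (\<sigma> - 1))"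
proof (rule set_integrable_bound)
  show "set_integrable lborel {0<..<1} (\<lambda>u. C * u powr (a + \<sigma> - 1))"
    using assms(3) by (intro set_integrable_mult_right set_integrable_powr_01) auto
  have "norm (G x) * x powr (\<sigma> - 1) \<le> \<bar>C * x powr (a + \<sigma> - 1)\<bar>" if x: "0 < x" "x < 1" for x
  proof -
    have "norm (G x) * x powr (\<sigma> - 1) \<le> C * x powr a * x powr (\<sigma> - 1)"
      using assms(2)[OF x] by (intro mult_right_mono) auto
    also have "\<dots> = C * x powr (a + \<sigma> - 1)" by (simp add: powr_add[symmetric] algebra_simps)
    finally show ?thesis by simp
  qed
  then show "AE x in lborel. x \<in> {0<..<1} \<longrightarrow> norm (norm (G x) * x powr (\<sigma> - 1)) \<le> norm (C * x powr (a + \<sigma> - 1))"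
    by auto
qed (auto simp: set_borel_measurable_def)

lemma bounded_mellin01_norm:
  assumes [measurable]: "G \<in> borel_measurable borel"
    and bd: "\<And>u. 0 < u \<Longrightarrow> u < 1 \<Longrightarrow> norm (G u) \<le> C" and s: "Re s > 0"
  shows "norm (mellin01 G s) \<le> C / Re s"
proof -
  have "norm (mellin01 G s) \<le> (LINT u:{0<..<1}|lborel. C * u powr (Re s - 1))"
    unfolding mellin01_def set_lebesgue_integral_def
  proof (rule Bochner_Integration.integral_norm_bound_integral)
    have "set_integrable lborel {0<..<1} (\<lambda>u. G u * of_real u powr (s - 1))"
      by (rule mellin01_integrable[OF _ bounded_mellin01_integrable[where C = C and a = 0 and \<sigma> = "Re s"]])
         (use bd s in auto)
    then show "integrable lborel (\<lambda>u. indicator {0<..<1} u *\<^sub>R (G u * of_real u powr (s - 1)))"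
      by (simp add: set_integrable_def)
    show "integrable lborel (\<lambda>u. indicator {0<..<1} u *\<^sub>R (C * u powr (Re s - 1)))"
      using set_integrable_mult_right[OF set_integrable_powr_01[of "Re s - 1"], of C] s
      by (simp add: set_integrable_def)
  qed (auto simp: indicator_def norm_mult norm_powr_of_real intro!: mult_right_mono bd)
  also have "\<dots> = C * (LINT u:{0<..<1}|lborel. u powr (Re s - 1))" by simp
  also have "(LINT u:{0<..<1}|lborel. u powr (Re s - 1)) = 1 / Re s"
  proof -
    have "complex_of_real (LINT u:{0<..<1}|lborel. u powr (Re s - 1)) = (LINT u:{0<..<1}|lborel. of_real u powr (of_real (Re s - 1)))"
      unfolding set_integral_complex_of_real[symmetric]
      by (rule set_lebesgue_integral_cong) (auto simp: powr_of_real simp del: of_real_diff)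
    also have "\<dots> = complex_of_real (1 / Re s)" using s by (subst integral_cpowr_01) auto
    finally show ?thesis by (simp only: of_real_eq_iff)
  qed
  finally show ?thesis by simp
qed

text \<open>The bound on the derivative is that of \<open>B * arctan\<close>, whose increments telescope.\<close>

lemma riemann_sum_arctan:
  fixes \<phi> :: "real \<Rightarrow> complex"
  assumes d: "\<And>x. (\<phi> has_vector_derivative \<phi>' x) (at x)" and bd: "\<And>x. norm (\<phi>' x) \<le> B / (1 + x\<^sup>2)"
    and u: "u > 0"
  shows "norm (of_real u * (\<Sum>n<N. \<phi> (real (Suc n) * u)) - integral {0..real N * u} \<phi>) \<le> u * (B * arctan (real N * u))"
proof (induction N)
  case (Suc N)
  define a b where "a = real N * u" and "b = real (Suc N) * u"
  have ab: "0 \<le> a" "a < b" "b - a = u" using u by (auto simp: a_def b_def algebra_simps)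
  have c: "continuous_on S \<phi>" for S
    using d by (meson continuous_at_imp_continuous_on has_vector_derivative_continuous)
  have ig: "\<phi> integrable_on {x..y}" for x y by (rule integrable_continuous_real[OF c])
  have diff: "norm (\<phi> b - \<phi> x) \<le> B * arctan b - B * arctan a" if x: "x \<in> {a..b}" for x
  proof (cases "x = b")
    case True
    have "B \<ge> 0" using order_trans[OF norm_ge_zero bd[of 0]] by simp
    then show ?thesis using True ab by (simp add: arctan_le_iff mult_left_mono)
  next
    case False
    have B: "B \<ge> 0" using order_trans[OF norm_ge_zero bd[of 0]] by simp
    have "norm (\<phi> b - \<phi> x) \<le> B * arctan b - B * arctan x"
    proof (rule differentiable_bound_general[where f' = \<phi>' and \<phi>' = "\<lambda>x. B / (1 + x\<^sup>2)"])
      show "x < b" using x False by auto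
      show "((\<lambda>x. B * arctan x) has_vector_derivative B / (1 + y\<^sup>2)) (at y)" for y
        unfolding has_real_derivative_iff_has_vector_derivative[symmetric]
        by (auto intro!: derivative_eq_intros simp: divide_inverse)
    qed (use d bd c in \<open>auto intro!: continuous_intros\<close>)
    moreover have "B * arctan a \<le> B * arctan x" using x B by (intro mult_left_mono) (auto simp: arctan_le_iff)
    ultimately show ?thesis by simp
  qed
  have e: "of_real u * \<phi> b - integral {a..b} \<phi> = integral {a..b} (\<lambda>x. \<phi> b - \<phi> x)"
    using ab ig by (subst Henstock_Kurzweil_Integration.integral_diff) (auto simp: scaleR_conv_of_real)
  have "norm (integral {a..b} (\<lambda>x. \<phi> b - \<phi> x)) \<le> (B * arctan b - B * arctan a) * (b - a)"
    by (rule integral_bound) (use ab diff c in \<open>auto intro!: continuous_intros\<close>)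
  then have step: "norm (of_real u * \<phi> b - integral {a..b} \<phi>) \<le> u * (B * arctan b) - u * (B * arctan a)"
    using e ab by (simp add: algebra_simps)
  have "integral {0..b} \<phi> = integral {0..a} \<phi> + integral {a..b} \<phi>"
    using ab ig by (intro Henstock_Kurzweil_Integration.integral_combine[symmetric]) auto
  then have "of_real u * (\<Sum>n<Suc N. \<phi> (real (Suc n) * u)) - integral {0..b} \<phi>
     = (of_real u * (\<Sum>n<N. \<phi> (real (Suc n) * u)) - integral {0..a} \<phi>) + (of_real u * \<phi> b - integral {a..b} \<phi>)"
    by (simp add: b_def algebra_simps)
  also have "norm \<dots> \<le> u * (B * arctan a) + (u * (B * arctan b) - u * (B * arctan a))"
    using Suc step by (intro order_trans[OF norm_triangle_ineq] add_mono) (auto simp: a_def)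
  finally show ?case by (simp add: b_def)
qed simp

lemma S_le1_continuous: "\<phi> \<in> S_le1 \<Longrightarrow> continuous_on S \<phi>"
  by (metis S_le1_derivs continuous_at_imp_continuous_on has_vector_derivative_continuous)

lemma S_le1_measurable: "\<phi> \<in> S_le1 \<Longrightarrow> \<phi> \<in> borel_measurable borel"
  by (intro borel_measurable_continuous_onI S_le1_continuous)

lemma S_le1_zero': "\<phi> \<in> S_le1 \<Longrightarrow> 1 \<le> \<bar>x\<bar> \<Longrightarrow> \<phi> x = 0"
  by (metis S_le1_derivs)

lemma S_le1_integral:
  assumes "\<phi> \<in> S_le1" "b \<ge> 1"
  shows "(LINT x:{0<..}|lborel. \<phi> x) = integral {0..b} \<phi>"
proof -
  have m [measurable]: "\<phi> \<in> borel_measurable borel" using assms by (simp add: S_le1_measurable)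
  have "(LINT x:{0<..}|lborel. \<phi> x) = (LINT x:{0..b}|lborel. \<phi> x)"
    unfolding set_lebesgue_integral_def
  proof (rule integral_cong_AE)
    have "AE x in lborel. x \<noteq> (0::real)" by (rule AE_lborel_singleton)
    then show "AE x in lborel. indicator {0<..} x *\<^sub>R \<phi> x = indicator {0..b} x *\<^sub>R \<phi> x"
      by eventually_elim (use assms S_le1_zero'[OF assms(1)] in \<open>auto simp: indicator_def\<close>)
  qed measurable
  also have "\<dots> = integral {0..b} \<phi>"
    by (rule set_borel_integral_eq_integral) (intro borel_integrable_atLeastAtMost' S_le1_continuous assms)
  finally show ?thesis .
qed

lemma E_map_finite:
  assumes "\<phi> \<in> S_le1" "u > 0" "real N * u \<ge> 1"
  shows "E_map \<phi> u = (\<Sum>n<N. \<phi> (real (Suc n) * u)) - (LINT x:{0<..}|lborel. \<phi> x) / of_real u"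
proof -
  have "(\<Sum>n. \<phi> (real (Suc n) * u)) = (\<Sum>n<N. \<phi> (real (Suc n) * u))"
  proof (rule suminf_finite)
    fix n assume "n \<notin> {..<N}"
    then have "real N * u \<le> real (Suc n) * u" using assms(2) by (intro mult_right_mono) auto
    then show "\<phi> (real (Suc n) * u) = 0" using assms by (intro S_le1_zero'[OF assms(1)]) linarith
  qed auto
  then show ?thesis by (simp add: E_map_def)
qed

lemma E_map_ge_1: "\<phi> \<in> S_le1 \<Longrightarrow> u \<ge> 1 \<Longrightarrow> E_map \<phi> u = - (LINT x:{0<..}|lborel. \<phi> x) / of_real u"
  using E_map_finite[of \<phi> u 1] S_le1_zero'[of \<phi> u] by simp

text \<open>\<open>u * E_map \<phi> u\<close> is the error of the Riemann sum of step
  \<open>u\<close> for the integral of \<open>\<phi>\<close> over the half-line. Since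
  \<open>\<phi>'\<close> vanishes outside the unit interval, \<open>2 * B / (1 + x\<^sup>2)\<close>
  dominates it, and the error is at most \<open>u * (2 * B) * (pi / 2)\<close>, so that
  \<open>u\<close> cancels.\<close>

lemma E_map_bound:
  assumes S: "\<phi> \<in> S_le1" and d: "\<And>x. (\<phi> has_vector_derivative \<phi>' x) (at x)" and bd: "\<And>x. norm (\<phi>' x) \<le> B"
    and u: "u > 0"
  shows "norm (E_map \<phi> u) \<le> B * pi"
proof -
  have B: "B \<ge> 0" using order_trans[OF norm_ge_zero bd[of 0]] by simp
  have bd': "norm (\<phi>' x) \<le> (2 * B) / (1 + x\<^sup>2)" for x
  proof (cases "\<bar>x\<bar> \<ge> 1")
    case True
    obtain D where "D 0 = \<phi>" "\<And>n x. (D n has_vector_derivative D (Suc n) x) (at x)"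
      "\<And>n x. 1 \<le> \<bar>x\<bar> \<Longrightarrow> D n x = 0" using S_le1_derivs[OF S] by metis
    then have "\<phi>' x = 0" using d[of x] True vector_derivative_unique_at by metis
    then show ?thesis using B by simp
  next
    case False
    then have "x\<^sup>2 \<le> 1" by (simp add: abs_square_le_1)
    then have "B * (1 + x\<^sup>2) \<le> 2 * B" using B mult_left_mono[of "1 + x\<^sup>2" 2 B] by simp
    then have "B \<le> 2 * B / (1 + x\<^sup>2)" by (simp add: field_simps add_pos_nonneg)
    then show ?thesis using bd[of x] by linarith
  qed
  obtain N where N: "real N * u \<ge> 1" using u by (metis reals_Archimedean3 less_imp_le)
  have "of_real u * E_map \<phi> u = of_real u * (\<Sum>n<N. \<phi> (real (Suc n) * u)) - integral {0..real N * u} \<phi>"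
    using E_map_finite[OF S u N] S_le1_integral[OF S N] u by (simp add: right_diff_distrib)
  then have "u * norm (E_map \<phi> u) \<le> u * (2 * B * arctan (real N * u))"
    using riemann_sum_arctan[OF d bd' u, of N] u by (metis abs_of_pos norm_mult norm_of_real)
  then have "norm (E_map \<phi> u) \<le> 2 * B * arctan (real N * u)" using u by simp
  also have "\<dots> \<le> 2 * B * (pi / 2)" using B arctan_ubound[of "real N * u"] by (intro mult_left_mono) auto
  finally show ?thesis by simp
qed

lemma E_map_bounded:
  assumes S: "\<phi> \<in> S_le1"
  obtains C where "C \<ge> 0" "\<And>u. u > 0 \<Longrightarrow> norm (E_map \<phi> u) \<le> C"
proof -
  obtain D where D: "D 0 = \<phi>" "\<And>n x. (D n has_vector_derivative D (Suc n) x) (at x)"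
    "\<And>n x. 1 \<le> \<bar>x\<bar> \<Longrightarrow> D n x = 0" using S_le1_derivs[OF S] by metis
  have "continuous_on {-1..1} (D 1)"
    using has_vector_derivative_continuous[OF D(2)] continuous_at_imp_continuous_on by blast
  then have "bounded (D 1 ` {-1..1})" by (intro compact_imp_bounded compact_continuous_image) auto
  then obtain B where B: "B > 0" "\<And>x. x \<in> {-1..1} \<Longrightarrow> norm (D 1 x) \<le> B"
    unfolding bounded_pos by blast
  have "norm (D 1 x) \<le> B" for x
  proof (cases "1 \<le> \<bar>x\<bar>")
    case False
    then have "x \<in> {-1..1}" by auto
    then show ?thesis by (rule B(2))
  qed (use B D(3)[of x 1] in simp)
  then have "norm (E_map \<phi> u) \<le> B * pi" if "u > 0" for u
    using E_map_bound[OF S _ _ that, of "D 1" B] D(1) D(2)[of 0] by simp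
  then show ?thesis using that[of "B * pi"] B by simp
qed

lemma E_map_measurable:
  assumes "\<phi> \<in> borel_measurable borel" shows "E_map \<phi> \<in> borel_measurable borel"
proof -
  note assms [measurable]
  show ?thesis unfolding E_map_def by measurable
qed

section \<open>Poisson summation\<close>

lemma sums_sin_Ln:
  assumes "0 \<le> r" "r < 1"
  shows "(\<lambda>n. r ^ n * sin (2 * pi * real n * y) / real n) sums (- Im (ln (1 - of_real r * cis (2 * pi * y))))"
proof -
  let ?w = "of_real r * cis (2 * pi * y)"
  have "norm (- ?w) < 1" using assms by (simp add: norm_mult)
  from Ln_series'[OF this] have "(\<lambda>n. - (?w ^ n) / of_nat n) sums ln (1 - ?w)" by simp
  then have "(\<lambda>n. Im (- (?w ^ n) / of_nat n)) sums Im (ln (1 - ?w))" by (rule sums_Im)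
  moreover have "Im (- (?w ^ n) / of_nat n) = - (r ^ n * sin (2 * pi * real n * y) / real n)" for n
  proof -
    have "real n * (2 * pi * y) = 2 * pi * real n * y" by simp
    then have "?w ^ n = of_real (r ^ n) * cis (2 * pi * real n * y)"
      by (simp only: power_mult_distrib Complex.DeMoivre of_real_power)
    then show ?thesis by (simp add: Im_divide_of_nat del: of_real_power)
  qed
  ultimately have "(\<lambda>n. - (r ^ n * sin (2 * pi * real n * y) / real n)) sums Im (ln (1 - ?w))" by (simp only:)
  from sums_minus[OF this] show ?thesis by simp
qed

lemma integral_sin_series:
  assumes r: "0 \<le> r" "r < 1" and x: "0 \<le> x"
  shows "integral {0..x} (\<lambda>y. - Im (ln (1 - of_real r * cis (2 * pi * y)))) =
    (\<Sum>n. r ^ n * (1 - cos (2 * pi * real n * x)) / (2 * pi * (real n)\<^sup>2))"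
proof -
  define g where "g n y = r ^ n * (1 - cos (2 * pi * real n * y)) / (2 * pi * (real n)\<^sup>2)" for n y
  define g' where "g' n y = r ^ n * sin (2 * pi * real n * y) / real n" for n y
  have d: "(g n has_field_derivative g' n y) (at y within S)" for n y S
    unfolding g_def g'_def
    by (cases "n = 0") (auto intro!: derivative_eq_intros simp: power2_eq_square)
  have bd: "norm (g' n y) \<le> r ^ n" for n y
  proof (cases "n = 0")
    case False
    have "\<bar>sin (2 * pi * real n * y)\<bar> \<le> real n" using False abs_sin_le_one[of "2 * pi * real n * y"]
      by (intro order_trans[OF abs_sin_le_one]) simp
    then have "r ^ n * \<bar>sin (2 * pi * real n * y)\<bar> \<le> r ^ n * real n" using r by (intro mult_left_mono) auto
    then show ?thesis using False r by (simp add: g'_def abs_mult divide_le_eq)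
  qed (simp add: g'_def)
  have u: "uniformly_convergent_on UNIV (\<lambda>n y. \<Sum>i<n. g' i y)"
    by (rule Weierstrass_m_test'[where M = "\<lambda>n. r ^ n"]) (use bd r in \<open>auto intro: summable_geometric\<close>)
  have s0: "summable (\<lambda>n. g n 0)" by (simp add: g_def)
  have D: "((\<lambda>y. \<Sum>n. g n y) has_field_derivative (\<Sum>n. g' n y)) (at y)" for y
    by (rule has_field_derivative_series'(2)[OF convex_UNIV d u UNIV_I s0]) simp
  have "((\<lambda>y. \<Sum>n. g' n y) has_integral ((\<Sum>n. g n x) - (\<Sum>n. g n 0))) {0..x}"
    by (rule fundamental_theorem_of_calculus[OF x])
       (use D in \<open>auto simp: has_real_derivative_iff_has_vector_derivative[symmetric] intro: has_field_derivative_at_within\<close>)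
  moreover have "(\<Sum>n. g' n y) = - Im (ln (1 - of_real r * cis (2 * pi * y)))" for y
    using sums_sin_Ln[OF r, of y] by (simp add: g'_def sums_iff)
  moreover have "(\<Sum>n. g n 0) = 0" by (simp add: g_def)
  ultimately have "((\<lambda>y. - Im (ln (1 - of_real r * cis (2 * pi * y)))) has_integral (\<Sum>n. g n x)) {0..x}" by simp
  from integral_unique[OF this] show ?thesis by (simp only: g_def)
qed

lemma Im_Ln_one_minus_cis:
  assumes "0 < y" "y < 1"
  shows "Im (ln (1 - cis (2 * pi * y))) = pi * (y - 1/2)" "Re (1 - cis (2 * pi * y)) > 0"
proof -
  have s: "sin (pi * y) > 0" using assms by (intro sin_gt_zero) auto
  have "1 - cis (2 * pi * y) = of_real (2 * sin (pi * y)) * cis (pi * (y - 1/2))"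
  proof -
    have "pi * (y - 1/2) = pi * y - pi/2" by (simp add: algebra_simps)
    then have "cos (pi * (y - 1/2)) = sin (pi * y)" "sin (pi * (y - 1/2)) = - cos (pi * y)"
      by (auto simp: cos_diff sin_diff)
    moreover have "2 * pi * y = 2 * (pi * y)" by simp
    then have "cos (2 * pi * y) = 1 - 2 * sin (pi * y) * sin (pi * y)" "sin (2 * pi * y) = 2 * sin (pi * y) * cos (pi * y)"
      by (simp_all only: cos_double_sin sin_double power2_eq_square)
    ultimately show ?thesis by (simp add: complex_eq_iff)
  qed
  also have "\<dots> = exp (of_real (ln (2 * sin (pi * y))) + \<i> * of_real (pi * (y - 1/2)))"
    using s by (simp only: exp_add cis_conv_exp exp_of_real) simp
  finally have e: "1 - cis (2 * pi * y) = exp (of_real (ln (2 * sin (pi * y))) + \<i> * of_real (pi * (y - 1/2)))" .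
  have "\<bar>pi * (y - 1/2)\<bar> < pi" using assms by (simp add: abs_mult abs_less_iff)
  then show "Im (ln (1 - cis (2 * pi * y))) = pi * (y - 1/2)"
    unfolding e using assms by (subst Ln_exp) auto
  have "Re (1 - cis (2 * pi * y)) = 2 * (sin (pi * y))\<^sup>2"
    using cos_double_sin[of "pi * y"] by (simp add: mult.assoc)
  then show "Re (1 - cis (2 * pi * y)) > 0" using s by simp
qed

text \<open>For \<open>r < 1\<close> the sine series of the damped sawtooth can be integrated
  termwise. Then \<open>r\<close> tends to 1: by dominated convergence for the integrals, as
  arguments are bounded by \<open>pi\<close>, and by Tannery's theorem for the series. The
  integrated sawtooth gives the quadratic part, the Basel sum the constant. The term
  \<open>n = 0\<close> is 0, since division by 0 yields 0.\<close>

theorem sums_cos_over_square: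
  assumes x: "0 \<le> x" "x \<le> 1"
  shows "(\<lambda>n. cos (2 * pi * real n * x) / (real n)\<^sup>2) sums (pi\<^sup>2 * (x\<^sup>2 - x + 1/6))"
proof -
  define r where "r j = 1 - inverse (real (Suc j))" for j
  have r: "0 \<le> r j" "r j < 1" for j by (auto simp: r_def field_simps)
  have rlim: "r \<longlonglongrightarrow> 1" unfolding r_def using tendsto_diff[OF tendsto_const LIMSEQ_inverse_real_of_nat, of 1] by simp
  define a where "a n = (1 - cos (2 * pi * real n * x)) / (2 * pi * (real n)\<^sup>2)" for n
  have sq: "summable (\<lambda>n. 1 / (real n)\<^sup>2)" using inverse_power_summable[of 2, where 'a = real] by (simp add: field_simps)
  have ab: "norm (a n) \<le> 1 / (real n)\<^sup>2" for n
  proof -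
    have "norm (1 - cos (2 * pi * real n * x)) \<le> 2 * pi"
      using cos_ge_minus_one[of "2 * pi * real n * x"] cos_le_one[of "2 * pi * real n * x"] pi_ge_two unfolding real_norm_def by linarith
    then have "norm (1 - cos (2 * pi * real n * x)) / (2 * pi * (real n)\<^sup>2) \<le> (2 * pi) / (2 * pi * (real n)\<^sup>2)"
      by (intro divide_right_mono) auto
    then show ?thesis by (simp add: a_def abs_mult)
  qed
  have L1: "(\<lambda>j. \<Sum>n. r j ^ n * a n) \<longlonglongrightarrow> (\<Sum>n. a n)"
  proof (rule tannerys_theorem[THEN conjunct2, THEN conjunct2])
    show "(\<lambda>j. r j ^ n * a n) \<longlonglongrightarrow> a n" for n
      using tendsto_mult[OF tendsto_power[OF rlim] tendsto_const, of n "a n"] by simp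
    have "norm (r j ^ n * a n) \<le> 1 / (real n)\<^sup>2" for j n
    proof -
      have "r j ^ n \<le> 1" using r[of j] by (intro power_le_one) auto
      then have "norm (r j ^ n * a n) \<le> 1 * norm (a n)" unfolding norm_mult using r[of j] by (intro mult_right_mono) auto
      then show ?thesis using ab[of n] by simp
    qed
    then show "\<forall>\<^sub>F (n, j) in sequentially \<times>\<^sub>F sequentially. norm (r j ^ n * a n) \<le> 1 / (real n)\<^sup>2"
      by (auto intro: always_eventually)
  qed (use sq in auto)
  have L2: "(\<lambda>j. integral {0..x} (\<lambda>y. - Im (ln (1 - of_real (r j) * cis (2 * pi * y))))) \<longlonglongrightarrow> integral {0<..<x} (\<lambda>y. - (pi * (y - 1/2)))"
  proof -
    have Re_pos: "Re (1 - of_real (r j) * cis (2 * pi * y)) > 0" for j y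
    proof -
      have "r j * cos (2 * pi * y) \<le> r j * 1" using r by (intro mult_left_mono) auto
      then show ?thesis using r[of j] by simp
    qed
    have cont: "continuous_on S (\<lambda>y. - Im (ln (1 - of_real (r j) * cis (2 * pi * y))))" for j S
      using Re_pos by (intro continuous_intros) (auto simp: complex_nonpos_Reals_iff not_le)
    have "(\<lambda>j. integral {0<..<x} (\<lambda>y. - Im (ln (1 - of_real (r j) * cis (2 * pi * y))))) \<longlonglongrightarrow> integral {0<..<x} (\<lambda>y. - (pi * (y - 1/2)))"
    proof (rule dominated_convergence(2)[where h = "\<lambda>_. pi"])
      show "(\<lambda>y. - Im (ln (1 - of_real (r j) * cis (2 * pi * y)))) integrable_on {0<..<x}" for j
        using integrable_continuous_real[OF cont] by (simp add: integrable_on_open_interval_real)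
      show "(\<lambda>_. pi) integrable_on {0<..<x}"
        unfolding integrable_on_open_interval_real by (intro integrable_continuous_real continuous_on_const)
      show "norm (- Im (ln (1 - of_real (r j) * cis (2 * pi * y)))) \<le> pi" for j y
        using mpi_less_Im_Ln[of "1 - of_real (r j) * cis (2 * pi * y)"] Im_Ln_le_pi[of "1 - of_real (r j) * cis (2 * pi * y)"] Re_pos[of j y]
        by fastforce
      show "(\<lambda>j. - Im (ln (1 - of_real (r j) * cis (2 * pi * y)))) \<longlonglongrightarrow> - (pi * (y - 1/2))" if y: "y \<in> {0<..<x}" for y
      proof -
        have y: "0 < y" "y < 1" using y x by auto
        have "(\<lambda>j. - Im (ln (1 - of_real (r j) * cis (2 * pi * y)))) \<longlonglongrightarrow> - Im (ln (1 - of_real 1 * cis (2 * pi * y)))"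
          using Im_Ln_one_minus_cis(2)[OF y] by (intro tendsto_intros rlim) (auto simp: complex_nonpos_Reals_iff)
        then show ?thesis using Im_Ln_one_minus_cis(1)[OF y] by simp
      qed
    qed
    moreover have "integral {0<..<x} f = integral {0..x} f" for f :: "real \<Rightarrow> real"
      by (simp add: integral_open_interval_real)
    ultimately show ?thesis by simp
  qed
  have I: "integral {0<..<x} (\<lambda>y. - (pi * (y - 1/2))) = pi * (x - x\<^sup>2) / 2"
  proof -
    have "((\<lambda>y. - (pi * (y - 1/2))) has_integral (pi * (x - x\<^sup>2) / 2 - pi * (0 - 0\<^sup>2) / 2)) {0..x}"
      by (rule fundamental_theorem_of_calculus[OF x(1)])
         (auto simp: has_real_derivative_iff_has_vector_derivative[symmetric] field_simps intro!: derivative_eq_intros)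
    then have "((\<lambda>y. - (pi * (y - 1/2))) has_integral (pi * (x - x\<^sup>2) / 2)) {0..x}" by simp
    from integral_unique[OF this] show ?thesis unfolding integral_open_interval_real .
  qed
  have R: "integral {0..x} (\<lambda>y. - Im (ln (1 - of_real (r j) * cis (2 * pi * y)))) = (\<Sum>n. r j ^ n * a n)" for j
    using integral_sin_series[OF r x(1), of j] by (simp add: a_def)
  have "(\<lambda>j. \<Sum>n. r j ^ n * a n) \<longlonglongrightarrow> pi * (x - x\<^sup>2) / 2"
    using L2 unfolding I R .
  then have suma: "(\<Sum>n. a n) = pi * (x - x\<^sup>2) / 2" using L1 LIMSEQ_unique by blast
  have "summable a" by (rule summable_comparison_test'[OF sq]) (use ab in auto)
  with suma have A: "a sums (pi * (x - x\<^sup>2) / 2)" by (simp add: sums_iff)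
  have "(\<lambda>n. 1 / (real (Suc n))\<^sup>2) sums (pi\<^sup>2 / 6)" using inverse_squares_sums by (simp add: add.commute)
  then have "(\<lambda>n. 1 / (real n)\<^sup>2) sums (pi\<^sup>2 / 6 + 1 / (real 0)\<^sup>2)" by (rule sums_Suc)
  then have B: "(\<lambda>n. 1 / (real n)\<^sup>2) sums (pi\<^sup>2 / 6)" by simp
  have "(\<lambda>n. 1 / (real n)\<^sup>2 - 2 * pi * a n) sums (pi\<^sup>2 / 6 - 2 * pi * (pi * (x - x\<^sup>2) / 2))"
    by (intro sums_diff sums_mult A B)
  moreover have "1 / (real n)\<^sup>2 - 2 * pi * a n = cos (2 * pi * real n * x) / (real n)\<^sup>2" for n
    by (cases "n = 0") (auto simp: a_def field_simps)
  moreover have "pi\<^sup>2 / 6 - 2 * pi * (pi * (x - x\<^sup>2) / 2) = pi\<^sup>2 * (x\<^sup>2 - x + 1/6)"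
    by (simp add: power2_eq_square field_simps)
  ultimately show ?thesis by simp
qed

section \<open>Fourier transforms of compactly supported functions: derivatives and decay\<close>

abbreviation efun :: "real \<Rightarrow> real \<Rightarrow> complex" where
  "efun y x \<equiv> exp (2 * of_real pi * \<i> * of_real y * of_real x)"

lemma norm_efun [simp]: "norm (efun y x) = 1"
  by (simp add: norm_exp_eq_Re)

lemma continuous_efun: "continuous_on S (efun y)"
  by (intro continuous_intros)

lemma fourier_compact:
  assumes c: "continuous_on UNIV f" and z: "\<And>x. 1 \<le> \<bar>x\<bar> \<Longrightarrow> f x = 0"
  shows "fourier f y = integral {-1..1} (\<lambda>x. f x * efun y x)"
proof -
  have "(LINT x|lborel. f x * efun y x) = (LINT x:{-1..1}|lborel. f x * efun y x)"
    unfolding set_lebesgue_integral_def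
    by (rule Bochner_Integration.integral_cong) (use z in \<open>auto simp: indicator_def abs_le_iff\<close>)
  also have "\<dots> = integral {-1..1} (\<lambda>x. f x * efun y x)"
    by (intro set_borel_integral_eq_integral borel_integrable_atLeastAtMost' continuous_on_mult continuous_efun
         continuous_on_subset[OF c]) auto
  finally show ?thesis by (simp add: fourier_def)
qed

lemma fourier_norm_bound:
  assumes c: "continuous_on UNIV f" and z: "\<And>x. 1 \<le> \<bar>x\<bar> \<Longrightarrow> f x = 0" and B: "\<And>x. norm (f x) \<le> B"
  shows "norm (fourier f y) \<le> 2 * B"
proof -
  have "norm (integral {-1..1} (\<lambda>x. f x * efun y x)) \<le> B * (1 - (-1))"
    by (rule integral_bound) (use B in \<open>auto simp: norm_mult intro!: continuous_on_mult continuous_efun continuous_on_subset[OF c]\<close>)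
  then show ?thesis using fourier_compact[OF c z] by simp
qed

lemma compact_support_bounded:
  fixes f :: "real \<Rightarrow> complex"
  assumes c: "continuous_on UNIV f" and z: "\<And>x. 1 \<le> \<bar>x\<bar> \<Longrightarrow> f x = 0"
  obtains B where "B \<ge> 0" "\<And>x. norm (f x) \<le> B"
proof -
  have "bounded (f ` {-1..1})"
    by (intro compact_imp_bounded compact_continuous_image continuous_on_subset[OF c]) auto
  then obtain B where B: "B > 0" "\<And>x. x \<in> {-1..1} \<Longrightarrow> norm (f x) \<le> B" unfolding bounded_pos by blast
  have "norm (f x) \<le> B" for x
  proof (cases "1 \<le> \<bar>x\<bar>")
    case False
    then have "x \<in> {-1..1}" by auto
    then show ?thesis by (rule B(2))
  qed (use z B in simp)
  then show ?thesis using that[of B] B by simp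
qed

lemma fourier_by_parts:
  assumes d: "\<And>x. (f has_vector_derivative f' x) (at x)" and c': "continuous_on UNIV f'"
    and z: "\<And>x. 1 \<le> \<bar>x\<bar> \<Longrightarrow> f x = 0" and z': "\<And>x. 1 \<le> \<bar>x\<bar> \<Longrightarrow> f' x = 0"
  shows "fourier f' y = - (2 * of_real pi * \<i> * of_real y) * fourier f y"
proof -
  let ?w = "2 * of_real pi * \<i> * of_real y"
  have c: "continuous_on UNIV f"
    using has_vector_derivative_continuous[OF d] by (simp add: continuous_at_imp_continuous_on)
  have e: "(efun y has_vector_derivative ?w * efun y x) (at x)" for x
  proof -
    have "((\<lambda>z. exp (?w * z)) has_field_derivative ?w * exp (?w * of_real x)) (at (of_real x))"
      by (auto intro!: derivative_eq_intros)
    then show ?thesis by (rule has_vector_derivative_real_field)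
  qed
  have "((\<lambda>x. f x * (?w * efun y x) + f' x * efun y x) has_integral (f 1 * efun y 1 - f (-1) * efun y (-1))) {-1..1}"
    by (rule fundamental_theorem_of_calculus)
       (simp, rule has_vector_derivative_at_within[OF has_vector_derivative_mult[OF d e]])
  then have "integral {-1..1} (\<lambda>x. f x * (?w * efun y x) + f' x * efun y x) = 0"
    using z[of 1] z[of "-1"] by (simp add: integral_unique)
  moreover have "integral {-1..1} (\<lambda>x. f x * (?w * efun y x) + f' x * efun y x)
     = integral {-1..1} (\<lambda>x. f x * (?w * efun y x)) + integral {-1..1} (\<lambda>x. f' x * efun y x)"
    by (intro Henstock_Kurzweil_Integration.integral_add integrable_continuous_real continuous_on_mult
      continuous_on_const continuous_efun continuous_on_subset[OF c subset_UNIV] continuous_on_subset[OF c' subset_UNIV])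
  moreover have "integral {-1..1} (\<lambda>x. f x * (?w * efun y x)) = ?w * integral {-1..1} (\<lambda>x. f x * efun y x)"
    by (simp only: mult.left_commute[of "f _" ?w] integral_mult_right)
  moreover have "fourier f y = integral {-1..1} (\<lambda>x. f x * efun y x)"
    by (rule fourier_compact[OF c z])
  moreover have "fourier f' y = integral {-1..1} (\<lambda>x. f' x * efun y x)"
    by (rule fourier_compact[OF c' z'])
  ultimately show ?thesis by (simp add: eq_neg_iff_add_eq_0 add.commute)
qed

lemma fourier_derivative:
  assumes c: "continuous_on UNIV f" and z: "\<And>x. 1 \<le> \<bar>x\<bar> \<Longrightarrow> f x = 0"
  shows "(fourier f has_vector_derivative fourier (\<lambda>x. 2 * of_real pi * \<i> * of_real x * f x) y) (at y)"
proof -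
  have "((\<lambda>y. integral (cbox (-1) 1) (\<lambda>x. f x * efun y x)) has_vector_derivative
       integral (cbox (-1) 1) (\<lambda>x. 2 * of_real pi * \<i> * of_real x * f x * efun y x)) (at y within UNIV)"
  proof (rule leibniz_rule_vector_derivative)
    fix y x :: real
    have "((\<lambda>y. exp (2 * of_real pi * \<i> * y * of_real x)) has_field_derivative (2 * of_real pi * \<i> * of_real x) * efun y x) (at (of_real y))"
      by (auto intro!: derivative_eq_intros)
    then have "((\<lambda>y. efun y x) has_vector_derivative (2 * of_real pi * \<i> * of_real x) * efun y x) (at y)"
      by (rule has_vector_derivative_real_field)
    then have "((\<lambda>y. f x * efun y x) has_vector_derivative f x * ((2 * of_real pi * \<i> * of_real x) * efun y x)) (at y)"
      by (rule has_vector_derivative_mult_right)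
    then show "((\<lambda>y. f x * efun y x) has_vector_derivative 2 * of_real pi * \<i> * of_real x * f x * efun y x) (at y within UNIV)"
      by (simp add: mult_ac)
  next
    show "(\<lambda>x. f x * efun y x) integrable_on cbox (-1) 1" for y
      by (intro integrable_continuous continuous_on_mult continuous_efun continuous_on_subset[OF c]) auto
    show "continuous_on (UNIV \<times> cbox (-1) 1) (\<lambda>(y, x). 2 * of_real pi * \<i> * of_real x * f x * efun y x)"
      unfolding split_beta by (intro continuous_intros continuous_on_compose2[OF c]) auto
  qed auto
  moreover have "fourier f = (\<lambda>y. integral (cbox (-1) 1) (\<lambda>x. f x * efun y x))"
    unfolding cbox_interval by (rule ext, rule fourier_compact[OF c z])
  moreover have "fourier (\<lambda>x. 2 * of_real pi * \<i> * of_real x * f x) y =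
      integral (cbox (-1) 1) (\<lambda>x. 2 * of_real pi * \<i> * of_real x * f x * efun y x)"
    unfolding cbox_interval by (rule fourier_compact) (use z in \<open>auto intro!: continuous_intros c\<close>)
  ultimately show ?thesis by simp
qed

lemma fourier_C2_decay:
  assumes d: "\<And>x. (f has_vector_derivative f1 x) (at x)" "\<And>x. (f1 has_vector_derivative f2 x) (at x)"
    and c2: "continuous_on UNIV f2"
    and z: "\<And>x. 1 \<le> \<bar>x\<bar> \<Longrightarrow> f x = 0" "\<And>x. 1 \<le> \<bar>x\<bar> \<Longrightarrow> f1 x = 0" "\<And>x. 1 \<le> \<bar>x\<bar> \<Longrightarrow> f2 x = 0"
  obtains C where "C \<ge> 0" "\<And>y. norm (fourier f y) \<le> C / (1 + y\<^sup>2)"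
proof -
  have c: "continuous_on UNIV f" "continuous_on UNIV f1"
    using d has_vector_derivative_continuous by (blast intro: continuous_at_imp_continuous_on)+
  obtain B B2 where B: "B \<ge> 0" "\<And>x. norm (f x) \<le> B" "B2 \<ge> 0" "\<And>x. norm (f2 x) \<le> B2"
    by (metis compact_support_bounded[OF c(1) z(1)] compact_support_bounded[OF c2 z(3)])
  have "norm (fourier f y) \<le> (2 * B + 2 * B2) / (1 + y\<^sup>2)" for y
  proof -
    let ?w = "2 * of_real pi * \<i> * complex_of_real y"
    have "fourier f2 y = - ?w * (- ?w * fourier f y)"
      by (simp only: fourier_by_parts[OF d(2) c2 z(2,3)] fourier_by_parts[OF d(1) c(2) z(1,2)])
    then have "norm (fourier f2 y) = (norm ?w)\<^sup>2 * norm (fourier f y)"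
      by (simp add: norm_mult power2_eq_square)
    moreover have "norm ?w = 2 * pi * \<bar>y\<bar>" by (simp add: norm_mult)
    moreover have "norm (fourier f2 y) \<le> 2 * B2" by (rule fourier_norm_bound[OF c2 z(3) B(4)])
    moreover have n1: "norm (fourier f y) \<le> 2 * B" by (rule fourier_norm_bound[OF c(1) z(1) B(2)])
    ultimately have 2: "(2 * pi)\<^sup>2 * y\<^sup>2 * norm (fourier f y) \<le> 2 * B2" by (simp add: power_mult_distrib)
    have "1 \<le> (2 * pi)\<^sup>2" using pi_ge_two by (intro one_le_power) simp
    then have "1 * (y\<^sup>2 * norm (fourier f y)) \<le> (2 * pi)\<^sup>2 * (y\<^sup>2 * norm (fourier f y))"
      by (intro mult_right_mono) auto
    then have "(1 + y\<^sup>2) * norm (fourier f y) \<le> 2 * B + 2 * B2"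
      using 2 n1 by (simp add: algebra_simps)
    moreover have "1 + y\<^sup>2 > 0" by (simp add: add_pos_nonneg)
    ultimately show ?thesis by (simp add: pos_le_divide_eq mult.commute)
  qed
  then show ?thesis using that[of "2 * B + 2 * B2"] B by simp
qed

lemma fourier_power_decay:
  assumes "\<phi> \<in> S_le1"
  shows "\<exists>C\<ge>0. \<forall>y. \<bar>y\<bar> ^ n * norm (fourier \<phi> y) \<le> C"
proof -
  obtain D where D: "D 0 = \<phi>" "\<And>n x. (D n has_vector_derivative D (Suc n) x) (at x)"
    "\<And>n x. 1 \<le> \<bar>x\<bar> \<Longrightarrow> D n x = 0" using S_le1_derivs[OF assms] by metis
  have c: "continuous_on UNIV (D n)" for n
    using D(2) has_vector_derivative_continuous by (blast intro: continuous_at_imp_continuous_on)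
  have e: "norm (fourier (D n) y) = (2 * pi) ^ n * \<bar>y\<bar> ^ n * norm (fourier \<phi> y)" for n y
  proof (induction n)
    case (Suc n)
    have "fourier (D (Suc n)) y = - (2 * of_real pi * \<i> * of_real y) * fourier (D n) y"
      by (rule fourier_by_parts[OF D(2) c D(3) D(3)])
    then show ?case using Suc by (simp add: norm_mult)
  qed (simp add: D)
  obtain B where B: "B \<ge> 0" "\<And>x. norm (D n x) \<le> B" by (metis compact_support_bounded[OF c D(3)])
  have "\<bar>y\<bar> ^ n * norm (fourier \<phi> y) \<le> 2 * B" for y
  proof -
    have "1 \<le> (2 * pi) ^ n" using pi_ge_two by (intro one_le_power) simp
    then have "1 * (\<bar>y\<bar> ^ n * norm (fourier \<phi> y)) \<le> (2 * pi) ^ n * (\<bar>y\<bar> ^ n * norm (fourier \<phi> y))"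
      by (intro mult_right_mono) auto
    also have "\<dots> = norm (fourier (D n) y)" by (simp add: e mult_ac)
    also have "\<dots> \<le> 2 * B" by (rule fourier_norm_bound[OF c D(3) B(2)])
    finally show ?thesis by simp
  qed
  then show ?thesis using B by (intro exI[of _ "2 * B"]) auto
qed

text \<open>The upper limit \<open>L\<close> is left free above 1 so that it can be taken as a
  multiple of \<open>1 / u\<close>, the mesh of the grid in the proof of Poisson summation.\<close>

lemma fourier_even:
  assumes S: "\<phi> \<in> S_le1" and L: "L \<ge> 1"
  shows "fourier \<phi> y = 2 * integral {0..L} (\<lambda>x. \<phi> x * of_real (cos (2 * pi * y * x)))"
proof -
  note c = S_le1_continuous[OF S]
  define g where "g x = \<phi> x * efun y x" for x
  have cg: "continuous_on A g" for A unfolding g_def by (intro continuous_on_mult c continuous_efun)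
  have "integral {-1..1} g = integral {-1..0} g + integral {0..1} g"
    by (rule Henstock_Kurzweil_Integration.integral_combine[symmetric]) (auto intro: integrable_continuous_real cg)
  also have "integral {-1..0} g = integral {0..1} (\<lambda>x. g (- x))"
    using Henstock_Kurzweil_Integration.integral_reflect_real[where a = 0 and b = 1 and f = "\<lambda>x. g (- x)"] by simp
  also have "integral {0..1} (\<lambda>x. g (- x)) + integral {0..1} g = integral {0..1} (\<lambda>x. g (- x) + g x)"
    by (rule Henstock_Kurzweil_Integration.integral_add[symmetric])
       (auto intro!: integrable_continuous_real cg continuous_on_compose2[OF cg] continuous_intros)
  also have "\<dots> = integral {0..L} (\<lambda>x. g (- x) + g x)"
  proof -
    have "(\<lambda>x. g (- x) + g x) integrable_on {0..1}"
      by (auto intro!: integrable_continuous_real cg continuous_intros continuous_on_compose2[OF cg])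
    then have "((\<lambda>x. g (- x) + g x) has_integral integral {0..1} (\<lambda>x. g (- x) + g x)) {0..1}"
      by (rule integrable_integral)
    moreover have "integral {0..L} (\<lambda>x. g (- x) + g x) = integral {0..1} (\<lambda>x. g (- x) + g x) + integral {1..L} (\<lambda>x. g (- x) + g x)"
      using L by (intro Henstock_Kurzweil_Integration.integral_combine[symmetric])
       (auto intro!: integrable_continuous_real cg continuous_intros continuous_on_compose2[OF cg])
    moreover have "integral {1..L} (\<lambda>x. g (- x) + g x) = integral {1..L} (\<lambda>x. 0)"
      by (rule Henstock_Kurzweil_Integration.integral_cong) (use S_le1_zero'[OF S] in \<open>auto simp: g_def\<close>)
    ultimately show ?thesis by simp
  qed
  also have "(\<lambda>x. g (- x) + g x) = (\<lambda>x. 2 * (\<phi> x * of_real (cos (2 * pi * y * x))))"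
  proof
    fix x
    have "efun y (- x) + efun y x = 2 * of_real (cos (2 * pi * y * x))"
      using cos_exp_eq[of "of_real (2 * pi * y * x)"] by (simp add: mult_ac add.commute flip: cos_of_real)
    then show "g (- x) + g x = 2 * (\<phi> x * of_real (cos (2 * pi * y * x)))"
      by (simp add: g_def S_le1_even[OF S] flip: distrib_left)
  qed
  finally have "integral {-1..1} g = 2 * integral {0..L} (\<lambda>x. \<phi> x * of_real (cos (2 * pi * y * x)))"
    by simp
  moreover have "fourier \<phi> y = integral {-1..1} g"
    unfolding g_def by (rule fourier_compact[OF c S_le1_zero'[OF S]])
  ultimately show ?thesis by simp
qed

text \<open>Two integrations by parts against the Bernoulli polynomial \<open>q\<close>, whose
  second derivative is constant. \<open>q\<close> takes equal values at both ends of the cell, so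
  the \<open>f1\<close> terms telescope over consecutive cells; \<open>q1\<close> takes opposite
  values, so the \<open>f\<close> terms add up to a trapezoidal sum.\<close>

lemma Euler_Maclaurin_unit:
  fixes f f1 f2 :: "real \<Rightarrow> complex"
  assumes d: "\<And>x. (f has_vector_derivative f1 x) (at x)" "\<And>x. (f1 has_vector_derivative f2 x) (at x)"
    and u: "u > 0" and ab: "a = real n / u" "b = real (Suc n) / u"
  shows "((\<lambda>x. f2 x * of_real (pi\<^sup>2 * ((u * x - real n)\<^sup>2 - (u * x - real n) + 1/6)) - 2 * pi\<^sup>2 * u\<^sup>2 * f x)
     has_integral (of_real (pi\<^sup>2 / 6) * (f1 b - f1 a) - of_real (pi\<^sup>2 * u) * (f a + f b))) {a..b}"
proof -
  define q where "q x = pi\<^sup>2 * ((u * x - real n)\<^sup>2 - (u * x - real n) + 1/6)" for x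
  define q1 where "q1 x = pi\<^sup>2 * u * (2 * (u * x - real n) - 1)" for x
  have q: "((\<lambda>x. of_real (q x) :: complex) has_vector_derivative of_real (q1 x)) (at x)" for x
    unfolding q_def q1_def
    by (intro has_vector_derivative_of_real) (auto intro!: derivative_eq_intros simp: algebra_simps)
  have q1: "((\<lambda>x. of_real (q1 x) :: complex) has_vector_derivative of_real (2 * pi\<^sup>2 * u\<^sup>2)) (at x)" for x
    unfolding q1_def
    by (intro has_vector_derivative_of_real) (auto intro!: derivative_eq_intros simp: power2_eq_square)
  define W where "W x = f1 x * of_real (q x) - f x * of_real (q1 x)" for x
  have W: "(W has_vector_derivative (f2 x * of_real (q x) - 2 * pi\<^sup>2 * u\<^sup>2 * f x)) (at x)" for x
  proof -
    have "(W has_vector_derivative ((f1 x * of_real (q1 x) + f2 x * of_real (q x)) -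
        (f x * of_real (2 * pi\<^sup>2 * u\<^sup>2) + f1 x * of_real (q1 x)))) (at x)"
      unfolding W_def by (intro has_vector_derivative_diff has_vector_derivative_mult d q q1)
    then show ?thesis by (simp add: algebra_simps)
  qed
  have H: "((\<lambda>x. f2 x * of_real (q x) - 2 * pi\<^sup>2 * u\<^sup>2 * f x) has_integral (W b - W a)) {a..b}"
    by (rule fundamental_theorem_of_calculus)
       (use u ab W in \<open>auto intro: has_vector_derivative_at_within simp: divide_right_mono\<close>)
  have "u * a - real n = 0" "u * b - real n = 1" using ab u by auto
  then have qs: "q a = pi\<^sup>2 / 6" "q b = pi\<^sup>2 / 6" "q1 a = - (pi\<^sup>2 * u)" "q1 b = pi\<^sup>2 * u"
    by (simp_all add: q_def q1_def)
  then have "W b - W a = of_real (pi\<^sup>2 / 6) * (f1 b - f1 a) - of_real (pi\<^sup>2 * u) * (f a + f b)"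
    unfolding W_def qs by (simp add: algebra_simps)
  from H[unfolded this q_def] show ?thesis .
qed

text \<open>Up to the factor \<open>pi\<^sup>2\<close> the periodic continuation of the second Bernoulli polynomial.\<close>

definition cos_square_series :: "real \<Rightarrow> real" where
  "cos_square_series x = (\<Sum>k. cos (2 * pi * real k * x) / (real k)\<^sup>2)"

lemma summable_inverse_squares: "summable (\<lambda>n. 1 / (real n)\<^sup>2)"
  using inverse_power_summable[of 2, where 'a = real] by (simp add: field_simps)

lemma cos_square_series_eq:
  assumes "real n \<le> x" "x \<le> real (Suc n)"
  shows "cos_square_series x = pi\<^sup>2 * ((x - real n)\<^sup>2 - (x - real n) + 1/6)"
proof -
  have "cos (2 * pi * real k * x) = cos (2 * pi * real k * (x - real n))" for k
  proof -
    have "2 * pi * real k * x = 2 * pi * real k * (x - real n) + 2 * pi * real (k * n)" by (simp add: algebra_simps)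
    also have "cos \<dots> = cos (2 * pi * real k * (x - real n))"
      using cos_int_2pin[of "int (k * n)"] sin_int_2pin[of "int (k * n)"] unfolding cos_add by simp
    finally show ?thesis .
  qed
  then show ?thesis using sums_cos_over_square[of "x - real n"] assms by (simp add: cos_square_series_def sums_iff)
qed

text \<open>This is Poisson summation folded by evenness, which is why \<open>\<phi> 0\<close>
  counts half. Integrating by parts twice puts \<open>1 / k\<^sup>2\<close> into each Fourier
  coefficient, so the sum over \<open>k\<close> may be taken under the integral; it produces the
  periodic Bernoulli function, and the Euler-Maclaurin formula evaluates the result on the grid of
  mesh \<open>1 / u\<close>.\<close>

lemma sum_fourier:
  assumes S: "\<phi> \<in> S_le1" and u: "u > 0" and N: "real N / u \<ge> 1"
  shows "(\<lambda>k. fourier \<phi> (real (Suc k) * u)) sums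
    ((\<phi> 0 / 2 + (\<Sum>n<N. \<phi> (real (Suc n) / u))) / of_real u - (LINT x:{0<..}|lborel. \<phi> x))"
proof -
  obtain D where D: "D 0 = \<phi>" "\<And>n x. (D n has_vector_derivative D (Suc n) x) (at x)"
    "\<And>n x. 1 \<le> \<bar>x\<bar> \<Longrightarrow> D n x = 0" using S_le1_derivs[OF S] by metis
  have d1: "(\<phi> has_vector_derivative D 1 x) (at x)" and d2: "(D 1 has_vector_derivative D 2 x) (at x)" for x
    using D(2)[of 0 x] D(2)[of 1 x] D(1) by (auto simp: numeral_2_eq_2)
  have c: "continuous_on A (D n)" for A n
    using D(2) has_vector_derivative_continuous by (blast intro: continuous_at_imp_continuous_on)
  note c0 = S_le1_continuous[OF S]
  define L where "L = real N / u"
  have L: "L \<ge> 1" using N by (simp add: L_def)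
  \<comment> \<open>Integration runs over the half-line only, so a boundary term at 0 would remain;
    the derivative of an even function is odd and removes it.\<close>
  have D10: "D 1 0 = 0"
  proof -
    have "((\<phi> \<circ> (\<lambda>x. -1 * x)) has_vector_derivative ((-1) *\<^sub>R D 1 (-1 * 0))) (at 0)"
      by (rule vector_diff_chain_at) (use d1 in \<open>auto intro!: derivative_eq_intros\<close>)
    moreover have "\<phi> \<circ> (\<lambda>x. -1 * x) = \<phi>" using S_le1_even[OF S] by (auto simp: fun_eq_iff)
    ultimately have "(\<phi> has_vector_derivative - D 1 0) (at 0)" by simp
    then have "- D 1 0 = D 1 0" using d1[of 0] vector_derivative_unique_at by blast
    then show ?thesis by (simp add: eq_neg_iff_add_eq_0 neg_eq_iff_add_eq_0)
  qed
  have zL: "\<phi> L = 0" "D 1 L = 0" using D(1,3) L by (metis abs_of_nonneg order_trans zero_le_one)+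
  have four: "fourier \<phi> (real k * u) = - integral {0..L} (\<lambda>x. D 2 x * of_real (cos (2 * pi * real k * (u * x)) / (real k)\<^sup>2)) / of_real (2 * pi\<^sup>2 * u\<^sup>2)"
    if k: "k > 0" for k
  proof -
    define w where "w = 2 * pi * real k * u"
    have w: "w > 0" using k u by (simp add: w_def)
    define V where "V x = \<phi> x * of_real (sin (w * x) / w) + D 1 x * of_real (cos (w * x) / w\<^sup>2)" for x
    have s: "((\<lambda>x. of_real (sin (w * x) / w) :: complex) has_vector_derivative of_real (cos (w * x))) (at x)" for x
      by (intro has_vector_derivative_of_real) (use w in \<open>auto intro!: derivative_eq_intros\<close>)
    have co: "((\<lambda>x. of_real (cos (w * x) / w\<^sup>2) :: complex) has_vector_derivative of_real (- sin (w * x) / w)) (at x)" for x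
      by (intro has_vector_derivative_of_real) (use w in \<open>auto intro!: derivative_eq_intros simp: power2_eq_square\<close>)
    have "(V has_vector_derivative (\<phi> x * of_real (cos (w * x)) + D 2 x * of_real (cos (w * x) / w\<^sup>2))) (at x)" for x
    proof -
      have "(V has_vector_derivative ((\<phi> x * of_real (cos (w * x)) + D 1 x * of_real (sin (w * x) / w)) +
         (D 1 x * of_real (- sin (w * x) / w) + D 2 x * of_real (cos (w * x) / w\<^sup>2)))) (at x)"
        unfolding V_def by (intro has_vector_derivative_add has_vector_derivative_mult d1 d2 s co)
      then show ?thesis by simp
    qed
    then have "((\<lambda>x. \<phi> x * of_real (cos (w * x)) + D 2 x * of_real (cos (w * x) / w\<^sup>2)) has_integral (V L - V 0)) {0..L}"
      using L by (intro fundamental_theorem_of_calculus) (auto intro: has_vector_derivative_at_within)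
    moreover have "V L - V 0 = 0" using zL D10 by (simp add: V_def)
    ultimately have "integral {0..L} (\<lambda>x. \<phi> x * of_real (cos (w * x)) + D 2 x * of_real (cos (w * x) / w\<^sup>2)) = 0"
      by (simp add: integral_unique)
    moreover have "integral {0..L} (\<lambda>x. \<phi> x * of_real (cos (w * x)) + D 2 x * of_real (cos (w * x) / w\<^sup>2))
       = integral {0..L} (\<lambda>x. \<phi> x * of_real (cos (w * x))) + integral {0..L} (\<lambda>x. D 2 x * of_real (cos (w * x) / w\<^sup>2))"
      using w by (intro Henstock_Kurzweil_Integration.integral_add integrable_continuous_real continuous_intros c c0) auto
    ultimately have "integral {0..L} (\<lambda>x. \<phi> x * of_real (cos (w * x))) = - integral {0..L} (\<lambda>x. D 2 x * of_real (cos (w * x) / w\<^sup>2))"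
      by (simp add: eq_neg_iff_add_eq_0)
    moreover have "(\<lambda>x. D 2 x * of_real (cos (w * x) / w\<^sup>2)) =
        (\<lambda>x. of_real (1 / (2 * pi * u)\<^sup>2) * (D 2 x * of_real (cos (2 * pi * real k * (u * x)) / (real k)\<^sup>2)))"
      by (simp add: w_def power_mult_distrib mult_ac fun_eq_iff)
    moreover have "fourier \<phi> (real k * u) = 2 * integral {0..L} (\<lambda>x. \<phi> x * of_real (cos (w * x)))"
      using fourier_even[OF S L, of "real k * u"] by (simp add: w_def mult_ac)
    ultimately have "fourier \<phi> (real k * u) = 2 * - (of_real (1 / (2 * pi * u)\<^sup>2) * integral {0..L} (\<lambda>x. D 2 x * of_real (cos (2 * pi * real k * (u * x)) / (real k)\<^sup>2)))"
      by (simp only: integral_mult_right)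
    then show ?thesis by (simp add: power_mult_distrib)
  qed
  define g where "g k x = indicator {0..L} x *\<^sub>R (D 2 x * of_real (cos (2 * pi * real k * (u * x)) / (real k)\<^sup>2))" for k x
  have cg: "continuous_on {0..L} (\<lambda>x. D 2 x * of_real (cos (2 * pi * real k * (u * x)) / (real k)\<^sup>2))" for k
    by (cases "k = 0") (auto intro!: continuous_intros c)
  have gi: "integrable lborel (g k)" for k
    using borel_integrable_atLeastAtMost'[OF cg] by (simp add: g_def[abs_def] set_integrable_def)
  obtain B where B: "B \<ge> 0" "\<And>x. norm (D 2 x) \<le> B" using compact_support_bounded[OF c[of UNIV 2] D(3)[of _ 2]] by metis
  have gb: "norm (g k x) \<le> indicator {0..L} x * B * (1 / (real k)\<^sup>2)" for k x
  proof -
    have "norm (D 2 x * of_real (cos (2 * pi * real k * (u * x)) / (real k)\<^sup>2)) \<le> B * (1 / (real k)\<^sup>2)"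
      unfolding norm_mult norm_of_real
    proof (intro mult_mono)
      show "\<bar>cos (2 * pi * real k * (u * x)) / (real k)\<^sup>2\<bar> \<le> 1 / (real k)\<^sup>2" by (simp add: abs_divide divide_right_mono)
    qed (use B in auto)
    then show ?thesis by (auto simp: g_def indicator_def)
  qed
  have AE_norm: "AE x in lborel. summable (\<lambda>k. norm (g k x))"
  proof (rule AE_I2)
    show "summable (\<lambda>k. norm (g k x))" for x
      by (rule summable_comparison_test'[OF summable_mult[OF summable_inverse_squares, of "indicator {0..L} x * B"]]) (use gb in auto)
  qed
  have nb: "norm (LINT x|lborel. norm (g k x)) \<le> (L * B) * (1 / (real k)\<^sup>2)" for k
  proof -
    have i: "set_integrable lborel {0..L} (\<lambda>_. B * (1 / (real k)\<^sup>2))"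
      by (rule borel_integrable_atLeastAtMost'[OF continuous_on_const])
    have "(LINT x|lborel. norm (g k x)) \<le> (LINT x:{0..L}|lborel. B * (1 / (real k)\<^sup>2))"
      unfolding set_lebesgue_integral_def
    proof (rule integral_mono[OF integrable_norm[OF gi] i[unfolded set_integrable_def]])
      show "norm (g k x) \<le> indicator {0..L} x *\<^sub>R (B * (1 / (real k)\<^sup>2))" for x
        using gb[of k x] unfolding real_scaleR_def mult.assoc .
    qed
    also have "\<dots> = integral {0..L} (\<lambda>_. B * (1 / (real k)\<^sup>2))"
      by (rule set_borel_integral_eq_integral(2)[OF i])
    also have "\<dots> = (L * B) * (1 / (real k)\<^sup>2)"
      using L unfolding integral_const_real measure_lborel_Icc by simp
    finally show ?thesis by simp
  qed
  have sum_norm: "summable (\<lambda>k. LINT x|lborel. norm (g k x))"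
    by (rule summable_comparison_test'[OF summable_mult[OF summable_inverse_squares, of "L * B"]]) (rule nb)
  have "(\<lambda>k. integral\<^sup>L lborel (g k)) sums (LINT x|lborel. (\<Sum>k. g k x))"
    by (rule sums_integral[OF gi AE_norm sum_norm])
  moreover have "integral\<^sup>L lborel (g k) = integral {0..L} (\<lambda>x. D 2 x * of_real (cos (2 * pi * real k * (u * x)) / (real k)\<^sup>2))" for k
    unfolding g_def set_lebesgue_integral_def[symmetric]
    by (rule set_borel_integral_eq_integral(2)[OF borel_integrable_atLeastAtMost'[OF cg]])
  moreover have gs: "(\<Sum>k. g k x) = indicator {0..L} x *\<^sub>R (D 2 x * of_real (cos_square_series (u * x)))" for x
  proof (cases "x \<in> {0..L}")
    case True
    have "(\<lambda>k. cos (2 * pi * real k * (u * x)) / (real k)\<^sup>2) sums cos_square_series (u * x)"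
      unfolding cos_square_series_def
      by (rule summable_sums, rule summable_comparison_test'[OF summable_inverse_squares]) (auto simp: divide_right_mono)
    then have "(\<lambda>k. D 2 x * of_real (cos (2 * pi * real k * (u * x)) / (real k)\<^sup>2)) sums (D 2 x * of_real (cos_square_series (u * x)))"
      by (intro sums_mult sums_of_real)
    then show ?thesis using True by (simp add: g_def sums_iff)
  qed (simp add: g_def)
  ultimately have S1: "(\<lambda>k. integral {0..L} (\<lambda>x. D 2 x * of_real (cos (2 * pi * real k * (u * x)) / (real k)\<^sup>2))) sums
      (LINT x:{0..L}|lborel. D 2 x * of_real (cos_square_series (u * x)))"
    by (simp add: set_lebesgue_integral_def)
  have gbern: "integrable lborel (\<lambda>x. indicator {0..L} x *\<^sub>R (D 2 x * of_real (cos_square_series (u * x))))"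
  proof -
    have "integrable lborel (\<lambda>x. \<Sum>k. g k x)"
      by (rule integrable_suminf[OF gi AE_norm sum_norm])
    then show ?thesis unfolding gs .
  qed
  \<comment> \<open>Adding the cells counts interior grid values twice and the two outermost values
    once; the last one is doubled in the sum and subtracted again.\<close>
  have em: "((\<lambda>x. D 2 x * of_real (cos_square_series (u * x)) - 2 * pi\<^sup>2 * u\<^sup>2 * \<phi> x) has_integral
      (of_real (pi\<^sup>2 / 6) * (D 1 (real m / u) - D 1 0) - of_real (pi\<^sup>2 * u) * (\<phi> 0 + 2 * (\<Sum>n<m. \<phi> (real (Suc n) / u)) - \<phi> (real m / u)))) {0..real m / u}" for m
  proof (induction m)
    case (Suc m)
    define a b where "a = real m / u" and "b = real (Suc m) / u"
    have ab: "0 \<le> a" "a \<le> b" using u by (auto simp: a_def b_def divide_right_mono)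
    have 1: "((\<lambda>x. D 2 x * of_real (pi\<^sup>2 * ((u * x - real m)\<^sup>2 - (u * x - real m) + 1/6)) - 2 * pi\<^sup>2 * u\<^sup>2 * \<phi> x)
     has_integral (of_real (pi\<^sup>2 / 6) * (D 1 b - D 1 a) - of_real (pi\<^sup>2 * u) * (\<phi> a + \<phi> b))) {a..b}"
      by (rule Euler_Maclaurin_unit[OF d1 d2 u a_def b_def])
    have 2: "((\<lambda>x. D 2 x * of_real (cos_square_series (u * x)) - 2 * pi\<^sup>2 * u\<^sup>2 * \<phi> x)
     has_integral (of_real (pi\<^sup>2 / 6) * (D 1 b - D 1 a) - of_real (pi\<^sup>2 * u) * (\<phi> a + \<phi> b))) {a..b}"
    proof (rule has_integral_eq[OF _ 1])
      fix x assume "x \<in> {a..b}"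
      then have "real m \<le> u * x" "u * x \<le> real (Suc m)" using u by (auto simp: a_def b_def field_simps)
      then show "D 2 x * of_real (pi\<^sup>2 * ((u * x - real m)\<^sup>2 - (u * x - real m) + 1/6)) - 2 * pi\<^sup>2 * u\<^sup>2 * \<phi> x =
         D 2 x * of_real (cos_square_series (u * x)) - 2 * pi\<^sup>2 * u\<^sup>2 * \<phi> x" by (simp only: cos_square_series_eq)
    qed
    have val: "(c1 * (D 1 a - D 1 0) - c2 * (\<phi> 0 + 2 * T - \<phi> a)) + (c1 * (D 1 b - D 1 a) - c2 * (\<phi> a + \<phi> b))
        = c1 * (D 1 b - D 1 0) - c2 * (\<phi> 0 + 2 * (T + \<phi> b) - \<phi> b)" for c1 c2 T
      by (simp add: algebra_simps)
    show ?case
      using has_integral_combine[OF ab Suc[folded a_def] 2]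
      unfolding val sum.lessThan_Suc b_def[symmetric] .
  qed (use has_integral_refl(2) in simp)
  have SL: "(LINT x:{0..L}|lborel. D 2 x * of_real (cos_square_series (u * x))) = integral {0..L} (\<lambda>x. D 2 x * of_real (cos_square_series (u * x)))"
    using gbern by (intro set_borel_integral_eq_integral) (simp add: set_integrable_def)
  have "((\<lambda>x. 2 * pi\<^sup>2 * u\<^sup>2 * \<phi> x) has_integral (2 * pi\<^sup>2 * u\<^sup>2 * integral {0..L} \<phi>)) {0..L}"
    by (intro has_integral_mult_right integrable_integral integrable_continuous_real c0)
  from has_integral_add[OF em[of N, folded L_def] this]
  have "((\<lambda>x. D 2 x * of_real (cos_square_series (u * x))) has_integral
     (2 * pi\<^sup>2 * u\<^sup>2 * integral {0..L} \<phi> - of_real (pi\<^sup>2 * u) * (\<phi> 0 + 2 * (\<Sum>n<N. \<phi> (real (Suc n) / u))))) {0..L}"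
    by (simp add: zL D10 algebra_simps del: One_nat_def)
  then have I: "(LINT x:{0..L}|lborel. D 2 x * of_real (cos_square_series (u * x))) =
     2 * pi\<^sup>2 * u\<^sup>2 * (LINT x:{0<..}|lborel. \<phi> x) - of_real (pi\<^sup>2 * u) * (\<phi> 0 + 2 * (\<Sum>n<N. \<phi> (real (Suc n) / u)))"
    using SL S_le1_integral[OF S L] by (simp add: integral_unique)
  have "(\<lambda>k. - integral {0..L} (\<lambda>x. D 2 x * of_real (cos (2 * pi * real (Suc k) * (u * x)) / (real (Suc k))\<^sup>2)) / of_real (2 * pi\<^sup>2 * u\<^sup>2)) sums
     (- (LINT x:{0..L}|lborel. D 2 x * of_real (cos_square_series (u * x))) / of_real (2 * pi\<^sup>2 * u\<^sup>2))"
  proof (intro sums_divide sums_minus)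
    show "(\<lambda>k. integral {0..L} (\<lambda>x. D 2 x * of_real (cos (2 * pi * real (Suc k) * (u * x)) / (real (Suc k))\<^sup>2))) sums
       (LINT x:{0..L}|lborel. D 2 x * of_real (cos_square_series (u * x)))"
      \<comment> \<open>The term of index 0 that is split off is 0, because of its denominator
        \<open>(real 0)\<^sup>2\<close>.\<close>
      using S1 by (subst sums_Suc_iff) simp
  qed
  then have "(\<lambda>k. fourier \<phi> (real (Suc k) * u)) sums (- (LINT x:{0..L}|lborel. D 2 x * of_real (cos_square_series (u * x))) / of_real (2 * pi\<^sup>2 * u\<^sup>2))"
    by (simp only: four[OF zero_less_Suc])
  moreover have "- (LINT x:{0..L}|lborel. D 2 x * of_real (cos_square_series (u * x))) / of_real (2 * pi\<^sup>2 * u\<^sup>2) =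
     (\<phi> 0 / 2 + (\<Sum>n<N. \<phi> (real (Suc n) / u))) / of_real u - (LINT x:{0<..}|lborel. \<phi> x)"
    unfolding I using u by (simp add: field_simps power2_eq_square)
  ultimately show ?thesis by simp
qed

lemma set_integrable_quadratic_decay:
  fixes f :: "real \<Rightarrow> complex"
  assumes c: "continuous_on UNIV f" and bd: "\<And>x. norm (f x) \<le> C / (1 + x\<^sup>2)"
  shows "set_integrable lborel {0..} f"
proof -
  have m: "f \<in> borel_measurable borel" by (rule borel_measurable_continuous_onI[OF c])
  have 1: "set_integrable lborel {0..1} f"
    by (rule borel_integrable_atLeastAtMost'[OF continuous_on_subset[OF c subset_UNIV]])
  have 2: "set_integrable lborel {1<..} f"
  proof (rule set_integrable_bound)
    show "set_integrable lborel {1<..} (\<lambda>x. C * x powr -2)"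
      by (intro set_integrable_mult_right set_integrable_powr_1_inf) auto
    have "C \<ge> 0" using order_trans[OF norm_ge_zero bd[of 0]] by simp
    have "norm (f x) \<le> norm (C * x powr -2)" if "1 < x" for x
    proof -
      have "C / (1 + x\<^sup>2) \<le> C / x\<^sup>2" using that \<open>C \<ge> 0\<close> by (intro divide_left_mono) (auto intro!: mult_pos_pos add_pos_pos)
      also have "\<dots> = C * x powr -2" using that by (simp add: powr_minus divide_inverse)
      finally show ?thesis using bd[of x] \<open>C \<ge> 0\<close> by simp
    qed
    then show "AE x in lborel. x \<in> {1<..} \<longrightarrow> norm (f x) \<le> norm (C * x powr -2)" by auto
    show "set_borel_measurable lborel {1<..} f" unfolding set_borel_measurable_def
      by (intro borel_measurable_scaleR borel_measurable_indicator) (use m in auto)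
  qed
  have "{0..} = {0..1} \<union> {1::real<..}" by force
  then show ?thesis using set_integrable_Un[OF 1 2] by simp
qed

text \<open>As \<open>u\<close> tends to 0, \<open>u\<close> times the sum of
  \<open>fourier \<phi>\<close> over the positive multiples of \<open>u\<close> is a Riemann sum for
  the left-hand side, with error of order \<open>u\<close>. By \<open>sum_fourier\<close> the same
  quantity is \<open>\<phi> 0 / 2\<close> up to a multiple of \<open>u\<close>.\<close>

lemma integral_fourier:
  assumes S: "\<phi> \<in> S_le1"
  shows "(LINT x:{0<..}|lborel. fourier \<phi> x) = \<phi> 0 / 2"
proof -
  obtain D where D: "D 0 = \<phi>" "\<And>n x. (D n has_vector_derivative D (Suc n) x) (at x)"
    "\<And>n x. 1 \<le> \<bar>x\<bar> \<Longrightarrow> D n x = 0" using S_le1_derivs[OF S] by metis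
  have cD: "continuous_on A (D n)" for A n
    using D(2) has_vector_derivative_continuous by (blast intro: continuous_at_imp_continuous_on)
  have d1: "(\<phi> has_vector_derivative D 1 x) (at x)" and d2: "(D 1 has_vector_derivative D 2 x) (at x)" for x
    using D(2)[of 0 x] D(2)[of 1 x] D(1) by (auto simp: numeral_2_eq_2)
  note c0 = S_le1_continuous[OF S, of UNIV]
  note z0 = S_le1_zero'[OF S]
  let ?f = "fourier \<phi>"
  let ?c = "2 * of_real pi * \<i> :: complex"
  let ?f' = "fourier (\<lambda>x. ?c * of_real x * \<phi> x)"
  have fd: "(?f has_vector_derivative ?f' y) (at y)" for y by (rule fourier_derivative[OF c0 z0])
  have cf: "continuous_on UNIV ?f"
    using has_vector_derivative_continuous[OF fd] by (simp add: continuous_at_imp_continuous_on)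
  obtain C1 where C1: "C1 \<ge> 0" "\<And>y. norm (?f y) \<le> C1 / (1 + y\<^sup>2)"
    by (rule fourier_C2_decay[OF d1 d2 cD z0 D(3) D(3)]) (assumption | rule that)+
  have x: "((\<lambda>x. ?c * of_real x) has_vector_derivative ?c) (at x)" for x
    by (intro has_vector_derivative_mult_right[where a = ?c, THEN has_vector_derivative_eq_rhs] has_vector_derivative_of_real)
       (auto intro!: derivative_eq_intros)
  obtain C2 where C2: "C2 \<ge> 0" "\<And>y. norm (?f' y) \<le> C2 / (1 + y\<^sup>2)"
  proof (rule fourier_C2_decay)
    show "((\<lambda>x. ?c * of_real x * \<phi> x) has_vector_derivative ?c * of_real x * D 1 x + ?c * \<phi> x) (at x)" for x
      by (rule has_vector_derivative_mult[OF x d1])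
    show "((\<lambda>x. ?c * of_real x * D 1 x + ?c * \<phi> x) has_vector_derivative (?c * of_real x * D 2 x + ?c * D 1 x) + ?c * D 1 x) (at x)" for x
      by (intro has_vector_derivative_add has_vector_derivative_mult[OF x d2] has_vector_derivative_mult_right d1)
    show "continuous_on UNIV (\<lambda>x. (?c * of_real x * D 2 x + ?c * D 1 x) + ?c * D 1 x)"
      by (intro continuous_intros cD)
  qed (use z0 D(3) that in auto)
  have int: "set_integrable lborel {0..} ?f" by (rule set_integrable_quadratic_decay[OF cf C1(2)])
  define A where "A = (LINT x:{0<..}|lborel. ?f x)"
  have A: "A = (LINT x:{0..}|lborel. ?f x)"
    unfolding A_def set_lebesgue_integral_def
  proof (rule integral_cong_AE)
    have [measurable]: "?f \<in> borel_measurable borel" by (rule borel_measurable_continuous_onI[OF cf])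
    show "(\<lambda>x. indicator {0<..} x *\<^sub>R ?f x) \<in> borel_measurable lborel"
      "(\<lambda>x. indicator {0..} x *\<^sub>R ?f x) \<in> borel_measurable lborel" by measurable
    have "AE x in lborel. x \<noteq> (0::real)" by (rule AE_lborel_singleton)
    then show "AE x in lborel. indicator {0<..} x *\<^sub>R ?f x = indicator {0..} x *\<^sub>R ?f x"
      by eventually_elim (auto simp: indicator_def)
  qed
  have lim: "(\<lambda>N. integral {0..real N * u} ?f) \<longlonglongrightarrow> A" if u: "u > 0" for u
  proof -
    have "((\<lambda>b. LINT x:{0..b}|lborel. ?f x) \<longlongrightarrow> A) at_top"
      unfolding A by (rule tendsto_set_lebesgue_integral_at_top[OF _ int]) simp
    moreover have "filterlim (\<lambda>N. real N * u) at_top sequentially"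
      using u by (intro filterlim_at_top_mult_tendsto_pos[OF tendsto_const] filterlim_real_sequentially)
    ultimately have "(\<lambda>N. LINT x:{0..real N * u}|lborel. ?f x) \<longlonglongrightarrow> A"
      by (rule filterlim_compose)
    moreover have "(LINT x:{0..b}|lborel. ?f x) = integral {0..b} ?f" for b
      by (intro set_borel_integral_eq_integral borel_integrable_atLeastAtMost' continuous_on_subset[OF cf subset_UNIV])
    ultimately show ?thesis by simp
  qed
  have key: "norm (\<phi> 0 / 2 - of_real u * (LINT x:{0<..}|lborel. \<phi> x) - A) \<le> u * (C2 * pi / 2)" if u: "0 < u" "u \<le> 1" for u
  proof -
    \<comment> \<open>For \<open>u \<le> 1\<close> the grid point \<open>1 / u\<close> is already
      outside the interior of the support, so \<open>N = 1\<close> suffices and the only surviving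
      grid value is \<open>\<phi> 0\<close>.\<close>
    have "real 1 / u \<ge> 1" using u by simp
    from sum_fourier[OF S u(1) this]
    have "(\<lambda>k. ?f (real (Suc k) * u)) sums ((\<phi> 0 / 2) / of_real u - (LINT x:{0<..}|lborel. \<phi> x))"
      using z0[of "1 / u"] u by simp
    then have "(\<lambda>N. of_real u * (\<Sum>n<N. ?f (real (Suc n) * u)) - integral {0..real N * u} ?f) \<longlonglongrightarrow>
       of_real u * ((\<phi> 0 / 2) / of_real u - (LINT x:{0<..}|lborel. \<phi> x)) - A"
      unfolding sums_def by (intro tendsto_intros lim u)
    moreover have "norm (of_real u * (\<Sum>n<N. ?f (real (Suc n) * u)) - integral {0..real N * u} ?f) \<le> u * (C2 * pi / 2)" for N
    proof -
      have "norm (of_real u * (\<Sum>n<N. ?f (real (Suc n) * u)) - integral {0..real N * u} ?f) \<le> u * (C2 * arctan (real N * u))"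
        by (rule riemann_sum_arctan[OF fd C2(2) u(1)])
      also have "\<dots> \<le> u * (C2 * (pi / 2))"
        using u C2(1) arctan_ubound[of "real N * u"] by (intro mult_left_mono) auto
      finally show ?thesis by simp
    qed
    ultimately have "norm (of_real u * ((\<phi> 0 / 2) / of_real u - (LINT x:{0<..}|lborel. \<phi> x)) - A) \<le> u * (C2 * pi / 2)"
      by (intro Lim_norm_ubound[OF sequentially_bot]) auto
    then show ?thesis using u by (simp add: right_diff_distrib)
  qed
  have t1: "((\<lambda>u. norm (\<phi> 0 / 2 - of_real u * (LINT x:{0<..}|lborel. \<phi> x) - A)) \<longlongrightarrow> norm (\<phi> 0 / 2 - of_real 0 * (LINT x:{0<..}|lborel. \<phi> x) - A)) (at_right 0)"
    by (intro tendsto_intros)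
  have t2: "((\<lambda>u. u * (C2 * pi / 2)) \<longlongrightarrow> 0 * (C2 * pi / 2)) (at_right 0)" by (intro tendsto_intros)
  have "eventually (\<lambda>u::real. u \<in> {0<..<1}) (at_right 0)" by (rule eventually_at_right_real) simp
  then have ev: "eventually (\<lambda>u. norm (\<phi> 0 / 2 - of_real u * (LINT x:{0<..}|lborel. \<phi> x) - A) \<le> u * (C2 * pi / 2)) (at_right 0)"
    by eventually_elim (use key in auto)
  have "norm (\<phi> 0 / 2 - of_real 0 * (LINT x:{0<..}|lborel. \<phi> x) - A) \<le> 0 * (C2 * pi / 2)"
    by (rule tendsto_le[OF _ t2 t1 ev]) simp
  then show ?thesis by (simp add: A_def)
qed

text \<open>The correction terms change places in Poisson summation: \<open>\<phi> 0 / 2\<close> is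
  what \<open>E_map\<close> subtracts for \<open>fourier \<phi>\<close>, and the half-line integral
  of \<open>\<phi>\<close> is what it subtracts for \<open>\<phi>\<close>.\<close>

theorem E_map_fourier:
  assumes S: "\<phi> \<in> S_le1" and u: "u > 0"
  shows "E_map (fourier \<phi>) u = E_map \<phi> (1 / u) / of_real u"
proof -
  obtain N where N: "real N * (1 / u) \<ge> 1" using u by (metis reals_Archimedean3 less_imp_le zero_less_divide_1_iff)
  then have "real N / u \<ge> 1" by simp
  from sums_unique[OF sum_fourier[OF S u this], symmetric]
  have sf: "(\<Sum>k. fourier \<phi> (real (Suc k) * u)) =
     (\<phi> 0 / 2 + (\<Sum>n<N. \<phi> (real (Suc n) / u))) / of_real u - (LINT x:{0<..}|lborel. \<phi> x)" .
  have "E_map \<phi> (1 / u) = (\<Sum>n<N. \<phi> (real (Suc n) * (1 / u))) - (LINT x:{0<..}|lborel. \<phi> x) / of_real (1 / u)"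
    by (rule E_map_finite[OF S _ N]) (use u in simp)
  then have E: "E_map \<phi> (1 / u) = (\<Sum>n<N. \<phi> (real (Suc n) / u)) - of_real u * (LINT x:{0<..}|lborel. \<phi> x)"
    by simp
  show ?thesis unfolding E_map_def[of "fourier \<phi>"] integral_fourier[OF S] sf E
    using u by (simp add: add_divide_distrib diff_divide_distrib)
qed

text \<open>As \<open>\<phi> 0 = 0\<close>, the correction term of
  \<open>E_map (fourier \<phi>)\<close> vanishes, and \<open>E_map_fourier\<close> turns small
  \<open>u\<close> into a sum of Fourier coefficients at the large frequencies
  \<open>(k + 1) / u\<close>. Of the \<open>n + 2\<close> powers of decay, two make the sum over
  \<open>k\<close> converge, and one power of \<open>u\<close> is lost to the factor
  \<open>1 / u\<close>.\<close>

lemma E_map_rapid_decay: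
  assumes S: "\<phi> \<in> S_le1" and 0: "\<phi> 0 = 0"
  shows "\<exists>C. \<forall>u. 0 < u \<longrightarrow> u < 1 \<longrightarrow> norm (E_map \<phi> u) \<le> C * u powr real n"
proof -
  obtain C where C: "C \<ge> 0" "\<And>y. \<bar>y\<bar> ^ (n + 2) * norm (fourier \<phi> y) \<le> C"
    using fourier_power_decay[OF S, of "n+2"] by blast
  have sq: "summable (\<lambda>k. 1 / (real (Suc k))\<^sup>2)"
    using summable_Suc_iff[of "\<lambda>k. 1 / (real k)\<^sup>2"] summable_inverse_squares by simp
  define C' where "C' = C * (\<Sum>k. 1 / (real (Suc k))\<^sup>2)"
  have "norm (E_map \<phi> u) \<le> C' * u powr real n" if u: "0 < u" "u < 1" for u
  proof -
    have E: "E_map \<phi> u = (\<Sum>k. fourier \<phi> (real (Suc k) * (1 / u))) / of_real u"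
      using E_map_fourier[OF S, of "1 / u"] u integral_fourier[OF S] 0
      by (simp add: E_map_def[of "fourier \<phi>"] field_simps)
    have b: "norm (fourier \<phi> (real (Suc k) * (1 / u))) \<le> C * u ^ (n + 2) * (1 / (real (Suc k))\<^sup>2)" for k
    proof -
      have "(real (Suc k))\<^sup>2 \<le> real (Suc k) ^ (n + 2)" by (intro power_increasing) auto
      then have "(real (Suc k))\<^sup>2 * (1 / u) ^ (n + 2) * norm (fourier \<phi> (real (Suc k) * (1 / u)))
          \<le> real (Suc k) ^ (n + 2) * (1 / u) ^ (n + 2) * norm (fourier \<phi> (real (Suc k) * (1 / u)))"
        using u by (intro mult_right_mono) auto
      also have "\<dots> = \<bar>real (Suc k) * (1 / u)\<bar> ^ (n + 2) * norm (fourier \<phi> (real (Suc k) * (1 / u)))"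
        using u by (simp only: power_mult_distrib abs_mult power_abs abs_of_nonneg of_nat_0_le_iff zero_le_divide_1_iff less_imp_le)
      also have "\<dots> \<le> C" by (rule C(2))
      finally have "(real (Suc k))\<^sup>2 * (1 / u) ^ (n + 2) * norm (fourier \<phi> (real (Suc k) * (1 / u))) \<le> C" .
      then show ?thesis using u by (simp add: field_simps power_divide del: of_nat_Suc)
    qed
    have "norm (\<Sum>k. fourier \<phi> (real (Suc k) * (1 / u))) \<le> (\<Sum>k. C * u ^ (n + 2) * (1 / (real (Suc k))\<^sup>2))"
      by (rule norm_suminf_le[OF b summable_mult[OF sq]])
    also have "\<dots> = C' * u ^ (n + 2)" unfolding C'_def using suminf_mult[OF sq, of "C * u ^ (n + 2)"] by (simp add: mult_ac)
    finally have "norm (\<Sum>k. fourier \<phi> (real (Suc k) * (1 / u))) / u \<le> C' * u ^ (n + 2) / u"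
      by (rule divide_right_mono) (use u in simp)
    then have "norm (E_map \<phi> u) \<le> C' * u ^ (n + 2) / u"
      unfolding E norm_divide using u by simp
    also have "\<dots> = C' * u ^ n * u" using u by (simp add: power_add power2_eq_square)
    also have "\<dots> \<le> C' * u ^ n * 1"
    proof (rule mult_left_mono)
      have "C' \<ge> 0" unfolding C'_def using C(1) sq by (intro mult_nonneg_nonneg suminf_nonneg) auto
      then show "0 \<le> C' * u ^ n" using u by simp
    qed (use u in simp)
    finally show ?thesis using u by (simp add: powr_realpow)
  qed
  then show ?thesis by blast
qed

section \<open>The zeta function\<close>

definition half_integral :: "(real \<Rightarrow> complex) \<Rightarrow> complex" where
  "half_integral \<phi> = (LINT x:{0<..}|lborel. \<phi> x)"

lemma S_le1_bounded:
  assumes "\<phi> \<in> S_le1" obtains B where "B \<ge> 0" "\<And>x. norm (\<phi> x) \<le> B"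
proof -
  have z: "1 \<le> \<bar>x\<bar> \<Longrightarrow> \<phi> x = 0" for x by (rule S_le1_zero'[OF assms])
  show ?thesis using compact_support_bounded[OF S_le1_continuous[OF assms] z] that by metis
qed

lemma mellin01_S_integrable:
  assumes S: "\<phi> \<in> S_le1" and s: "Re s > 0"
  shows "set_integrable lborel {0<..<1} (\<lambda>u. \<phi> u * of_real u powr (s - 1))"
proof -
  obtain B where B: "B \<ge> 0" "\<And>x. norm (\<phi> x) \<le> B" using S_le1_bounded[OF S] by blast
  show ?thesis
    by (rule mellin01_integrable[OF S_le1_measurable[OF S] bounded_mellin01_integrable[OF S_le1_measurable[OF S], of B 0 "Re s"]])
       (use B s in auto)
qed

lemma mellin01_S_holomorphic: "\<phi> \<in> S_le1 \<Longrightarrow> mellin01 \<phi> holomorphic_on {s. Re s > 0}"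
proof -
  assume S: "\<phi> \<in> S_le1"
  obtain B where B: "B \<ge> 0" "\<And>x. norm (\<phi> x) \<le> B" using S_le1_bounded[OF S] by blast
  show ?thesis
    by (rule mellin01_holomorphic[OF S_le1_measurable[OF S] bounded_mellin01_integrable[OF S_le1_measurable[OF S], of B 0]])
       (use B in auto)
qed

lemma mellin01_E_holomorphic: "\<phi> \<in> S_le1 \<Longrightarrow> mellin01 (E_map \<phi>) holomorphic_on {s. Re s > 0}"
proof -
  assume S: "\<phi> \<in> S_le1"
  have m: "E_map \<phi> \<in> borel_measurable borel" by (rule E_map_measurable[OF S_le1_measurable[OF S]])
  obtain B where B: "B \<ge> 0" "\<And>u. u > 0 \<Longrightarrow> norm (E_map \<phi> u) \<le> B" using E_map_bounded[OF S] by blast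
  show ?thesis
    by (rule mellin01_holomorphic[OF m bounded_mellin01_integrable[OF m, of B 0]]) (use B in auto)
qed

lemma entire_from_halfplanes:
  assumes "\<And>n::nat. f holomorphic_on {s. Re s > - real n}"
  shows "f holomorphic_on UNIV"
proof -
  have "UNIV = (\<Union>n::nat. {s. Re s > - real n})"
  proof (intro set_eqI iffI UNIV_I)
    fix s :: complex
    obtain n where "- Re s < real n" using reals_Archimedean2 by blast
    then show "s \<in> (\<Union>n::nat. {s. Re s > - real n})" by (auto intro!: exI[of _ n])
  qed
  moreover have "f holomorphic_on (\<Union>n::nat. {s. Re s > - real n})"
    by (rule holomorphic_on_UN_open) (use assms open_halfspace_Re_gt in auto)
  ultimately show ?thesis by simp
qed

lemma mellin01_entire:
  assumes m: "G \<in> borel_measurable borel"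
    and "\<And>n. \<exists>C. \<forall>u. 0 < u \<longrightarrow> u < 1 \<longrightarrow> norm (G u) \<le> C * u powr real n"
  shows "mellin01 G holomorphic_on UNIV"
proof (rule entire_from_halfplanes)
  fix n :: nat
  obtain C where C: "\<And>u. 0 < u \<Longrightarrow> u < 1 \<Longrightarrow> norm (G u) \<le> C * u powr real n" using assms(2) by blast
  show "mellin01 G holomorphic_on {s. Re s > - real n}"
    by (rule mellin01_holomorphic[OF m bounded_mellin01_integrable[OF m C]]) auto
qed

text \<open>Substituting \<open>v = (n + 1) * u\<close> in the term of index \<open>n\<close> pulls
  out the Dirichlet coefficient. \<open>Re s > 1\<close> allows the interchange of sum and integral
  and makes the correction term integrable at 0, where it contributes
  \<open>- half_integral \<phi> / (s - 1)\<close>; the factor \<open>s - 1\<close> clears this pole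
  in preparation for the continuation.\<close>

lemma mellin_E_map:
  assumes S: "\<phi> \<in> S_le1" and s: "Re s > 1"
  shows "(s - 1) * mellin01 (E_map \<phi>) s + half_integral \<phi> = (s - 1) * (\<Sum>n. 1 / of_nat (Suc n) powr s) * mellin01 \<phi> s"
proof -
  have m [measurable]: "\<phi> \<in> borel_measurable borel" by (rule S_le1_measurable[OF S])
  define G where "G u = indicator {0<..} u *\<^sub>R (\<phi> u * of_real u powr (s - 1))" for u
  define F where "F n u = indicator {0<..<1} u *\<^sub>R (\<phi> (real (Suc n) * u) * of_real u powr (s - 1))" for n u
  have G: "G = (\<lambda>u. indicator {0<..<1} u *\<^sub>R (\<phi> u * of_real u powr (s - 1)))"
    using S_le1_zero'[OF S] by (auto simp: G_def fun_eq_iff indicator_def)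
  have Gi: "integrable lborel G"
    using mellin01_S_integrable[OF S, of s] s unfolding G set_integrable_def by simp
  have Gm: "integral\<^sup>L lborel G = mellin01 \<phi> s" unfolding G mellin01_def set_lebesgue_integral_def ..
  have FG: "F n u = of_nat (Suc n) powr (1 - s) * G (0 + real (Suc n) * u)" for n u
  proof (cases "u > 0")
    case True
    have "real (Suc n) * u \<ge> 1 * u" using True by (intro mult_right_mono) auto
    then have 1: "F n u = \<phi> (real (Suc n) * u) * of_real u powr (s - 1)"
    proof (cases "u < 1")
      case False
      then have "1 \<le> \<bar>real (Suc n) * u\<bar>" using \<open>real (Suc n) * u \<ge> 1 * u\<close> by linarith
      then show ?thesis using S_le1_zero'[OF S] False by (simp add: F_def del: of_nat_Suc)
    qed (use True in \<open>simp add: F_def del: of_nat_Suc\<close>)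
    have "(of_real (real (Suc n)) * of_real u) powr (s - 1) = (of_real (real (Suc n)) powr (s - 1) * of_real u powr (s - 1) :: complex)"
      using True by (intro powr_times_real) auto
    then have "G (0 + real (Suc n) * u) = \<phi> (real (Suc n) * u) * (of_nat (Suc n) powr (s - 1) * of_real u powr (s - 1))"
      using True by (simp add: G_def del: of_nat_Suc)
    moreover have "of_nat (Suc n) powr (1 - s) * of_nat (Suc n) powr (s - 1) = (1 :: complex)"
      by (simp add: powr_add[symmetric] del: of_nat_Suc)
    ultimately show ?thesis unfolding 1 by (simp add: mult_ac del: of_nat_Suc)
  next
    case False
    then have "\<not> 0 < real (Suc n) * u" by (simp add: zero_less_mult_iff)
    then show ?thesis using False by (simp add: F_def G_def del: of_nat_Suc)
  qed
  have Gai: "integrable lborel (\<lambda>u. G (0 + real (Suc n) * u))" for n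
    by (rule lborel_integrable_real_affine[OF Gi]) simp
  have Fi: "integrable lborel (F n)" for n
    unfolding FG[abs_def] by (intro integrable_mult_right Gai)
  have norm_pow: "norm (of_nat (Suc n) powr (1 - s) :: complex) = real (Suc n) powr (1 - Re s)" for n
    using norm_powr_of_real[of "real (Suc n)" "1 - s"] by simp
  have Fint: "integral\<^sup>L lborel (F n) = 1 / of_nat (Suc n) powr s * mellin01 \<phi> s" for n
  proof -
    have "mellin01 \<phi> s = of_nat (Suc n) * (LINT u|lborel. G (0 + real (Suc n) * u))"
      using lborel_integral_real_affine[of "real (Suc n)" G 0] Gm by (simp add: scaleR_conv_of_real)
    moreover have "integral\<^sup>L lborel (F n) = of_nat (Suc n) powr (1 - s) * (LINT u|lborel. G (0 + real (Suc n) * u))"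
      unfolding FG[abs_def] by simp
    moreover have "of_nat (Suc n) powr (1 - s) = (of_nat (Suc n) / of_nat (Suc n) powr s :: complex)"
      by (simp add: powr_diff del: of_nat_Suc)
    ultimately show ?thesis by simp
  qed
  have Fnorm: "(LINT u|lborel. norm (F n u)) = real (Suc n) powr (- Re s) * (LINT u|lborel. norm (G u))" for n
  proof -
    have "(LINT u|lborel. norm (G u)) = real (Suc n) * (LINT u|lborel. norm (G (0 + real (Suc n) * u)))"
      using lborel_integral_real_affine[of "real (Suc n)" "\<lambda>u. norm (G u)" 0] by simp
    moreover have "(LINT u|lborel. norm (F n u)) = real (Suc n) powr (1 - Re s) * (LINT u|lborel. norm (G (0 + real (Suc n) * u)))"
      unfolding FG[abs_def] norm_mult norm_pow by simp
    moreover have "real (Suc n) powr (1 - Re s) = real (Suc n) powr (- Re s) * real (Suc n)"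
      by (simp add: powr_diff powr_minus divide_inverse)
    ultimately show ?thesis by simp
  qed
  have sm: "summable (\<lambda>n. real (Suc n) powr (- Re s))"
    using summable_real_powr_iff[of "- Re s"] s by (subst summable_Suc_iff) simp
  have fin: "finite {n. F n u \<noteq> 0}" for u
  proof (cases "u > 0")
    case True
    obtain N where N: "real N * u \<ge> 1" using True by (metis reals_Archimedean3 less_imp_le)
    have "{n. F n u \<noteq> 0} \<subseteq> {..N}"
    proof clarify
      fix n assume n: "F n u \<noteq> 0"
      show "n \<le> N"
      proof (rule ccontr)
        assume "\<not> n \<le> N"
        then have "real N * u \<le> real (Suc n) * u" using True by (intro mult_right_mono) auto
        then have "\<phi> (real (Suc n) * u) = 0" using N by (intro S_le1_zero'[OF S]) linarith
        then show False using n by (simp add: F_def)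
      qed
    qed
    then show ?thesis by (rule finite_subset) simp
  qed (simp add: F_def)
  have "(\<lambda>n. integral\<^sup>L lborel (F n)) sums (LINT u|lborel. (\<Sum>n. F n u))"
  proof (rule sums_integral[OF Fi])
    show "AE u in lborel. summable (\<lambda>n. norm (F n u))"
    proof (rule AE_I2)
      show "summable (\<lambda>n. norm (F n u))" for u by (rule summable_finite[OF fin[of u]]) auto
    qed
    show "summable (\<lambda>n. LINT u|lborel. norm (F n u))" unfolding Fnorm by (intro summable_mult2 sm)
  qed
  then have A: "(LINT u|lborel. (\<Sum>n. F n u)) = (\<Sum>n. 1 / of_nat (Suc n) powr s) * mellin01 \<phi> s"
  proof -
    assume a: "(\<lambda>n. integral\<^sup>L lborel (F n)) sums (LINT u|lborel. (\<Sum>n. F n u))"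
    have "summable (\<lambda>n. 1 / of_nat (Suc n) powr s :: complex)"
    proof (rule summable_comparison_test'[OF sm])
      show "norm (1 / of_nat (Suc n) powr s :: complex) \<le> real (Suc n) powr (- Re s)" for n
        using norm_powr_of_real[of "real (Suc n)" s] by (simp add: norm_divide powr_minus divide_inverse norm_inverse del: of_nat_Suc)
    qed
    from sums_mult2[OF summable_sums[OF this], of "mellin01 \<phi> s"] a
    show ?thesis unfolding Fint using sums_unique2 by blast
  qed
  have Fs: "integrable lborel (\<lambda>u. \<Sum>n. F n u)"
  proof (rule integrable_suminf[OF Fi])
    show "AE u in lborel. summable (\<lambda>n. norm (F n u))"
    proof (rule AE_I2)
      show "summable (\<lambda>n. norm (F n u))" for u by (rule summable_finite[OF fin[of u]]) auto
    qed
    show "summable (\<lambda>n. LINT u|lborel. norm (F n u))" unfolding Fnorm by (intro summable_mult2 sm)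
  qed
  have pi: "integrable lborel (\<lambda>u. indicator {0<..<1} u *\<^sub>R (of_real u powr (s - 2) :: complex))"
    using set_integrable_cpowr_01[of "s - 2"] s by (simp add: set_integrable_def)
  have Es: "indicator {0<..<1} u *\<^sub>R (E_map \<phi> u * of_real u powr (s - 1)) =
      (\<Sum>n. F n u) - half_integral \<phi> * (indicator {0<..<1} u *\<^sub>R of_real u powr (s - 2))" for u
  proof (cases "u \<in> {0<..<1}")
    case True
    then have u: "u > 0" by simp
    have "finite {n. \<phi> (real (Suc n) * u) \<noteq> 0}"
      using fin[of u] True by (simp add: F_def)
    then have sum\<phi>: "summable (\<lambda>n. \<phi> (real (Suc n) * u))" by (intro summable_finite) auto
    have "(\<Sum>n. F n u) = (\<Sum>n. \<phi> (real (Suc n) * u)) * of_real u powr (s - 1)"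
      using suminf_mult2[OF sum\<phi>, of "of_real u powr (s - 1)"] True by (simp add: F_def)
    moreover have "of_real u powr (s - 1) / of_real u = (of_real u powr (s - 2) :: complex)"
    proof -
      have "of_real u powr (s - 2) = (of_real u powr ((s - 1) - 1) :: complex)" by (simp add: algebra_simps)
      also have "\<dots> = of_real u powr (s - 1) / of_real u" using u by (subst powr_diff) auto
      finally show ?thesis ..
    qed
    moreover have "E_map \<phi> u * of_real u powr (s - 1) =
       (\<Sum>n. \<phi> (real (Suc n) * u)) * of_real u powr (s - 1) - half_integral \<phi> * (of_real u powr (s - 1) / of_real u)"
      by (simp add: E_map_def half_integral_def left_diff_distrib)
    ultimately show ?thesis using True by simp
  qed (simp add: F_def)
  have "mellin01 (E_map \<phi>) s = (LINT u|lborel. (\<Sum>n. F n u)) - half_integral \<phi> * (LINT u:{0<..<1}|lborel. of_real u powr (s - 2))"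
    unfolding mellin01_def set_lebesgue_integral_def Es Bochner_Integration.integral_diff[OF Fs integrable_mult_right[OF pi]]
      integral_mult_right_zero ..
  also have "(LINT u:{0<..<1}|lborel. of_real u powr (s - 2)) = 1 / (s - 1)"
    using integral_cpowr_01[of "s - 2"] s by simp
  finally have "mellin01 (E_map \<phi>) s = (LINT u|lborel. (\<Sum>n. F n u)) - half_integral \<phi> * (1 / (s - 1))" .
  moreover have "s - 1 \<noteq> 0" using s by auto
  ultimately have "(s - 1) * mellin01 (E_map \<phi>) s + half_integral \<phi> = (s - 1) * (LINT u|lborel. (\<Sum>n. F n u))"
    by (simp only: right_diff_distrib) simp
  then show ?thesis unfolding A by (simp only: mult.assoc)
qed

text \<open>With \<open>t = Im s\<close> the oscillations cancel and the integrand is nonnegative,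
  so a part of the support suffices. On its middle third both fractions in the exponent are at most
  3, whence \<open>exp (-6)\<close>, and the power of \<open>u\<close> is at least
  \<open>(1 - \<eta>) ^ N\<close>.\<close>

lemma bump_mellin01_lower:
  assumes \<eta>: "0 < \<eta>" "\<eta> \<le> 1/2" and N: "Re s \<le> real N + 1"
  shows "norm (mellin01 (bump \<eta> (Im s)) s) \<ge> \<eta> / 3 * exp (-6) * (1 - \<eta>) ^ N"
proof -
  define \<sigma> where "\<sigma> = Re s"
  define h where "h u = indicator {1 - \<eta><..<1} u * (exp (- (\<eta> / (u - (1 - \<eta>))) - \<eta> / (1 - u)) * u powr (\<sigma> - 1))" for u
  have h: "indicator {0<..<1} u *\<^sub>R (bump \<eta> (Im s) u * of_real u powr (s - 1)) = complex_of_real (h u)" for u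
  proof (cases "u \<in> {1 - \<eta><..<1}")
    case True
    then have u: "u > 0" "u < 1" using \<eta> by auto
    have "of_real u powr (- \<i> * of_real (Im s)) * of_real u powr (s - 1) = complex_of_real (u powr (\<sigma> - 1))"
    proof -
      have "- \<i> * of_real (Im s) + (s - 1) = of_real (\<sigma> - 1)" by (simp add: complex_eq_iff \<sigma>_def)
      then show ?thesis using u by (simp only: powr_add[symmetric] powr_of_real less_imp_le)
    qed
    then show ?thesis using True u bump_eq[OF \<eta>, of u "Im s"] by (simp add: h_def mult.assoc)
  next
    case False
    then show ?thesis by (auto simp: h_def bump_def indicator_def)
  qed
  have m: "mellin01 (bump \<eta> (Im s)) s = of_real (integral\<^sup>L lborel h)"
    unfolding mellin01_def set_lebesgue_integral_def h by (rule integral_complex_of_real)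
  define c where "c = exp (-6) * (1 - \<eta>) ^ N"
  have c0: "c \<ge> 0" using \<eta> by (simp add: c_def)
  have hm: "h \<in> borel_measurable borel" unfolding h_def by measurable
  have hb: "\<bar>h u\<bar> \<le> indicator {0..1} u * max 1 ((1/2) powr (\<sigma> - 1))" for u
  proof (cases "u \<in> {1 - \<eta><..<1}")
    case True
    then have u: "u > 1/2" "u < 1" using \<eta> by auto
    have "\<eta> / (u - (1 - \<eta>)) \<ge> 0" "\<eta> / (1 - u) \<ge> 0" using True \<eta> by auto
    then have "exp (- (\<eta> / (u - (1 - \<eta>))) - \<eta> / (1 - u)) \<le> 1" unfolding exp_le_one_iff by linarith
    moreover have "u powr (\<sigma> - 1) \<le> max 1 ((1/2) powr (\<sigma> - 1))"
    proof (cases "\<sigma> \<ge> 1")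
      case True
      then have "u powr (\<sigma> - 1) \<le> 1 powr (\<sigma> - 1)" using u by (intro powr_mono2) auto
      then show ?thesis by simp
    next
      case False
      then have "u powr (\<sigma> - 1) \<le> (1/2) powr (\<sigma> - 1)" using u by (intro powr_mono2') auto
      then show ?thesis by simp
    qed
    ultimately have "exp (- (\<eta> / (u - (1 - \<eta>))) - \<eta> / (1 - u)) * u powr (\<sigma> - 1) \<le> 1 * max 1 ((1/2) powr (\<sigma> - 1))"
      by (intro mult_mono) auto
    then show ?thesis using True u by (simp add: h_def abs_mult)
  qed (simp add: h_def)
  have hi: "integrable lborel h"
  proof (rule Bochner_Integration.integrable_bound)
    show "integrable lborel (\<lambda>u. indicator {0..1::real} u * max 1 ((1/2) powr (\<sigma> - 1)))"
      using borel_integrable_atLeastAtMost'[of 0 1 "\<lambda>_. max 1 ((1/2) powr (\<sigma> - 1))"]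
      by (simp add: set_integrable_def)
    show "AE u in lborel. norm (h u) \<le> norm (indicator {0..1} u * max 1 ((1/2) powr (\<sigma> - 1)))"
      using hb by (auto intro!: AE_I2 order_trans[OF hb])
  qed (use hm in simp)
  have J: "set_integrable lborel {1 - 2 * \<eta> / 3..1 - \<eta> / 3} (\<lambda>_. c)"
    by (rule borel_integrable_atLeastAtMost'[OF continuous_on_const])
  have "(LINT u:{1 - 2 * \<eta> / 3..1 - \<eta> / 3}|lborel. c) \<le> integral\<^sup>L lborel h"
    unfolding set_lebesgue_integral_def
  proof (rule integral_mono[OF J[unfolded set_integrable_def] hi])
    fix u
    show "indicator {1 - 2 * \<eta> / 3..1 - \<eta> / 3} u *\<^sub>R c \<le> h u"
    proof (cases "u \<in> {1 - 2 * \<eta> / 3..1 - \<eta> / 3}")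
      case True
      then have u: "1 - \<eta> < u" "u < 1" "u > 0" "u - (1 - \<eta>) \<ge> \<eta> / 3" "1 - u \<ge> \<eta> / 3" using \<eta> by auto
      have "\<eta> / (u - (1 - \<eta>)) \<le> 3" using u by (subst pos_divide_le_eq) auto
      moreover have "\<eta> / (1 - u) \<le> 3" using u by (subst pos_divide_le_eq) auto
      ultimately  have 1: "exp (-6) \<le> exp (- (\<eta> / (u - (1 - \<eta>))) - \<eta> / (1 - u))" unfolding exp_le_cancel_iff by linarith
      have "(1 - \<eta>) ^ N \<le> u ^ N" using u \<eta> by (intro power_mono) auto
      also have "\<dots> = u powr real N" using u by (simp add: powr_realpow)
      also have "\<dots> \<le> u powr (\<sigma> - 1)" using u N by (intro powr_mono') (auto simp: \<sigma>_def)
      finally have "c \<le> exp (- (\<eta> / (u - (1 - \<eta>))) - \<eta> / (1 - u)) * u powr (\<sigma> - 1)"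
        unfolding c_def using 1 \<eta> by (intro mult_mono) auto
      then show ?thesis using True u by (simp add: h_def)
    next
      case False
      then show ?thesis by (auto simp: h_def indicator_def)
    qed
  qed
  moreover have "(LINT u:{1 - 2 * \<eta> / 3..1 - \<eta> / 3}|lborel. c) = \<eta> / 3 * c"
    unfolding set_borel_integral_eq_integral(2)[OF J] using \<eta> by simp
  ultimately have "\<eta> / 3 * c \<le> \<bar>integral\<^sup>L lborel h\<bar>" by linarith
  then show ?thesis unfolding m by (simp add: c_def mult.assoc)
qed

lemma bump_mellin01_nonzero:
  assumes "0 < \<eta>" "\<eta> \<le> 1/2" shows "mellin01 (bump \<eta> (Im s)) s \<noteq> 0"
proof -
  obtain N where "Re s - 1 < real N" using reals_Archimedean2 by blast
  then have "norm (mellin01 (bump \<eta> (Im s)) s) \<ge> \<eta> / 3 * exp (-6) * (1 - \<eta>) ^ N"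
    by (intro bump_mellin01_lower assms) simp
  moreover have "\<eta> / 3 * exp (-6) * (1 - \<eta>) ^ N > 0" using assms by (intro mult_pos_pos zero_less_power) auto
  ultimately show ?thesis by auto
qed

lemma mellin01_1: "\<phi> \<in> S_le1 \<Longrightarrow> mellin01 \<phi> 1 = half_integral \<phi>"
proof -
  assume S: "\<phi> \<in> S_le1"
  show ?thesis unfolding mellin01_def half_integral_def set_lebesgue_integral_def
  proof (rule Bochner_Integration.integral_cong[OF refl])
    show "indicator {0<..<1} x *\<^sub>R (\<phi> x * of_real x powr (1 - 1)) = indicator {0<..} x *\<^sub>R \<phi> x" for x
      using S_le1_zero'[OF S, of x] by (cases "x < 1") (auto simp: indicator_def)
  qed
qed

text \<open>A bump vanishes near 0. So it decays faster than any power there, and having value 0 at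
  0 the same holds for its image under \<open>E_map\<close>, by Poisson summation.\<close>

lemma mellin01_bump_entire:
  assumes \<eta>: "0 < \<eta>" "\<eta> \<le> 1/2"
  shows "mellin01 (bump \<eta> t) holomorphic_on UNIV" "mellin01 (E_map (bump \<eta> t)) holomorphic_on UNIV"
proof -
  note S = bump_in_S_le1[OF \<eta>, of t]
  have "norm (bump \<eta> t u) \<le> 2 ^ n * u powr real n" if "0 < u" "u < 1" for u n
  proof (cases "1/2 < u")
    case True
    then have "1 \<le> (2 * u) ^ n" by (intro one_le_power) simp
    then show ?thesis using norm_bump_le_1[OF \<eta>, of t u] that by (simp add: powr_realpow power_mult_distrib)
  next
    case False
    then have "bump \<eta> t u = 0" using that \<eta> by (simp add: bump_def)
    then show ?thesis by simp
  qed
  then show "mellin01 (bump \<eta> t) holomorphic_on UNIV"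
    by (intro mellin01_entire S_le1_measurable[OF S]) blast
  have "bump \<eta> t 0 = 0" using \<eta> by (simp add: bump_def)
  then show "mellin01 (E_map (bump \<eta> t)) holomorphic_on UNIV"
    by (intro mellin01_entire E_map_measurable S_le1_measurable[OF S] E_map_rapid_decay[OF S])
qed

text \<open>\<open>Z\<close> is glued from the Mellin identities of the bumps of width
  \<open>1/2\<close>: at \<open>s\<close> the bump with \<open>t = Im s\<close> has a nonzero
  transform. At \<open>s = 1\<close> the identity compares \<open>half_integral\<close> with itself,
  which gives \<open>Z 1 = 1\<close>. The quotient \<open>Z s / (s - 1)\<close> witnesses the choice
  in \<open>riemann_zeta\<close>, and the identity theorem shows that the chosen function equals it
  off 1.\<close>

lemma zeta_continuation:
  obtains Z where "Z holomorphic_on UNIV" "Z 1 = 1"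
    "\<And>s. s \<noteq> 1 \<Longrightarrow> riemann_zeta s = Z s / (s - 1)"
    "\<And>s. Re s > 1 \<Longrightarrow> Z s = (s - 1) * (\<Sum>n. 1 / of_nat (Suc n) powr s)"
    "\<And>\<phi> s. \<phi> \<in> S_le1 \<Longrightarrow> Re s > 0 \<Longrightarrow> (s - 1) * mellin01 (E_map \<phi>) s + half_integral \<phi> = Z s * mellin01 \<phi> s"
proof -
  let ?D = "\<lambda>s. \<Sum>n. 1 / of_nat (Suc n) powr s :: complex"
  have op: "open {s::complex. Re s > c}" for c by (rule open_halfspace_Re_gt)
  have ex2: "2 \<in> {s::complex. Re s > 1}" by simp
  have bS: "bump (1/2) t \<in> S_le1" for t by (rule bump_in_S_le1) auto
  have "\<exists>Z. Z holomorphic_on UNIV \<and> (\<forall>s\<in>{s. Re s > 1}. Z s = (s - 1) * ?D s) \<and>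
    (\<forall>t\<in>UNIV. \<forall>s\<in>UNIV. (s - 1) * mellin01 (E_map (bump (1/2) t)) s + half_integral (bump (1/2) t) = Z s * mellin01 (bump (1/2) t) s)"
  proof (rule glue_holomorphic[where V = "{s. Re s > 1}"])
    show "{s::complex. Re s > 1} \<noteq> {}" using ex2 by blast
    show "\<exists>t\<in>UNIV. mellin01 (bump (1/2) t) s \<noteq> 0" for s using bump_mellin01_nonzero[of "1/2" s] by auto
    show "(s - 1) * mellin01 (E_map (bump (1/2) t)) s + half_integral (bump (1/2) t) = (s - 1) * ?D s * mellin01 (bump (1/2) t) s"
      if "s \<in> {s. Re s > 1}" for s t using mellin_E_map[OF bS, of s t] that by simp
  qed (auto intro!: holomorphic_intros mellin01_bump_entire op)
  then obtain Z where Z: "Z holomorphic_on UNIV" "\<And>s. Re s > 1 \<Longrightarrow> Z s = (s - 1) * ?D s"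
    "\<And>s t. (s - 1) * mellin01 (E_map (bump (1/2) t)) s + half_integral (bump (1/2) t) = Z s * mellin01 (bump (1/2) t) s" by auto
  have Z1: "Z 1 = 1"
    using Z(3)[of 1 "Im 1"] mellin01_1[OF bS, of "Im 1"] bump_mellin01_nonzero[of "1/2" 1] by auto
  have zex: "(\<lambda>s. Z s / (s - 1)) holomorphic_on - {1} \<and> (\<forall>s. Re s > 1 \<longrightarrow> Z s / (s - 1) = ?D s)"
    using Z(2) by (auto intro!: holomorphic_intros holomorphic_on_subset[OF Z(1)])
  have rz: "riemann_zeta holomorphic_on - {1} \<and> (\<forall>s. Re s > 1 \<longrightarrow> riemann_zeta s = ?D s)"
    unfolding riemann_zeta_def by (rule someI[of _ "\<lambda>s. Z s / (s - 1)"]) (rule zex)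
  have zeta: "riemann_zeta s = Z s / (s - 1)" if "s \<noteq> 1" for s
  proof (rule analytic_continuation_open[of "{s. Re s > 1}" "- {1}" riemann_zeta "\<lambda>s. Z s / (s - 1)"])
    show "riemann_zeta s = Z s / (s - 1)" if "s \<in> {s. Re s > 1}" for s
      using rz zex that by (metis mem_Collect_eq)
    show "connected (- {1::complex})" by (simp add: connected_punctured_universe)
    show "{s::complex. Re s > 1} \<noteq> {}" using ex2 by blast
  qed (use op rz zex that in \<open>simp_all, force\<close>)
  have all: "(s - 1) * mellin01 (E_map \<phi>) s + half_integral \<phi> = Z s * mellin01 \<phi> s" if S: "\<phi> \<in> S_le1" and s: "Re s > 0" for \<phi> s
  proof (rule analytic_continuation_open[of "{s. Re s > 1}" "{s. Re s > 0}"
        "\<lambda>s. (s - 1) * mellin01 (E_map \<phi>) s + half_integral \<phi>" "\<lambda>s. Z s * mellin01 \<phi> s"])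
    show "{s::complex. Re s > 1} \<noteq> {}" using ex2 by blast
    show "connected {s::complex. Re s > 0}" by (intro convex_connected convex_halfspace_Re_gt)
    show "(s - 1) * mellin01 (E_map \<phi>) s + half_integral \<phi> = Z s * mellin01 \<phi> s" if "s \<in> {s. Re s > 1}" for s
      using mellin_E_map[OF S, of s] Z(2)[of s] that by simp
  qed (use op s in \<open>auto intro!: holomorphic_intros mellin01_E_holomorphic[OF S] mellin01_S_holomorphic[OF S] holomorphic_on_subset[OF Z(1)]\<close>)
  show ?thesis by (rule that[OF Z(1) Z1 zeta Z(2) all])
qed

section \<open>Orthogonal projection in \<open>L2\<close>\<close>

lemma measurable_cnj [measurable]: "cnj \<in> borel_measurable borel"
  by (intro borel_measurable_continuous_onI continuous_intros)

lemma L2_measurable: "f \<in> L2 M \<Longrightarrow> f \<in> borel_measurable M" by (simp add: L2_def)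
lemma L2_square_integrable: "f \<in> L2 M \<Longrightarrow> integrable M (\<lambda>x. (norm (f x))\<^sup>2)" by (simp add: L2_def)

lemma norm_add_square_le: "(norm (a + b))\<^sup>2 \<le> 2 * (norm a)\<^sup>2 + 2 * (norm b)\<^sup>2" for a b :: complex
proof -
  have "(norm (a + b))\<^sup>2 \<le> (norm a + norm b)\<^sup>2" by (intro power_mono norm_triangle_ineq) auto
  also have "\<dots> \<le> 2 * (norm a)\<^sup>2 + 2 * (norm b)\<^sup>2"
    using sum_squares_bound[of "norm a" "norm b"] by (simp add: power2_eq_square algebra_simps)
  finally show ?thesis .
qed

lemma L2_add:
  assumes "f \<in> L2 M" "g \<in> L2 M" shows "(\<lambda>x. f x + g x) \<in> L2 M"
proof -
  note [measurable] = L2_measurable[OF assms(1)] L2_measurable[OF assms(2)]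
  have "integrable M (\<lambda>x. 2 * (norm (f x))\<^sup>2 + 2 * (norm (g x))\<^sup>2)"
    using assms by (intro Bochner_Integration.integrable_add integrable_mult_right) (auto dest: L2_square_integrable)
  then have "integrable M (\<lambda>x. (norm (f x + g x))\<^sup>2)"
    by (rule Bochner_Integration.integrable_bound) (auto intro!: AE_I2 norm_add_square_le)
  then show ?thesis by (simp add: L2_def)
qed

lemma L2_cmult:
  assumes "f \<in> L2 M" shows "(\<lambda>x. c * f x) \<in> L2 M"
  using assms unfolding L2_def by (auto simp: norm_mult power_mult_distrib)

lemma L2_diff:
  assumes "f \<in> L2 M" "g \<in> L2 M" shows "(\<lambda>x. f x - g x) \<in> L2 M"
  using L2_add[OF assms(1) L2_cmult[OF assms(2), of "-1"]] by simp

lemma L2_prod_integrable: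
  assumes "f \<in> L2 M" "g \<in> L2 M" shows "integrable M (\<lambda>x. f x * cnj (g x))"
proof -
  note [measurable] = L2_measurable[OF assms(1)] L2_measurable[OF assms(2)]
  have "integrable M (\<lambda>x. (norm (f x))\<^sup>2 + (norm (g x))\<^sup>2)"
    using assms by (intro Bochner_Integration.integrable_add) (auto dest: L2_square_integrable)
  then show ?thesis
  proof (rule Bochner_Integration.integrable_bound)
    have "norm (f x * cnj (g x)) \<le> norm ((norm (f x))\<^sup>2 + (norm (g x))\<^sup>2)" for x
    proof -
      have "0 \<le> norm (f x) * norm (g x)" by simp
      moreover have "2 * (norm (f x) * norm (g x)) \<le> (norm (f x))\<^sup>2 + (norm (g x))\<^sup>2"
        using sum_squares_bound[of "norm (f x)" "norm (g x)"] by (simp only: mult.assoc)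
      moreover have "norm (f x * cnj (g x)) = norm (f x) * norm (g x)" by (simp add: norm_mult)
      moreover have "norm ((norm (f x))\<^sup>2 + (norm (g x))\<^sup>2) = (norm (f x))\<^sup>2 + (norm (g x))\<^sup>2" by simp
      ultimately show ?thesis by linarith
    qed
    then show "AE x in M. norm (f x * cnj (g x)) \<le> norm ((norm (f x))\<^sup>2 + (norm (g x))\<^sup>2)" by simp
  qed simp
qed

definition L2_sq :: "'a measure \<Rightarrow> ('a \<Rightarrow> complex) \<Rightarrow> real" where
  "L2_sq M f = (LINT x|M. (norm (f x))\<^sup>2)"

lemma L2_sq_nonneg: "L2_sq M f \<ge> 0" by (simp add: L2_sq_def)

lemma L2_norm_eq: "L2_norm M f = sqrt (L2_sq M f)" by (simp add: L2_norm_def L2_sq_def)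

lemma L2_sq_expand:
  assumes "f \<in> L2 M" "g \<in> L2 M"
  shows "L2_sq M (\<lambda>x. f x - c * g x) = L2_sq M f - 2 * Re (cnj c * L2_inner M f g) + (norm c)\<^sup>2 * L2_sq M g"
proof -
  note i = L2_prod_integrable[OF assms] L2_square_integrable[OF assms(1)] L2_square_integrable[OF assms(2)]
  have i1: "integrable M (\<lambda>x. 2 * Re (cnj c * (f x * cnj (g x))))"
    by (intro integrable_mult_right integrable_Re i)
  have i2: "integrable M (\<lambda>x. (norm c)\<^sup>2 * (norm (g x))\<^sup>2)" by (intro integrable_mult_right i)
  have "(norm (a - c * b))\<^sup>2 = (norm a)\<^sup>2 - 2 * Re (cnj c * (a * cnj b)) + (norm c)\<^sup>2 * (norm b)\<^sup>2" for a b
    unfolding cmod_power2 by (simp add: power2_eq_square algebra_simps)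
  then have "L2_sq M (\<lambda>x. f x - c * g x) = (LINT x|M. (norm (f x))\<^sup>2 - 2 * Re (cnj c * (f x * cnj (g x))) + (norm c)\<^sup>2 * (norm (g x))\<^sup>2)"
    by (simp add: L2_sq_def)
  also have "\<dots> = (LINT x|M. (norm (f x))\<^sup>2) - (LINT x|M. 2 * Re (cnj c * (f x * cnj (g x)))) + (LINT x|M. (norm c)\<^sup>2 * (norm (g x))\<^sup>2)"
    unfolding Bochner_Integration.integral_add[OF Bochner_Integration.integrable_diff[OF i(2) i1] i2]
      Bochner_Integration.integral_diff[OF i(2) i1] ..
  also have "(LINT x|M. 2 * Re (cnj c * (f x * cnj (g x)))) = 2 * Re (LINT x|M. cnj c * (f x * cnj (g x)))"
    unfolding integral_mult_right_zero[of M 2] Bochner_Integration.integral_Re[OF integrable_mult_right[OF i(1)]] ..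
  finally show ?thesis by (simp add: L2_sq_def L2_inner_def)
qed

text \<open>Minimizing the quadratic in \<open>c\<close> proves a form with two uses. With
  \<open>d = 0\<close> it is the usual inequality; with \<open>d\<close> the squared distance from a
  vector to a subspace it says that the difference to a nearly closest point is nearly orthogonal to
  the subspace.\<close>

lemma L2_Cauchy_Schwarz:
  assumes "f \<in> L2 M" "g \<in> L2 M" and lower: "\<And>c. d \<le> L2_sq M (\<lambda>x. f x - c * g x)"
  shows "(norm (L2_inner M f g))\<^sup>2 \<le> (L2_sq M f - d) * L2_sq M g"
proof (cases "L2_sq M g = 0")
  case True
  define w where "w = L2_inner M f g"
  have "w = 0"
  proof (rule ccontr)
    assume "w \<noteq> 0"
    \<comment> \<open>Without a quadratic term, the linear term for this \<open>t\<close> lowers the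
      square to \<open>d - 1\<close>.\<close>
    define t where "t = (L2_sq M f - d + 1) / (2 * (norm w)\<^sup>2)"
    have "d \<le> L2_sq M f - 2 * Re (cnj (of_real t * w) * w)"
      using lower[of "of_real t * w"] L2_sq_expand[OF assms(1,2), of "of_real t * w"] True by (simp add: w_def)
    also have "Re (cnj (of_real t * w) * w) = t * (norm w)\<^sup>2" unfolding cmod_power2 by (simp add: power2_eq_square algebra_simps)
    also have "2 * (t * (norm w)\<^sup>2) = L2_sq M f - d + 1" using \<open>w \<noteq> 0\<close> by (simp add: t_def)
    finally show False by simp
  qed
  then show ?thesis using True by (simp add: w_def)
next
  case False
  define w where "w = L2_inner M f g"
  define G where "G = L2_sq M g"
  have G: "G > 0" using False L2_sq_nonneg[of M g] by (simp add: G_def)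
  have "d \<le> L2_sq M f - 2 * Re (cnj (w / of_real G) * w) + (norm (w / of_real G))\<^sup>2 * G"
    using lower[of "w / of_real G"] L2_sq_expand[OF assms(1,2), of "w / of_real G"] by (simp add: w_def G_def)
  also have "Re (cnj (w / of_real G) * w) = (norm w)\<^sup>2 / G" unfolding cmod_power2 by (simp add: power2_eq_square add_divide_distrib)
  also have "(norm (w / of_real G))\<^sup>2 * G = (norm w)\<^sup>2 / G" using G by (simp add: norm_divide power_divide power2_eq_square)
  finally show ?thesis using G by (simp add: w_def[symmetric] G_def[symmetric] field_simps)
qed

lemma L2_parallelogram:
  assumes "f \<in> L2 M" "g \<in> L2 M"
  shows "L2_sq M (\<lambda>x. f x + g x) + L2_sq M (\<lambda>x. f x - g x) = 2 * L2_sq M f + 2 * L2_sq M g"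
  using L2_sq_expand[OF assms, of 1] L2_sq_expand[OF assms, of "-1"] by simp

text \<open>Squared distances of order \<open>(1/16) ^ n\<close> remain summable after weighting
  with \<open>4 ^ n\<close>. Almost everywhere the weighted pointwise sum is therefore finite, which
  bounds the increments by a multiple of \<open>(1/2) ^ n\<close>.\<close>

lemma L2_complete_AE:
  fixes p :: "nat \<Rightarrow> 'a \<Rightarrow> complex"
  assumes p: "\<And>n. p n \<in> L2 M" and close: "\<And>n. L2_sq M (\<lambda>x. p (Suc n) x - p n x) \<le> (1/16) ^ n"
  shows "AE x in M. convergent (\<lambda>n. p n x)"
proof -
  define d where "d n x = p (Suc n) x - p n x" for n x
  have dL: "d n \<in> L2 M" for n unfolding d_def by (intro L2_diff p)
  note [measurable] = L2_measurable[OF dL]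
  have nn: "(\<integral>\<^sup>+x. ennreal (4 ^ n * (norm (d n x))\<^sup>2) \<partial>M) \<le> ennreal ((1/4) ^ n)" for n
  proof -
    have "(\<integral>\<^sup>+x. ennreal (4 ^ n * (norm (d n x))\<^sup>2) \<partial>M) = ennreal (LINT x|M. 4 ^ n * (norm (d n x))\<^sup>2)"
      by (rule nn_integral_eq_integral) (use L2_square_integrable[OF dL] in auto)
    also have "(LINT x|M. 4 ^ n * (norm (d n x))\<^sup>2) = 4 ^ n * L2_sq M (d n)" by (simp add: L2_sq_def)
    also have "\<dots> \<le> 4 ^ n * (1/16) ^ n" using close[of n] by (intro mult_left_mono) (auto simp: d_def[abs_def])
    also have "\<dots> = (1/4) ^ n" by (simp flip: power_mult_distrib)
    finally show ?thesis by (simp add: ennreal_leI)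
  qed
  have "(\<integral>\<^sup>+x. (\<Sum>n. ennreal (4 ^ n * (norm (d n x))\<^sup>2)) \<partial>M) = (\<Sum>n. \<integral>\<^sup>+x. ennreal (4 ^ n * (norm (d n x))\<^sup>2) \<partial>M)"
    by (rule nn_integral_suminf) measurable
  also have "\<dots> \<le> (\<Sum>n. ennreal ((1/4) ^ n))" by (intro suminf_le nn summableI)
  also have "\<dots> = ennreal (\<Sum>n. (1/4) ^ n)" by (rule suminf_ennreal_eq) (auto intro!: summable_sums summable_geometric)
  also have "\<dots> < \<infinity>" by simp
  finally have "AE x in M. (\<Sum>n. ennreal (4 ^ n * (norm (d n x))\<^sup>2)) \<noteq> \<infinity>"
    by (intro nn_integral_noteq_infinite) auto
  then show ?thesis
  proof eventually_elim
    case (elim x)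
    then have sm: "summable (\<lambda>n. 4 ^ n * (norm (d n x))\<^sup>2)"
      by (intro summable_suminf_not_top) auto
    define K where "K = (\<Sum>n. 4 ^ n * (norm (d n x))\<^sup>2)"
    have "norm (d n x) \<le> sqrt K * (1/2) ^ n" for n
    proof -
      have "4 ^ n * (norm (d n x))\<^sup>2 \<le> K"
        using sum_le_suminf[OF sm, of "{n}"] by (simp add: K_def)
      then have "sqrt (4 ^ n * (norm (d n x))\<^sup>2) \<le> sqrt K" by simp
      moreover have "sqrt (4 ^ n * (norm (d n x))\<^sup>2) = 2 ^ n * norm (d n x)"
      proof -
        have "4 ^ n * (norm (d n x))\<^sup>2 = (2 ^ n * norm (d n x))\<^sup>2"
          by (simp add: power_mult_distrib power2_eq_square flip: power_mult_distrib)
        then show ?thesis by simp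
      qed
      ultimately show ?thesis by (simp add: field_simps)
    qed
    then have "summable (\<lambda>n. d n x)"
      by (intro summable_comparison_test'[OF summable_mult[OF summable_geometric[of "1/2"]], of 0 _ "sqrt K"]) auto
    then have "convergent (\<lambda>n. \<Sum>k<n. d k x)" by (simp add: summable_iff_convergent)
    moreover have "(\<Sum>k<n. d k x) = p n x - p 0 x" for n
      unfolding d_def by (rule sum_lessThan_telescope)
    ultimately have "convergent (\<lambda>n. p n x - p 0 x)" by simp
    then have "convergent (\<lambda>n. (p n x - p 0 x) + p 0 x)" by (intro convergent_add convergent_const)
    then show ?case by simp
  qed
qed

text \<open>Assuming membership and bound only from \<open>N\<close> on lets the lemma be applied to
  the differences \<open>p m - p n\<close> for fixed \<open>n\<close>, which are controlled only for
  \<open>m \<ge> n\<close>.\<close>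

lemma L2_Fatou:
  fixes f :: "nat \<Rightarrow> 'a \<Rightarrow> complex"
  assumes f: "\<And>n. n \<ge> N \<Longrightarrow> f n \<in> L2 M" and g: "g \<in> borel_measurable M"
    and lim: "AE x in M. (\<lambda>n. f n x) \<longlonglongrightarrow> g x" and bd: "\<And>n. n \<ge> N \<Longrightarrow> L2_sq M (f n) \<le> B"
  shows "g \<in> L2 M" "L2_sq M g \<le> B"
proof -
  note [measurable] = g
  have B: "B \<ge> 0" using bd[of N] L2_sq_nonneg[of M "f N"] by simp
  have m: "f (n + N) \<in> borel_measurable M" for n using L2_measurable[OF f] by simp
  have "AE x in M. ennreal ((norm (g x))\<^sup>2) = liminf (\<lambda>n. ennreal ((norm (f (n + N) x))\<^sup>2))"
    using lim
  proof eventually_elim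
    case (elim x)
    then have "(\<lambda>n. ennreal ((norm (f (n + N) x))\<^sup>2)) \<longlonglongrightarrow> ennreal ((norm (g x))\<^sup>2)"
      by (intro tendsto_intros LIMSEQ_ignore_initial_segment)
    then show ?case by (intro lim_imp_Liminf[symmetric]) auto
  qed
  then have "(\<integral>\<^sup>+x. ennreal ((norm (g x))\<^sup>2) \<partial>M) = (\<integral>\<^sup>+x. liminf (\<lambda>n. ennreal ((norm (f (n + N) x))\<^sup>2)) \<partial>M)"
    by (rule nn_integral_cong_AE)
  also have "\<dots> \<le> liminf (\<lambda>n. \<integral>\<^sup>+x. ennreal ((norm (f (n + N) x))\<^sup>2) \<partial>M)"
    by (rule nn_integral_liminf) (use m in measurable)
  also have "\<dots> \<le> liminf (\<lambda>n. ennreal B)"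
  proof (rule Liminf_mono, rule always_eventually, rule allI)
    fix n
    have "(\<integral>\<^sup>+x. ennreal ((norm (f (n + N) x))\<^sup>2) \<partial>M) = ennreal (L2_sq M (f (n + N)))"
      unfolding L2_sq_def by (rule nn_integral_eq_integral) (use L2_square_integrable[OF f] in auto)
    also have "\<dots> \<le> ennreal B" using bd[of "n + N"] by (intro ennreal_leI) simp
    finally show "(\<integral>\<^sup>+x. ennreal ((norm (f (n + N) x))\<^sup>2) \<partial>M) \<le> ennreal B" .
  qed
  finally have le: "(\<integral>\<^sup>+x. ennreal ((norm (g x))\<^sup>2) \<partial>M) \<le> ennreal B" by (simp add: Liminf_const)
  have i: "integrable M (\<lambda>x. (norm (g x))\<^sup>2)"
  proof (rule integrableI_nonneg)
    show "(\<integral>\<^sup>+x. ennreal ((norm (g x))\<^sup>2) \<partial>M) < \<infinity>" using le by (rule order.strict_trans1) simp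
  qed auto
  then show "g \<in> L2 M" using g by (simp add: L2_def)
  have "ennreal (L2_sq M g) \<le> ennreal B"
    using le nn_integral_eq_integral[OF i] by (simp add: L2_sq_def)
  then show "L2_sq M g \<le> B" using B by simp
qed

lemma L2_inner_diff_left:
  assumes "f \<in> L2 M" "g \<in> L2 M" "h \<in> L2 M"
  shows "L2_inner M (\<lambda>x. f x - g x) h = L2_inner M f h - L2_inner M g h"
  unfolding L2_inner_def left_diff_distrib
  by (rule Bochner_Integration.integral_diff) (intro L2_prod_integrable assms)+

lemma L2_inner_commute:
  assumes "f \<in> L2 M" "g \<in> L2 M" shows "L2_inner M g f = cnj (L2_inner M f g)"
proof -
  have "L2_inner M g f = (LINT x|M. cnj (f x * cnj (g x)))" by (simp add: L2_inner_def mult.commute)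
  also have "\<dots> = cnj (L2_inner M f g)" unfolding L2_inner_def by (rule Bochner_Integration.integral_cnj)
  finally show ?thesis .
qed

text \<open>A minimizing sequence in \<open>X\<close> for the distance to \<open>h\<close> is Cauchy
  by the parallelogram law, applied to midpoints; its limit \<open>q\<close> represents the
  projection of \<open>h\<close> to the closure of \<open>X\<close>, and
  \<open>g = h - q\<close>.\<close>

theorem L2_projection:
  assumes X: "X \<subseteq> L2 M" "X \<noteq> {}" and add: "\<And>f g. f \<in> X \<Longrightarrow> g \<in> X \<Longrightarrow> (\<lambda>x. f x + g x) \<in> X"
    and mult: "\<And>c f. f \<in> X \<Longrightarrow> (\<lambda>x. c * f x) \<in> X"
    and h: "h \<in> L2 M" "h \<notin> L2_closure M X"
  obtains g where "g \<in> L2_orth M X" "L2_inner M h g \<noteq> 0"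
proof -
  define D where "D = (\<lambda>f. L2_sq M (\<lambda>x. h x - f x)) ` X"
  define d where "d = Inf D"
  have bdd: "bdd_below D" unfolding D_def by (rule bdd_belowI2[of _ 0]) (rule L2_sq_nonneg)
  have ne: "D \<noteq> {}" using X(2) by (simp add: D_def)
  have dle: "d \<le> L2_sq M (\<lambda>x. h x - f x)" if "f \<in> X" for f
    unfolding d_def by (rule cInf_lower[OF _ bdd]) (use that in \<open>simp add: D_def\<close>)
  have "\<exists>f\<in>X. L2_sq M (\<lambda>x. h x - f x) < d + e" if "e > 0" for e
    using cInf_lessD[OF ne, of "d + e"] that by (auto simp: d_def D_def)
  \<comment> \<open>The parallelogram law bounds the squared distance of \<open>p n\<close> and
    \<open>p m\<close> by twice the sum of the two excesses over \<open>d\<close>. Excesses below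
    \<open>(1/16) ^ n / 4\<close> thus give the rate required for convergence almost
    everywhere.\<close>
  then have "\<forall>n. \<exists>f\<in>X. L2_sq M (\<lambda>x. h x - f x) < d + (1/16) ^ n / 4" by simp
  then obtain p where p: "\<And>n. p n \<in> X" "\<And>n. L2_sq M (\<lambda>x. h x - p n x) < d + (1/16) ^ n / 4" by metis
  have pL: "p n \<in> L2 M" for n using p(1) X(1) by blast
  have hp: "(\<lambda>x. h x - p n x) \<in> L2 M" for n by (intro L2_diff h pL)
  have pp: "L2_sq M (\<lambda>x. p m x - p n x) \<le> (1/16) ^ n" if "n \<le> m" for m n
  proof -
    have mid: "(\<lambda>x. (1/2) * (p m x + p n x)) \<in> X" by (intro mult add p)
    have "L2_sq M (\<lambda>x. (h x - p n x) + (h x - p m x)) + L2_sq M (\<lambda>x. (h x - p n x) - (h x - p m x))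
        = 2 * L2_sq M (\<lambda>x. h x - p n x) + 2 * L2_sq M (\<lambda>x. h x - p m x)"
      by (rule L2_parallelogram[OF hp hp])
    moreover have "L2_sq M (\<lambda>x. (h x - p n x) + (h x - p m x)) = 4 * L2_sq M (\<lambda>x. h x - (1/2) * (p m x + p n x))"
    proof -
      have "(norm ((a - b) + (a - c)))\<^sup>2 = 4 * (norm (a - (1/2) * (c + b)))\<^sup>2" for a b c :: complex
      proof -
        have "(a - b) + (a - c) = 2 * (a - (1/2) * (c + b))" by (simp add: algebra_simps)
        then have "norm ((a - b) + (a - c)) = 2 * norm (a - (1/2) * (c + b))" by (metis norm_mult norm_numeral)
        then show ?thesis by (simp add: power2_eq_square)
      qed
      then show ?thesis by (simp add: L2_sq_def)
    qed
    moreover have "L2_sq M (\<lambda>x. (h x - p n x) - (h x - p m x)) = L2_sq M (\<lambda>x. p m x - p n x)" by simp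
    moreover have "(1/16 :: real) ^ m \<le> (1/16) ^ n" using that by (intro power_decreasing) auto
    ultimately show ?thesis using dle[OF mid] p(2)[of n] p(2)[of m] by linarith
  qed
  define q where "q x = lim (\<lambda>n. p n x)" for x
  have qm: "q \<in> borel_measurable M" unfolding q_def
    by (rule borel_measurable_lim_metric) (use L2_measurable[OF pL] in auto)
  have lim: "AE x in M. (\<lambda>n. p n x) \<longlonglongrightarrow> q x"
    using L2_complete_AE[OF pL pp] by (auto simp: convergent_LIMSEQ_iff q_def)
  have pq: "(\<lambda>x. q x - p n x) \<in> L2 M \<and> L2_sq M (\<lambda>x. q x - p n x) \<le> (1/16) ^ n" for n
  proof -
    have l: "AE x in M. (\<lambda>m. p m x - p n x) \<longlonglongrightarrow> q x - p n x"
      using lim by eventually_elim (intro tendsto_intros)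
    have m: "(\<lambda>x. q x - p n x) \<in> borel_measurable M" using qm L2_measurable[OF pL] by simp
    show ?thesis using L2_Fatou[OF _ m l, of n "(1/16)^n"] L2_diff[OF pL pL] pp by blast
  qed
  have qL: "q \<in> L2 M" using L2_add[OF conjunct1[OF pq[of 0]] pL[of 0]] by simp
  define g where "g x = h x - q x" for x
  have gL: "g \<in> L2 M" unfolding g_def by (intro L2_diff h qL)
  have pow: "(\<lambda>n. (1/16::real) ^ n) \<longlonglongrightarrow> 0" by (intro LIMSEQ_realpow_zero) auto
  have conv: "(\<lambda>n. L2_inner M (\<lambda>x. q x - p n x) f) \<longlonglongrightarrow> 0" if f: "f \<in> L2 M" for f
  proof -
    have "(norm (L2_inner M (\<lambda>x. q x - p n x) f))\<^sup>2 \<le> (1/16) ^ n * L2_sq M f" for n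
    proof -
      have "(norm (L2_inner M (\<lambda>x. q x - p n x) f))\<^sup>2 \<le> (L2_sq M (\<lambda>x. q x - p n x) - 0) * L2_sq M f"
        by (rule L2_Cauchy_Schwarz) (use pq f L2_sq_nonneg in auto)
      also have "\<dots> \<le> (1/16) ^ n * L2_sq M f" using pq[of n] by (intro mult_right_mono L2_sq_nonneg) auto
      finally show ?thesis .
    qed
    then have "(\<lambda>n. (norm (L2_inner M (\<lambda>x. q x - p n x) f))\<^sup>2) \<longlonglongrightarrow> 0"
      by (intro tendsto_sandwich[OF _ _ tendsto_const tendsto_mult_left_zero[OF pow, of "L2_sq M f"]]) auto
    then have "(\<lambda>n. norm (L2_inner M (\<lambda>x. q x - p n x) f)) \<longlonglongrightarrow> 0" using tendsto_real_sqrt by fastforce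
    then show ?thesis by (rule tendsto_norm_zero_cancel)
  qed
  have orth: "L2_inner M g f = 0" if f: "f \<in> X" for f
  proof -
    have fL: "f \<in> L2 M" using f X by blast
    have "(norm (L2_inner M (\<lambda>x. h x - p n x) f))\<^sup>2 \<le> (1/16) ^ n * L2_sq M f" for n
    proof -
      have "(norm (L2_inner M (\<lambda>x. h x - p n x) f))\<^sup>2 \<le> (L2_sq M (\<lambda>x. h x - p n x) - d) * L2_sq M f"
      proof (rule L2_Cauchy_Schwarz[OF hp fL])
        fix c
        have "(\<lambda>x. p n x + c * f x) \<in> X" by (intro add mult p f)
        from dle[OF this] show "d \<le> L2_sq M (\<lambda>x. h x - p n x - c * f x)" by (simp add: algebra_simps)
      qed
      also have "\<dots> \<le> (1/16) ^ n * L2_sq M f"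
      proof (rule mult_right_mono[OF _ L2_sq_nonneg])
        have "(1/16::real) ^ n / 4 \<le> (1/16) ^ n" by simp
        then show "L2_sq M (\<lambda>x. h x - p n x) - d \<le> (1/16) ^ n" using p(2)[of n] by linarith
      qed
      finally show ?thesis .
    qed
    then have "(\<lambda>n. (norm (L2_inner M (\<lambda>x. h x - p n x) f))\<^sup>2) \<longlonglongrightarrow> 0"
      by (intro tendsto_sandwich[OF _ _ tendsto_const tendsto_mult_left_zero[OF pow, of "L2_sq M f"]]) auto
    then have "(\<lambda>n. norm (L2_inner M (\<lambda>x. h x - p n x) f)) \<longlonglongrightarrow> 0" using tendsto_real_sqrt by fastforce
    then have 1: "(\<lambda>n. L2_inner M (\<lambda>x. h x - p n x) f) \<longlonglongrightarrow> 0" by (rule tendsto_norm_zero_cancel)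
    have "L2_inner M g f = L2_inner M (\<lambda>x. h x - p n x) f - L2_inner M (\<lambda>x. q x - p n x) f" for n
      using L2_inner_diff_left[OF hp[of n] conjunct1[OF pq[of n]] fL] by (simp add: g_def[abs_def])
    then have "(\<lambda>n. L2_inner M g f) \<longlonglongrightarrow> 0 - 0" using tendsto_diff[OF 1 conv[OF fL]] by simp
    then show ?thesis by (simp add: LIMSEQ_const_iff)
  qed
  have gO: "g \<in> L2_orth M X"
    unfolding L2_orth_def using gL orth L2_inner_commute[OF gL] X(1) by (auto simp: subset_eq)
  obtain e where e: "e > 0" "\<And>f. f \<in> X \<Longrightarrow> e \<le> L2_norm M (\<lambda>x. h x - f x)"
    using h unfolding L2_closure_def by (auto simp: not_less)
  have gpos: "L2_sq M g > 0"
  proof (rule ccontr)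
    assume "\<not> L2_sq M g > 0"
    then have g0: "L2_sq M g = 0" using L2_sq_nonneg[of M g] by simp
    have "e\<^sup>2 \<le> 2 * (1/16) ^ n" for n
    proof -
      have "e\<^sup>2 \<le> (L2_norm M (\<lambda>x. h x - p n x))\<^sup>2" using e p(1) by (intro power_mono) auto
      also have "\<dots> = L2_sq M (\<lambda>x. g x + (q x - p n x))" by (simp add: L2_norm_eq L2_sq_nonneg g_def)
      also have "\<dots> \<le> 2 * L2_sq M g + 2 * L2_sq M (\<lambda>x. q x - p n x)"
        using L2_parallelogram[OF gL conjunct1[OF pq[of n]]] L2_sq_nonneg[of M "\<lambda>x. g x - (q x - p n x)"] by linarith
      also have "\<dots> \<le> 2 * (1/16) ^ n" using pq[of n] g0 by simp
      finally show ?thesis .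
    qed
    then have "e\<^sup>2 \<le> 2 * 0" by (intro LIMSEQ_le_const[OF tendsto_mult_left[OF pow, of 2]]) auto
    then show False using e(1) by simp
  qed
  \<comment> \<open>As a limit of elements of \<open>X\<close>, \<open>q\<close> is orthogonal to
    \<open>g\<close>; so the inner product of \<open>h\<close> with \<open>g\<close> is the squared
    norm of \<open>g\<close>.\<close>
  have "L2_inner M p' g = 0" if "p' \<in> X" for p' using gO that by (simp add: L2_orth_def)
  then have "L2_inner M (\<lambda>x. q x - p n x) g = L2_inner M q g" for n
    using L2_inner_diff_left[OF qL pL gL] p(1) by simp
  then have "L2_inner M q g = 0" using conv[OF gL] by (simp add: LIMSEQ_const_iff)
  moreover have "L2_inner M g g = of_real (L2_sq M g)"
    unfolding L2_inner_def L2_sq_def integral_complex_of_real[symmetric] by (simp add: complex_norm_square del: of_real_power)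
  moreover have "L2_inner M g g = L2_inner M h g - L2_inner M q g"
    using L2_inner_diff_left[OF h(1) qL gL] by (simp add: g_def[abs_def])
  ultimately have "L2_inner M h g \<noteq> 0" using gpos by simp
  with gO that show ?thesis by blast
qed

section \<open>The inclusion implies the Riemann Hypothesis\<close>

text \<open>The theorem speaks of Lebesgue measure, whereas Fubini's theorem and the dilations are
  applied to Borel functions over \<open>lborel\<close>. Completing the measure changes neither
  integrals nor integrability of Borel functions.\<close>

lemma lebesgue_on_borel:
  fixes F :: "real \<Rightarrow> 'a::{banach, second_countable_topology}"
  assumes S: "S \<in> sets borel" and F: "F \<in> borel_measurable borel"
  shows "integral\<^sup>L (lebesgue_on S) F = (LINT u:S|lborel. F u)"
    "integrable (lebesgue_on S) F \<longleftrightarrow> set_integrable lborel S F"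
proof -
  have S': "S \<inter> space lebesgue \<in> sets lebesgue" using S by (simp add: sets_completionI_sets)
  have m: "(\<lambda>u. indicator S u *\<^sub>R F u) \<in> borel_measurable lborel" using S F by simp
  show "integral\<^sup>L (lebesgue_on S) F = (LINT u:S|lborel. F u)"
    unfolding set_lebesgue_integral_def
    by (subst integral_restrict_space[OF S']) (rule integral_completion[OF m])
  show "integrable (lebesgue_on S) F \<longleftrightarrow> set_integrable lborel S F"
    unfolding set_integrable_def
    by (subst integrable_restrict_space[OF S']) (rule integrable_completion[OF m])
qed

section \<open>Square-integrable functions on the half-line\<close>

abbreviation L2h :: "(real \<Rightarrow> complex) set" where "L2h \<equiv> L2 (lebesgue_on {0<..})"

lemma borel_L2h_iff:
  assumes "f \<in> borel_measurable borel"
  shows "f \<in> L2h \<longleftrightarrow> set_integrable lborel {0<..} (\<lambda>u. (norm (f u))\<^sup>2)"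
proof -
  have "f \<in> borel_measurable (lebesgue_on {0<..})"
    using assms by (intro measurable_restrict_space1) (simp add: measurable_completion)
  moreover have "(\<lambda>u. (norm (f u))\<^sup>2) \<in> borel_measurable borel" using assms by measurable
  ultimately show ?thesis unfolding L2_def using lebesgue_on_borel(2)[of "{0<..}" "\<lambda>u. (norm (f u))\<^sup>2"] by simp
qed

lemma L2_inner_borel:
  fixes f g :: "real \<Rightarrow> complex"
  assumes "f \<in> borel_measurable borel" "g \<in> borel_measurable borel"
  shows "L2_inner (lebesgue_on {0<..}) f g = (LINT u:{0<..}|lborel. f u * cnj (g u))"
  unfolding L2_inner_def by (rule lebesgue_on_borel(1)) (use assms in measurable)

lemma L2_norm_borel:
  fixes f :: "real \<Rightarrow> complex"
  assumes "f \<in> borel_measurable borel"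
  shows "L2_norm (lebesgue_on {0<..}) f = sqrt (LINT u:{0<..}|lborel. (norm (f u))\<^sup>2)"
  unfolding L2_norm_def by (subst lebesgue_on_borel(1)) (use assms in measurable)

lemma set_integrable_half_line:
  fixes f :: "real \<Rightarrow> 'a::{banach, second_countable_topology}"
  assumes m: "f \<in> borel_measurable borel"
    and 1: "\<And>u. 0 < u \<Longrightarrow> u < 1 \<Longrightarrow> norm (f u) \<le> C * u powr a" "a > -1"
    and 2: "\<And>u. 1 \<le> u \<Longrightarrow> norm (f u) \<le> C * u powr b" "b < -1"
  shows "set_integrable lborel {0<..} f"
proof -
  have A: "set_integrable lborel {0<..<1} f"
  proof (rule set_integrable_bound)
    show "set_integrable lborel {0<..<1} (\<lambda>u. C * u powr a)"
      by (intro set_integrable_mult_right set_integrable_powr_01 1)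
    show "AE u in lborel. u \<in> {0<..<1} \<longrightarrow> norm (f u) \<le> norm (C * u powr a)"
      using 1(1) by (auto intro!: AE_I2 order_trans[OF 1(1)])
  qed (use m in \<open>simp add: set_borel_measurable_def\<close>)
  have B: "set_integrable lborel {1<..} f"
  proof (rule set_integrable_bound)
    show "set_integrable lborel {1<..} (\<lambda>u. C * u powr b)"
      by (intro set_integrable_mult_right set_integrable_powr_1_inf 2)
    show "AE u in lborel. u \<in> {1<..} \<longrightarrow> norm (f u) \<le> norm (C * u powr b)"
      using 2(1) by (auto intro!: AE_I2 order_trans[OF 2(1)])
  qed (use m in \<open>simp add: set_borel_measurable_def\<close>)
  have C: "set_integrable lborel {1..1} f"
    unfolding set_integrable_def
  proof (rule integrable_cong_AE_imp[of lborel "\<lambda>_. 0"])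
    have "AE x in lborel. x \<noteq> (1::real)" by (rule AE_lborel_singleton)
    then show "AE x in lborel. 0 = indicator {1..1} x *\<^sub>R f x" by eventually_elim (auto simp: indicator_def)
  qed (use m in simp_all)
  have "set_integrable lborel ({0<..<1} \<union> ({1..1} \<union> {1<..})) f"
    by (intro set_integrable_Un A B C) auto
  moreover have "{0<..<1} \<union> ({1..1} \<union> {1<..}) = {0::real<..}" by auto
  ultimately show ?thesis by simp
qed

lemma set_integral_half_line:
  fixes f :: "real \<Rightarrow> complex"
  assumes "set_integrable lborel {0<..} f"
  shows "(LINT u:{0<..}|lborel. f u) = (LINT u:{0<..<1}|lborel. f u) + (LINT u:{1<..}|lborel. f u)"
proof -
  have 1: "set_integrable lborel {0<..<1} f" and 2: "set_integrable lborel {1<..} f"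
    by (rule set_integrable_subset[OF assms]; auto)+
  have "(LINT u:{0<..<1}|lborel. f u) + (LINT u:{1<..}|lborel. f u) = (LINT u|lborel. indicator {0<..<1} u *\<^sub>R f u + indicator {1<..} u *\<^sub>R f u)"
    unfolding set_lebesgue_integral_def
    by (rule Bochner_Integration.integral_add[symmetric]) (use 1 2 in \<open>simp_all add: set_integrable_def\<close>)
  also have "\<dots> = (LINT u:{0<..}|lborel. f u)"
    unfolding set_lebesgue_integral_def
  proof (rule integral_cong_AE)
    show "(\<lambda>u. indicator {0<..<1} u *\<^sub>R f u + indicator {1<..} u *\<^sub>R f u) \<in> borel_measurable lborel"
      "(\<lambda>u. indicator {0<..} u *\<^sub>R f u) \<in> borel_measurable lborel"
      using 1 2 assms by (auto simp: set_integrable_def)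
    have "AE x in lborel. x \<noteq> (1::real)" by (rule AE_lborel_singleton)
    then show "AE u in lborel. indicator {0<..<1} u *\<^sub>R f u + indicator {1<..} u *\<^sub>R f u = indicator {0<..} u *\<^sub>R f u"
      by eventually_elim (auto simp: indicator_def)
  qed
  finally show ?thesis ..
qed

lemma E_map_decay:
  assumes S: "\<phi> \<in> S_le1"
  obtains C where "C \<ge> 0" "\<And>u. u > 0 \<Longrightarrow> norm (E_map \<phi> u) \<le> C" "\<And>u. u \<ge> 1 \<Longrightarrow> norm (E_map \<phi> u) \<le> C / u"
proof -
  obtain C where C: "C \<ge> 0" "\<And>u. u > 0 \<Longrightarrow> norm (E_map \<phi> u) \<le> C" using E_map_bounded[OF S] by blast
  have "norm (E_map \<phi> u) \<le> (C + norm (half_integral \<phi>)) / u" if "u \<ge> 1" for u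
    using E_map_ge_1[OF S that] that C(1) by (simp add: norm_divide half_integral_def divide_right_mono)
  then show ?thesis using that[of "C + norm (half_integral \<phi>)"] C by (force intro: order_trans)
qed

lemma E_map_L2h:
  assumes S: "\<phi> \<in> S_le1"
  shows "E_map \<phi> \<in> L2h"
proof -
  have m [measurable]: "E_map \<phi> \<in> borel_measurable borel" by (rule E_map_measurable[OF S_le1_measurable[OF S]])
  obtain C where C: "C \<ge> 0" "\<And>u. u > 0 \<Longrightarrow> norm (E_map \<phi> u) \<le> C" "\<And>u. u \<ge> 1 \<Longrightarrow> norm (E_map \<phi> u) \<le> C / u"
    using E_map_decay[OF S] by blast
  have "set_integrable lborel {0<..} (\<lambda>u. (norm (E_map \<phi> u))\<^sup>2)"
  proof (rule set_integrable_half_line[where C = "C\<^sup>2" and a = 0 and b = "-2"])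
    show "norm ((norm (E_map \<phi> u))\<^sup>2) \<le> C\<^sup>2 * u powr 0" if "0 < u" for u
      using power_mono[OF C(2)[OF that], of 2] that by simp
    show "norm ((norm (E_map \<phi> u))\<^sup>2) \<le> C\<^sup>2 * u powr -2" if "1 \<le> u" for u
    proof -
      have "(norm (E_map \<phi> u))\<^sup>2 \<le> (C / u)\<^sup>2" using C(3)[OF that] by (intro power_mono) auto
      then show ?thesis using that by (simp add: powr_minus power_divide power_mult_distrib power_inverse divide_inverse)
    qed
  qed auto
  then show ?thesis using borel_L2h_iff[OF m] by simp
qed

lemma E_map_fourier_small:
  assumes S: "\<phi> \<in> S_le1" and u: "0 < u" "u \<le> 1"
  shows "E_map (fourier \<phi>) u = - half_integral \<phi>"
  using E_map_fourier[OF S u(1)] E_map_ge_1[OF S, of "1 / u"] u by (simp add: half_integral_def)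

lemma fourier_measurable:
  assumes S: "\<phi> \<in> S_le1" shows "fourier \<phi> \<in> borel_measurable borel"
proof -
  have "(fourier \<phi> has_vector_derivative fourier (\<lambda>x. 2 * of_real pi * \<i> * of_real x * \<phi> x) y) (at y)" for y
    by (rule fourier_derivative[OF S_le1_continuous[OF S] S_le1_zero'[OF S]])
  then have "continuous_on UNIV (fourier \<phi>)"
    using has_vector_derivative_continuous continuous_at_imp_continuous_on by blast
  then show ?thesis by (rule borel_measurable_continuous_onI)
qed

lemma E_map_fourier_L2h:
  assumes S: "\<phi> \<in> S_le1" shows "E_map (fourier \<phi>) \<in> L2h"
proof -
  have m [measurable]: "E_map (fourier \<phi>) \<in> borel_measurable borel" by (rule E_map_measurable[OF fourier_measurable[OF S]])
  obtain C where C: "C \<ge> 0" "\<And>u. u > 0 \<Longrightarrow> norm (E_map \<phi> u) \<le> C" "\<And>u. u \<ge> 1 \<Longrightarrow> norm (E_map \<phi> u) \<le> C / u"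
    using E_map_decay[OF S] by blast
  show ?thesis
    unfolding borel_L2h_iff[OF m]
  proof (rule set_integrable_half_line[where C = "(norm (half_integral \<phi>))\<^sup>2 + C\<^sup>2" and a = 0 and b = "-2"])
    show "norm ((norm (E_map (fourier \<phi>) u))\<^sup>2) \<le> ((norm (half_integral \<phi>))\<^sup>2 + C\<^sup>2) * u powr 0" if "0 < u" "u < 1" for u
      using E_map_fourier_small[OF S, of u] that by simp
    show "norm ((norm (E_map (fourier \<phi>) u))\<^sup>2) \<le> ((norm (half_integral \<phi>))\<^sup>2 + C\<^sup>2) * u powr -2" if u: "1 \<le> u" for u
    proof -
      have "norm (E_map (fourier \<phi>) u) \<le> C / u"
        using C(2)[of "1 / u"] u E_map_fourier[OF S, of u] by (simp add: norm_divide divide_right_mono)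
      then have "(norm (E_map (fourier \<phi>) u))\<^sup>2 \<le> (C / u)\<^sup>2" by (intro power_mono) auto
      also have "\<dots> = C\<^sup>2 * u powr -2" using u by (simp add: power_divide power_mult_distrib power_inverse powr_minus divide_inverse)
      also have "\<dots> \<le> ((norm (half_integral \<phi>))\<^sup>2 + C\<^sup>2) * u powr -2" by (intro mult_right_mono) auto
      finally show ?thesis by simp
    qed
  qed auto
qed

text \<open>The contradiction is quantitative: on the unit interval the orthogonal function built
  from the zero has a positive distance from the constants, which can be computed exactly, while the
  functions in the closure come arbitrarily near to constants there.\<close>

lemma inclusion_imp_no_zero:
  assumes inc: "L2_orth (lebesgue_on {0<..}) (E_map ` S_le1) \<subseteq> L2_closure (lebesgue_on {0<..}) (E_map ` fourier ` S_le1)"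
    and \<rho>: "Re \<rho> > 1/2" "\<rho> \<noteq> 1"
  shows "riemann_zeta \<rho> \<noteq> 0"
proof
  assume zero: "riemann_zeta \<rho> = 0"
  obtain Z where Z: "\<And>s. s \<noteq> 1 \<Longrightarrow> riemann_zeta s = Z s / (s - 1)"
    "\<And>\<phi> s. \<phi> \<in> S_le1 \<Longrightarrow> Re s > 0 \<Longrightarrow> (s - 1) * mellin01 (E_map \<phi>) s + half_integral \<phi> = Z s * mellin01 \<phi> s"
    using zeta_continuation by metis
  have Z0: "Z \<rho> = 0" using zero Z(1)[OF \<rho>(2)] \<rho>(2) by simp
  define \<sigma> where "\<sigma> = Re \<rho>"
  have \<sigma>: "\<sigma> > 1/2" using \<rho> by (simp add: \<sigma>_def)
  \<comment> \<open>Beyond 1, \<open>E_map \<phi>\<close> is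
    \<open>- half_integral \<phi> / u\<close>, and pairing it with \<open>cnj c / u\<close> gives
    \<open>- half_integral \<phi> * c\<close>. This \<open>c\<close> makes the total equal to the
    left-hand side of the Mellin identity at \<open>\<rho>\<close> divided by
    \<open>\<rho> - 1\<close>, which is 0 as \<open>Z \<rho> = 0\<close>.\<close>
  define c where "c = 1 / (1 - \<rho>)"
  define g where "g u = (if u < 1 then cnj (of_real u powr (\<rho> - 1)) else cnj c / of_real u)" for u :: real
  have gm [measurable]: "g \<in> borel_measurable borel" unfolding g_def by measurable
  have g1: "norm (g u) = u powr (\<sigma> - 1)" if "0 < u" "u < 1" for u
    using that norm_powr_of_real[of u "\<rho> - 1"] by (simp add: g_def \<sigma>_def)
  have g2: "norm (g u) = norm c / u" if "1 \<le> u" for u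
    using that by (simp add: g_def norm_divide)
  have sq1: "(norm (g u))\<^sup>2 = u powr (2 * \<sigma> - 2)" if "0 < u" "u < 1" for u
    using g1[OF that] that by (simp add: power2_eq_square powr_add[symmetric] algebra_simps)
  \<comment> \<open>Square integrability at 0 amounts to \<open>2 * \<sigma> - 2 > -1\<close>; this
    is where the zero has to lie to the right of the critical line.\<close>
  have gL: "g \<in> L2h"
    unfolding borel_L2h_iff[OF gm]
  proof (rule set_integrable_half_line[where C = "1 + (norm c)\<^sup>2" and a = "2 * \<sigma> - 2" and b = "-2"])
    show "norm ((norm (g u))\<^sup>2) \<le> (1 + (norm c)\<^sup>2) * u powr (2 * \<sigma> - 2)" if "0 < u" "u < 1" for u
      using sq1[OF that] by (simp add: mult_le_cancel_right1)
    show "norm ((norm (g u))\<^sup>2) \<le> (1 + (norm c)\<^sup>2) * u powr -2" if "1 \<le> u" for u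
    proof -
      have "(norm (g u))\<^sup>2 = (norm c)\<^sup>2 * u powr -2" using g2[OF that] that by (simp add: power_divide power_mult_distrib power_inverse powr_minus divide_inverse)
      also have "\<dots> \<le> (1 + (norm c)\<^sup>2) * u powr -2" by (intro mult_right_mono) auto
      finally show ?thesis by simp
    qed
  qed (use \<sigma> in auto)
  have orth: "L2_inner (lebesgue_on {0<..}) (E_map \<phi>) g = 0" if S: "\<phi> \<in> S_le1" for \<phi>
  proof -
    have m [measurable]: "E_map \<phi> \<in> borel_measurable borel" by (rule E_map_measurable[OF S_le1_measurable[OF S]])
    obtain C where C: "C \<ge> 0" "\<And>u. u > 0 \<Longrightarrow> norm (E_map \<phi> u) \<le> C" "\<And>u. u \<ge> 1 \<Longrightarrow> norm (E_map \<phi> u) \<le> C / u"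
      using E_map_decay[OF S] by blast
    have int: "set_integrable lborel {0<..} (\<lambda>u. E_map \<phi> u * cnj (g u))"
    proof (rule set_integrable_half_line[where C = "C * (1 + norm c)" and a = "\<sigma> - 1" and b = "-2"])
      show "norm (E_map \<phi> u * cnj (g u)) \<le> C * (1 + norm c) * u powr (\<sigma> - 1)" if "0 < u" "u < 1" for u
      proof -
        have "norm (E_map \<phi> u * cnj (g u)) \<le> C * u powr (\<sigma> - 1)"
          unfolding norm_mult complex_mod_cnj g1[OF that] using C(2)[OF that(1)] by (intro mult_right_mono) auto
        also have "\<dots> \<le> C * (1 + norm c) * u powr (\<sigma> - 1)" using C(1) by (intro mult_right_mono) (auto simp: mult_le_cancel_left1)
        finally show ?thesis .
      qed
      show "norm (E_map \<phi> u * cnj (g u)) \<le> C * (1 + norm c) * u powr -2" if "1 \<le> u" for u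
      proof -
        have "norm (E_map \<phi> u * cnj (g u)) \<le> (C / u) * (norm c / u)"
          unfolding norm_mult complex_mod_cnj g2[OF that] using C(3)[OF that] that by (intro mult_right_mono) auto
        also have "\<dots> = C * norm c * u powr -2" using that by (simp add: powr_minus divide_inverse power2_eq_square)
        also have "\<dots> \<le> C * (1 + norm c) * u powr -2" using C(1) by (intro mult_right_mono mult_left_mono) auto
        finally show ?thesis .
      qed
    qed (use \<sigma> in auto)
    have 1: "(LINT u:{0<..<1}|lborel. E_map \<phi> u * cnj (g u)) = mellin01 (E_map \<phi>) \<rho>"
      unfolding mellin01_def by (rule set_lebesgue_integral_cong) (auto simp: g_def)
    have "(LINT u:{1<..}|lborel. E_map \<phi> u * cnj (g u)) = (LINT u:{1<..}|lborel. (- half_integral \<phi> * c) * of_real u powr (-2))"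
    proof (rule set_lebesgue_integral_cong)
      show "\<forall>u. u \<in> {1<..} \<longrightarrow> E_map \<phi> u * cnj (g u) = (- half_integral \<phi> * c) * of_real u powr (-2)"
      proof (intro allI impI)
        fix u :: real assume u: "u \<in> {1<..}"
        have "of_real u powr (-2 :: complex) = 1 / (of_real u)\<^sup>2"
          using u by (simp add: powr_minus divide_inverse)
        then show "E_map \<phi> u * cnj (g u) = (- half_integral \<phi> * c) * of_real u powr (-2)"
          using u E_map_ge_1[OF S, of u] by (simp add: g_def half_integral_def power2_eq_square)
      qed
    qed simp
    also have "\<dots> = - half_integral \<phi> * c"
      unfolding set_integral_mult_right using integral_cpowr_1_inf[of "-2"] by simp
    finally have "L2_inner (lebesgue_on {0<..}) (E_map \<phi>) g = mellin01 (E_map \<phi>) \<rho> - half_integral \<phi> * c"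
      using set_integral_half_line[OF int] 1 by (simp add: L2_inner_borel[OF m gm])
    also have "\<dots> = ((\<rho> - 1) * mellin01 (E_map \<phi>) \<rho> + half_integral \<phi>) / (\<rho> - 1)"
      using \<rho>(2) by (simp add: c_def field_simps)
    also have "\<dots> = 0" using Z(2)[OF S, of \<rho>] Z0 \<rho>(1) by simp
    finally show ?thesis .
  qed
  have "g \<in> L2_orth (lebesgue_on {0<..}) (E_map ` S_le1)"
    using gL orth by (auto simp: L2_orth_def)
  then have cl: "g \<in> L2_closure (lebesgue_on {0<..}) (E_map ` fourier ` S_le1)" using inc by blast
  \<comment> \<open>The squared distance from \<open>g\<close> to the constants on the unit
    interval: \<open>g\<close> has squared norm \<open>1 / (2 * \<sigma> - 1)\<close> there, and its
    inner product with 1 is \<open>cnj (1 / \<rho>)\<close>. It is positive because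
    \<open>\<rho>\<close> differs from 1.\<close>
  define V where "V = 1 / (2 * \<sigma> - 1) - 1 / (norm \<rho>)\<^sup>2"
  have "V = (norm (\<rho> - 1))\<^sup>2 / ((2 * \<sigma> - 1) * (norm \<rho>)\<^sup>2)"
  proof -
    have "(norm (\<rho> - 1))\<^sup>2 = (norm \<rho>)\<^sup>2 - (2 * \<sigma> - 1)"
      unfolding cmod_power2 \<sigma>_def by (simp add: power2_eq_square algebra_simps)
    moreover have "(norm \<rho>)\<^sup>2 \<noteq> 0" using \<rho> by auto
    ultimately show ?thesis using \<sigma> by (simp add: V_def field_simps)
  qed
  moreover have "norm \<rho> > 0" using \<rho> by auto
  ultimately have V: "V > 0" using \<rho>(2) \<sigma> by simp
  obtain \<phi> where S: "\<phi> \<in> S_le1" and close: "L2_norm (lebesgue_on {0<..}) (\<lambda>u. g u - E_map (fourier \<phi>) u) < sqrt V"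
  proof -
    have "\<exists>f\<in>E_map ` fourier ` S_le1. L2_norm (lebesgue_on {0<..}) (\<lambda>u. g u - f u) < sqrt V"
      using cl V by (simp add: L2_closure_def)
    then show ?thesis using that by blast
  qed
  define k where "k = - half_integral \<phi>"
  let ?e = "E_map (fourier \<phi>)"
  have em [measurable]: "?e \<in> borel_measurable borel" by (rule E_map_measurable[OF fourier_measurable[OF S]])
  have "sqrt (LINT u:{0<..}|lborel. (norm (g u - ?e u))\<^sup>2) < sqrt V"
    using close by (simp add: L2_norm_borel)
  then have less: "(LINT u:{0<..}|lborel. (norm (g u - ?e u))\<^sup>2) < V" by simp
  have ek: "?e u = k" if "0 < u" "u < 1" for u using E_map_fourier_small[OF S, of u] that by (simp add: k_def)
  have "(\<lambda>u. g u - ?e u) \<in> L2h" by (rule L2_diff[OF gL E_map_fourier_L2h[OF S]])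
  then have si: "set_integrable lborel {0<..} (\<lambda>u. (norm (g u - ?e u))\<^sup>2)"
    by (subst (asm) borel_L2h_iff) auto
  let ?M = "lebesgue_on {0<..<1::real}"
  have "L2_sq ?M (\<lambda>u. g u - k * 1) = (LINT u:{0<..<1}|lborel. (norm (g u - k * 1))\<^sup>2)"
    unfolding L2_sq_def by (rule lebesgue_on_borel(1)) (simp, measurable)
  also have "\<dots> = (LINT u:{0<..<1}|lborel. (norm (g u - ?e u))\<^sup>2)"
    by (rule set_lebesgue_integral_cong) (auto simp: ek)
  also have "\<dots> \<le> (LINT u:{0<..}|lborel. (norm (g u - ?e u))\<^sup>2)"
    unfolding set_lebesgue_integral_def
  proof (rule integral_mono)
    show "integrable lborel (\<lambda>u. indicator {0<..} u *\<^sub>R (norm (g u - ?e u))\<^sup>2)" using si by (simp add: set_integrable_def)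
    have "set_integrable lborel {0<..<1} (\<lambda>u. (norm (g u - ?e u))\<^sup>2)" by (rule set_integrable_subset[OF si]) auto
    then show "integrable lborel (\<lambda>u. indicator {0<..<1} u *\<^sub>R (norm (g u - ?e u))\<^sup>2)" by (simp add: set_integrable_def)
  qed (auto simp: indicator_def)
  finally have up: "L2_sq ?M (\<lambda>u. g u - k * 1) < V" using less by simp
  have sg: "set_integrable lborel {0<..<1} (\<lambda>u. (norm (g u))\<^sup>2)"
    by (rule set_integrable_subset[of _ "{0<..}"]) (use gL borel_L2h_iff[OF gm] in auto)
  have gM: "g \<in> L2 ?M"
  proof -
    have "g \<in> borel_measurable ?M" by (intro measurable_restrict_space1) (simp add: measurable_completion)
    then show ?thesis using lebesgue_on_borel(2)[of "{0<..<1}" "\<lambda>u. (norm (g u))\<^sup>2"] sg by (simp add: L2_def)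
  qed
  have s1: "set_integrable lborel {0<..<1::real} (\<lambda>_. 1 :: real)"
    by (rule set_integrable_subset[OF borel_integrable_atLeastAtMost'[of 0 1, OF continuous_on_const]]) auto
  have oM: "(\<lambda>_. 1) \<in> L2 ?M"
    using lebesgue_on_borel(2)[of "{0<..<1::real}" "\<lambda>_. 1 :: real"] s1 by (simp add: L2_def)
  have c1: "L2_sq ?M (\<lambda>_. 1) = 1"
    unfolding L2_sq_def by (subst lebesgue_on_borel(1)) (auto simp: set_lebesgue_integral_def)
  have c2: "L2_sq ?M g = 1 / (2 * \<sigma> - 1)"
  proof -
    have "L2_sq ?M g = (LINT u:{0<..<1}|lborel. (norm (g u))\<^sup>2)"
      unfolding L2_sq_def by (rule lebesgue_on_borel(1)) (simp, measurable)
    also have "\<dots> = (LINT u:{0<..<1}|lborel. u powr (2 * \<sigma> - 2))"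
      by (rule set_lebesgue_integral_cong) (auto simp: sq1)
    finally have "complex_of_real (L2_sq ?M g) = (LINT u:{0<..<1}|lborel. of_real (u powr (2 * \<sigma> - 2)))"
      by (simp add: set_integral_complex_of_real)
    also have "\<dots> = (LINT u:{0<..<1}|lborel. of_real u powr (of_real (2 * \<sigma> - 2)))"
      by (rule set_lebesgue_integral_cong) (auto simp: powr_of_real simp del: of_real_diff of_real_mult)
    also have "\<dots> = of_real (1 / (2 * \<sigma> - 1))" using \<sigma> by (subst integral_cpowr_01) (auto simp: algebra_simps)
    finally show ?thesis by (simp only: of_real_eq_iff)
  qed
  have c3: "L2_inner ?M g (\<lambda>_. 1) = cnj (1 / \<rho>)"
  proof -
    have "L2_inner ?M g (\<lambda>_. 1) = (LINT u:{0<..<1}|lborel. g u)"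
      unfolding L2_inner_def by (subst lebesgue_on_borel(1)) auto
    also have "\<dots> = (LINT u:{0<..<1}|lborel. cnj (of_real u powr (\<rho> - 1)))"
      by (rule set_lebesgue_integral_cong) (auto simp: g_def)
    also have "\<dots> = (LINT u|lborel. cnj (indicator {0<..<1} u *\<^sub>R of_real u powr (\<rho> - 1)))"
      unfolding set_lebesgue_integral_def by (rule Bochner_Integration.integral_cong) (auto simp: indicator_def)
    also have "\<dots> = cnj (LINT u:{0<..<1}|lborel. of_real u powr (\<rho> - 1))"
      unfolding set_lebesgue_integral_def by (rule Bochner_Integration.integral_cnj)
    also have "\<dots> = cnj (1 / \<rho>)" using \<rho>(1) by (subst integral_cpowr_01) auto
    finally show ?thesis .
  qed
  \<comment> \<open>Completing the square in \<open>k\<close>: the nearest constant is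
    \<open>cnj (1 / \<rho>)\<close>.\<close>
  have "0 \<le> (norm (k - cnj (1 / \<rho>)))\<^sup>2" by simp
  also have "(norm (k - m))\<^sup>2 = (norm k)\<^sup>2 - 2 * Re (cnj k * m) + (norm m)\<^sup>2" for m
    unfolding cmod_power2 by (simp add: power2_eq_square algebra_simps)
  also have "norm (cnj (1 / \<rho>)) = norm (1 / \<rho>)" by (rule complex_mod_cnj)
  finally have "- 2 * Re (cnj k * cnj (1 / \<rho>)) + (norm k)\<^sup>2 \<ge> - (1 / (norm \<rho>)\<^sup>2)"
    by (simp add: norm_divide power_divide)
  moreover have "L2_sq ?M (\<lambda>u. g u - k * 1) = 1 / (2 * \<sigma> - 1) - 2 * Re (cnj k * cnj (1 / \<rho>)) + (norm k)\<^sup>2"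
    using L2_sq_expand[OF gM oM, of k] unfolding c1 c2 c3 by simp
  ultimately show False using up unfolding V_def by linarith
qed

section \<open>The Riemann Hypothesis implies the inclusion\<close>

text \<open>Vanishing moments give vanishing integrals against the Bernstein basis, by induction on
  the power of \<open>1 - u\<close>, hence against continuous functions, by Weierstrass
  approximation. Ramps pass to the half-lines \<open>{..a}\<close>, and these form an
  intersection-stable generator of the Borel sets.\<close>

lemma moments_zero:
  fixes G :: "real \<Rightarrow> complex"
  assumes i: "set_integrable lborel {0<..<1} G"
    and mom: "\<And>n::nat. (LINT u:{0<..<1}|lborel. G u * of_real (u ^ n)) = 0"
  shows "AE u in lborel. 0 < u \<longrightarrow> u < 1 \<longrightarrow> G u = 0"
proof -
  define H where "H u = indicator {0<..<1} u *\<^sub>R G u" for u :: real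
  have Hi: "integrable lborel H" using i by (simp add: H_def[abs_def] set_integrable_def)
  have Hm [measurable]: "H \<in> borel_measurable borel" using Hi by auto
  have bi: "integrable lborel (\<lambda>u. H u * of_real (f u))" if [measurable]: "f \<in> borel_measurable borel"
    and b: "\<And>u. u \<in> {0..1} \<Longrightarrow> \<bar>f u\<bar> \<le> B" for f :: "real \<Rightarrow> real" and B
  proof (rule Bochner_Integration.integrable_bound[OF integrable_mult_left[OF integrable_norm[OF Hi], of B]])
    have "norm (H u * of_real (f u)) \<le> norm (norm (H u) * B)" for u
    proof (cases "u \<in> {0<..<1}")
      case True
      then have "\<bar>f u\<bar> \<le> \<bar>B\<bar>" using b[of u] by auto
      then show ?thesis by (simp add: norm_mult abs_mult mult_left_mono)
    qed (simp add: H_def)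
    then show "AE u in lborel. norm (H u * of_real (f u)) \<le> norm (norm (H u) * B)" by simp
  qed measurable
  have cb: "\<exists>B. \<forall>u\<in>{0..1}. \<bar>f u\<bar> \<le> B" if "continuous_on {0..1} f" for f :: "real \<Rightarrow> real"
  proof -
    have "bounded (f ` {0..1})" by (intro compact_imp_bounded compact_continuous_image that) auto
    then show ?thesis unfolding bounded_iff by auto
  qed
  have ci: "integrable lborel (\<lambda>u. H u * of_real (f u))" if "continuous_on UNIV f" for f :: "real \<Rightarrow> real"
    using cb[OF continuous_on_subset[OF that subset_UNIV]] bi[OF borel_measurable_continuous_onI[OF that]] by blast
  have bern: "(LINT u|lborel. H u * of_real (u ^ k * (1 - u) ^ m)) = 0" for k m
  proof (induction m arbitrary: k)
    case 0
    have "(LINT u|lborel. H u * of_real (u ^ k)) = (LINT u:{0<..<1}|lborel. G u * of_real (u ^ k))"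
      unfolding set_lebesgue_integral_def by (rule Bochner_Integration.integral_cong) (auto simp: H_def)
    then show ?case using mom by simp
  next
    case (Suc m)
    have "H u * of_real (u ^ k * (1 - u) ^ Suc m) = H u * of_real (u ^ k * (1 - u) ^ m) - H u * of_real (u ^ Suc k * (1 - u) ^ m)" for u
      by (simp add: algebra_simps)
    then have "(LINT u|lborel. H u * of_real (u ^ k * (1 - u) ^ Suc m)) =
       (LINT u|lborel. H u * of_real (u ^ k * (1 - u) ^ m)) - (LINT u|lborel. H u * of_real (u ^ Suc k * (1 - u) ^ m))"
      by (simp only:) (intro Bochner_Integration.integral_diff ci continuous_intros)
    then show ?case unfolding Suc.IH by simp
  qed
  have cont0: "(LINT u|lborel. H u * of_real (f u)) = 0" if f: "continuous_on UNIV f" for f :: "real \<Rightarrow> real"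
  proof -
    define K where "K = (LINT u|lborel. norm (H u))"
    have K: "K \<ge> 0" by (simp add: K_def)
    have le: "norm (LINT u|lborel. H u * of_real (f u)) \<le> e * K" if e: "e > 0" for e
    proof -
      obtain N where N: "\<And>x. x \<in> {0..1} \<Longrightarrow> \<bar>f x - (\<Sum>k\<le>N. f (k/N) * Bernstein N k x)\<bar> < e"
        using Bernstein_Weierstrass[OF continuous_on_subset[OF f subset_UNIV] e] by blast
      define p where "p x = (\<Sum>k\<le>N. f (k/N) * Bernstein N k x)" for x
      have pc: "continuous_on UNIV p" unfolding p_def Bernstein_def by (intro continuous_intros)
      have "(LINT u|lborel. H u * of_real (p u)) = (\<Sum>k\<le>N. LINT u|lborel. H u * of_real (f (k/N) * Bernstein N k u))"
        unfolding p_def of_real_sum sum_distrib_left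
        by (rule Bochner_Integration.integral_sum) (intro ci continuous_intros, simp add: Bernstein_def, intro continuous_intros)
      also have "\<dots> = 0"
      proof (rule sum.neutral, intro ballI)
        fix k
        have "(LINT u|lborel. H u * of_real (f (k/N) * Bernstein N k u)) =
           (LINT u|lborel. of_real (f (k/N) * of_nat (N choose k)) * (H u * of_real (u ^ k * (1 - u) ^ (N - k))))"
          by (simp add: Bernstein_def mult_ac)
        also have "\<dots> = 0" unfolding integral_mult_right_zero bern by simp
        finally show "(LINT u|lborel. H u * of_real (f (k/N) * Bernstein N k u)) = 0" .
      qed
      finally have "(LINT u|lborel. H u * of_real (f u)) = (LINT u|lborel. H u * of_real (f u)) - (LINT u|lborel. H u * of_real (p u))"
        by simp
      also have "\<dots> = (LINT u|lborel. H u * of_real (f u) - H u * of_real (p u))"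
        by (intro Bochner_Integration.integral_diff[symmetric] ci f pc)
      also have "norm \<dots> \<le> (LINT u|lborel. e * norm (H u))"
      proof (rule Bochner_Integration.integral_norm_bound_integral)
        show "integrable lborel (\<lambda>u. H u * of_real (f u) - H u * of_real (p u))"
          by (intro Bochner_Integration.integrable_diff ci f pc)
        show "norm (H u * of_real (f u) - H u * of_real (p u)) \<le> e * norm (H u)" for u
        proof (cases "u \<in> {0<..<1}")
          case True
          have "H u * of_real (f u) - H u * of_real (p u) = H u * of_real (f u - p u)" by (simp add: algebra_simps)
          moreover have "\<bar>f u - p u\<bar> \<le> e" using N[of u] True by (simp add: p_def)
          moreover from this have "norm (H u) * \<bar>f u - p u\<bar> \<le> norm (H u) * e" by (intro mult_left_mono) auto
          ultimately show ?thesis by (simp add: norm_mult mult.commute[of e] del: of_real_diff)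
        qed (simp add: H_def)
      qed (use Hi in auto)
      finally show ?thesis by (simp add: K_def)
    qed
    have "norm (LINT u|lborel. H u * of_real (f u)) \<le> 0"
    proof (rule field_le_epsilon)
      fix e :: real assume "e > 0"
      then have "norm (LINT u|lborel. H u * of_real (f u)) \<le> (e / (K + 1)) * K" using K by (intro le) auto
      also have "\<dots> \<le> e" using K \<open>e > 0\<close> by (simp add: field_simps)
      finally show "norm (LINT u|lborel. H u * of_real (f u)) \<le> 0 + e" by simp
    qed
    then show ?thesis by simp
  qed
  have at: "(LINT u:{..a}|lborel. H u) = 0" for a
  proof -
    \<comment> \<open>A continuous ramp that is 1 up to \<open>a\<close> and falls to 0 on an
      interval of length \<open>1 / j\<close>; as \<open>j\<close> grows it tends to the indicator
      of \<open>{..a}\<close>.\<close>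
    define f where "f j x = max 0 (min 1 (1 - real j * (x - a)))" for j x
    have "(\<lambda>j. LINT u|lborel. H u * of_real (f j u)) \<longlonglongrightarrow> (LINT u|lborel. indicator {..a} u *\<^sub>R H u)"
    proof (rule integral_dominated_convergence[where w = "\<lambda>u. norm (H u)"])
      show "(\<lambda>u. H u * of_real (f j u)) \<in> borel_measurable lborel" for j unfolding f_def by measurable
      show "AE u in lborel. norm (H u * of_real (f j u)) \<le> norm (H u)" for j
        by (auto simp: f_def norm_mult mult_left_le intro!: AE_I2)
      show "AE u in lborel. (\<lambda>j. H u * of_real (f j u)) \<longlonglongrightarrow> indicator {..a} u *\<^sub>R H u"
      proof (rule AE_I2)
        fix u
        show "(\<lambda>j. H u * of_real (f j u)) \<longlonglongrightarrow> indicator {..a} u *\<^sub>R H u"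
        proof (cases "u \<le> a")
          case True
          then have "f j u = 1" for j
            using mult_nonneg_nonpos[of "real j" "u - a"] by (simp add: f_def)
          then show ?thesis using True by simp
        next
          case False
          have "eventually (\<lambda>j. real j \<ge> 1 / (u - a)) sequentially"
            using filterlim_real_sequentially by (simp add: filterlim_at_top)
          then have "eventually (\<lambda>j. H u * of_real (f j u) = 0) sequentially"
            by eventually_elim (use False in \<open>simp add: f_def field_simps\<close>)
          then show ?thesis using False by (simp add: tendsto_eventually)
        qed
      qed
    qed (use Hi in auto)
    moreover have "(LINT u|lborel. H u * of_real (f j u)) = 0" for j
      unfolding f_def by (intro cont0 continuous_intros)
    ultimately show ?thesis by (simp add: set_lebesgue_integral_def LIMSEQ_const_iff)
  qed
  have Hset: "set_integrable lborel A H" if "A \<in> sets borel" for A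
    unfolding set_integrable_def using that by (intro integrable_mult_indicator Hi) auto
  have all: "(LINT u:A|lborel. H u) = 0" if "A \<in> sets borel" for A
  proof -
    have sg: "sigma_sets UNIV (range (\<lambda>a::real. {..a})) = sets borel"
      unfolding borel_eq_atMost by (subst sets_measure_of) auto
    have "Int_stable (range (\<lambda>a::real. {..a}))"
    proof (rule Int_stableI_image)
      show "\<exists>k\<in>UNIV. {..i} \<inter> {..j} = {..k}" for i j :: real by (rule bexI[of _ "min i j"]) auto
    qed
    moreover have "range (\<lambda>a::real. {..a}) \<subseteq> Pow UNIV" by auto
    moreover have "A \<in> sigma_sets UNIV (range (\<lambda>a::real. {..a}))" using that sg by simp
    ultimately show ?thesis
    proof (induction rule: sigma_sets_induct_disjoint)
      case (basic A) then show ?case using at by auto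
    next
      case empty show ?case by (simp add: set_lebesgue_integral_def)
    next
      case (compl A)
      then have A: "A \<in> sets borel" using sg by simp
      have "(LINT u|lborel. indicator (UNIV - A) u *\<^sub>R H u) = (LINT u|lborel. H u - indicator A u *\<^sub>R H u)"
        by (rule Bochner_Integration.integral_cong) (auto simp: indicator_def)
      also have "\<dots> = (LINT u|lborel. H u) - (LINT u|lborel. indicator A u *\<^sub>R H u)"
        by (rule Bochner_Integration.integral_diff) (use Hi Hset[OF A] in \<open>auto simp: set_integrable_def\<close>)
      also have "(LINT u|lborel. H u) = 0" using bern[of 0 0] by simp
      finally show ?case using compl by (simp add: set_lebesgue_integral_def)
    next
      case (union A)
      have "(LINT u:(\<Union>i. A i)|lborel. H u) = (\<Sum>i. (LINT u:(A i)|lborel. H u))"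
        by (rule lebesgue_integral_countable_add) (use union sg in \<open>auto simp: disjoint_family_on_def intro!: Hset\<close>)
      then show ?case using union by simp
    qed
  qed
  have "AE u in lborel. H u = 0"
    by (rule sigma_finite_measure.density_zero[OF sigma_finite_lborel Hi]) (use all in auto)
  then show ?thesis by eventually_elim (auto simp: H_def)
qed

text \<open>Here \<open>g\<close> is the complex conjugate of an element of the orthogonal complement of \<open>E(S)\<close>.\<close>

locale orth_fun =
  fixes g :: "real \<Rightarrow> complex"
  assumes gm [measurable]: "g \<in> borel_measurable borel"
    and gL: "set_integrable lborel {0<..} (\<lambda>u. (norm (g u))\<^sup>2)"
    and orth: "\<And>\<phi>. \<phi> \<in> S_le1 \<Longrightarrow> (LINT u:{0<..}|lborel. E_map \<phi> u * g u) = 0"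
begin

definition "c = (LINT u:{1<..}|lborel. g u / of_real u)"
definition "G2 = (LINT u:{0<..<1}|lborel. (norm (g u))\<^sup>2)"
definition "G1 = (LINT u:{0<..<1}|lborel. norm (g u))"
text \<open>This is the part over the unit interval of the pairing of \<open>g\<close> with
  \<open>E_map\<close> of the dilate of \<open>\<phi>\<close> by \<open>w\<close>. For
  \<open>w \<ge> 1\<close> the dilate stays in \<open>S_le1\<close>, so orthogonality makes
  \<open>T \<phi> w\<close> an explicit multiple of \<open>1 / w\<close>. For smaller
  \<open>w\<close> only boundedness is known, and this suffices for a Mellin transform over the unit
  interval that is holomorphic on \<open>Re s > 0\<close>.\<close>

definition "T \<phi> w = (LINT u:{0<..<1}|lborel. E_map \<phi> (u * w) * g u)"
definition "k s = mellin01 g (1 - s)"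

lemma g_sq: "set_integrable lborel {0<..<1} (\<lambda>u. (norm (g u))\<^sup>2)"
  by (rule set_integrable_subset[OF gL]) auto

lemma G2_nonneg: "G2 \<ge> 0" by (simp add: G2_def set_lebesgue_integral_def)
lemma G1_nonneg: "G1 \<ge> 0" by (simp add: G1_def set_lebesgue_integral_def)

lemma g_mellin01_integrable:
  assumes "\<sigma> > 1/2" shows "set_integrable lborel {0<..<1} (\<lambda>u. norm (g u) * u powr (\<sigma> - 1))"
proof (rule set_integrable_bound)
  show "set_integrable lborel {0<..<1} (\<lambda>u. (norm (g u))\<^sup>2 + u powr (2 * \<sigma> - 2))"
    using assms by (intro set_integral_add g_sq set_integrable_powr_01) auto
  have "norm (norm (g u) * u powr (\<sigma> - 1)) \<le> norm ((norm (g u))\<^sup>2 + u powr (2 * \<sigma> - 2))" if "0 < u" for u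
  proof -
    have e: "u powr (2 * \<sigma> - 2) = (u powr (\<sigma> - 1))\<^sup>2" using that by (simp add: power2_eq_square powr_add[symmetric])
    have "0 \<le> norm (g u) * u powr (\<sigma> - 1)" by simp
    moreover have "2 * (norm (g u) * u powr (\<sigma> - 1)) \<le> (norm (g u))\<^sup>2 + (u powr (\<sigma> - 1))\<^sup>2"
      using sum_squares_bound[of "norm (g u)" "u powr (\<sigma> - 1)"] by (simp only: mult.assoc)
    ultimately show ?thesis unfolding e real_norm_def by linarith
  qed
  then show "AE u in lborel. u \<in> {0<..<1} \<longrightarrow> norm (norm (g u) * u powr (\<sigma> - 1)) \<le> norm ((norm (g u))\<^sup>2 + u powr (2 * \<sigma> - 2))"
    by auto
qed (simp add: set_borel_measurable_def)

lemma g_integrable: "set_integrable lborel {0<..<1} (\<lambda>u. norm (g u))"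
proof -
  have "set_integrable lborel {0<..<1} (\<lambda>u. norm (g u) * u powr (1 - 1))" by (rule g_mellin01_integrable) simp
  then show ?thesis
    by (rule set_integrable_cong[THEN iffD1, rotated -1]) auto
qed

lemma k_holomorphic: "k holomorphic_on {s. Re s < 1/2}"
proof -
  have "mellin01 g holomorphic_on {s. Re s > 1/2}" by (rule mellin01_holomorphic[OF gm g_mellin01_integrable])
  then show ?thesis unfolding k_def[abs_def]
    by (rule holomorphic_on_compose_gen[OF _ , unfolded o_def, of "\<lambda>s. 1 - s", rotated]) (auto intro!: holomorphic_intros)
qed

text \<open>The Cauchy-Schwarz inequality for \<open>g\<close> and the power
  \<open>u powr (- s)\<close>, whose squared norm is \<open>1 / (1 - 2 * Re s)\<close>. The bound
  serves three times: near zeros of \<open>Z\<close>, for polynomial growth on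
  \<open>Re s \<le> 1/4\<close>, and for the limit 0 at negative infinity.\<close>

lemma k_bound:
  assumes "Re s < 1/2" shows "norm (k s) \<le> sqrt (G2 / (1 - 2 * Re s))"
proof -
  let ?M = "lebesgue_on {0<..<1::real}"
  let ?h = "\<lambda>u::real. cnj (of_real u powr (- s))"
  have L: "f \<in> L2 ?M" if m [measurable]: "f \<in> borel_measurable borel" and i: "set_integrable lborel {0<..<1} (\<lambda>u. (norm (f u))\<^sup>2)" for f :: "real \<Rightarrow> complex"
  proof -
    have "f \<in> borel_measurable ?M" by (intro measurable_restrict_space1) (simp add: measurable_completion)
    then show ?thesis using lebesgue_on_borel(2)[of "{0<..<1}" "\<lambda>u. (norm (f u))\<^sup>2"] i by (simp add: L2_def)
  qed
  have sq: "(norm (?h u))\<^sup>2 = u powr (- 2 * Re s)" if "0 < u" for u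
    using that norm_powr_of_real[of u "- s"] by (simp add: power2_eq_square powr_add[symmetric])
  have hL: "?h \<in> L2 ?M"
  proof (rule L)
    have "set_integrable lborel {0<..<1} (\<lambda>u. u powr (- 2 * Re s))" by (rule set_integrable_powr_01) (use assms in simp)
    then show "set_integrable lborel {0<..<1} (\<lambda>u. (norm (?h u))\<^sup>2)"
      by (rule set_integrable_cong[THEN iffD1, rotated -1]) (auto simp: sq simp del: complex_mod_cnj)
  qed measurable
  have gLM: "g \<in> L2 ?M" by (rule L[OF gm g_sq])
  have ki: "L2_inner ?M g ?h = k s"
    unfolding L2_inner_def k_def mellin01_def by (subst lebesgue_on_borel(1)) auto
  have g2: "L2_sq ?M g = G2" unfolding L2_sq_def G2_def by (rule lebesgue_on_borel(1)) auto
  have h2: "L2_sq ?M ?h = 1 / (1 - 2 * Re s)"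
  proof -
    have "L2_sq ?M ?h = (LINT u:{0<..<1}|lborel. (norm (?h u))\<^sup>2)"
      unfolding L2_sq_def by (rule lebesgue_on_borel(1)) (simp, measurable)
    also have "\<dots> = (LINT u:{0<..<1}|lborel. u powr (- 2 * Re s))"
      by (rule set_lebesgue_integral_cong) (auto simp: sq simp del: complex_mod_cnj)
    finally have "complex_of_real (L2_sq ?M ?h) = (LINT u:{0<..<1}|lborel. of_real (u powr (- 2 * Re s)))"
      by (simp only: set_integral_complex_of_real)
    also have "\<dots> = (LINT u:{0<..<1}|lborel. of_real u powr (of_real (- 2 * Re s)))"
      by (rule set_lebesgue_integral_cong) (auto simp: powr_of_real simp del: of_real_minus of_real_mult)
    also have "\<dots> = of_real (1 / (1 - 2 * Re s))" using assms by (subst integral_cpowr_01) auto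
    finally show ?thesis by (simp only: of_real_eq_iff)
  qed
  have "(norm (L2_inner ?M g ?h))\<^sup>2 \<le> (L2_sq ?M g - 0) * L2_sq ?M ?h"
    by (rule L2_Cauchy_Schwarz[OF gLM hL]) (rule L2_sq_nonneg)
  then have "(norm (k s))\<^sup>2 \<le> G2 / (1 - 2 * Re s)" unfolding ki g2 h2 by simp
  then show ?thesis by (rule real_le_rsqrt)
qed

lemma T_tail:
  assumes S: "\<phi> \<in> S_le1" and w: "w \<ge> 1"
  shows "T \<phi> w = half_integral \<phi> * c / of_real w"
proof -
  let ?\<psi> = "\<lambda>x. \<phi> (w * x)"
  have S': "?\<psi> \<in> S_le1" by (rule S_le1_scale[OF S w])
  have tot: "half_integral ?\<psi> = half_integral \<phi> / of_real w"
  proof -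
    have "(LINT x|lborel. indicator {0<..} x *\<^sub>R \<phi> x) = \<bar>w\<bar> *\<^sub>R (LINT x|lborel. indicator {0<..} (0 + w * x) *\<^sub>R \<phi> (0 + w * x))"
      by (rule lborel_integral_real_affine) (use w in simp)
    also have "(\<lambda>x. indicator {0<..} (0 + w * x) *\<^sub>R \<phi> (0 + w * x)) = (\<lambda>x. indicator {0<..} x *\<^sub>R \<phi> (w * x))"
      using w by (auto simp: fun_eq_iff indicator_def zero_less_mult_iff)
    finally show ?thesis using w by (simp add: half_integral_def set_lebesgue_integral_def scaleR_conv_of_real)
  qed
  have E: "E_map ?\<psi> u = E_map \<phi> (u * w)" if "u > 0" for u
    using tot w that by (simp add: E_map_def half_integral_def mult_ac)
  have m [measurable]: "E_map ?\<psi> \<in> borel_measurable borel" by (rule E_map_measurable[OF S_le1_measurable[OF S']])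
  have cg: "(\<lambda>u. cnj (g u)) \<in> L2h"
    by (subst borel_L2h_iff) (use gL in auto)
  have "integrable (lebesgue_on {0<..}) (\<lambda>u. E_map ?\<psi> u * cnj (cnj (g u)))"
    by (rule L2_prod_integrable[OF E_map_L2h[OF S'] cg])
  then have int: "set_integrable lborel {0<..} (\<lambda>u. E_map ?\<psi> u * g u)"
    by (subst (asm) lebesgue_on_borel(2)) auto
  have "0 = (LINT u:{0<..<1}|lborel. E_map ?\<psi> u * g u) + (LINT u:{1<..}|lborel. E_map ?\<psi> u * g u)"
    using orth[OF S'] set_integral_half_line[OF int] by simp
  also have "(LINT u:{0<..<1}|lborel. E_map ?\<psi> u * g u) = T \<phi> w"
    unfolding T_def by (rule set_lebesgue_integral_cong) (auto simp: E)
  also have "(LINT u:{1<..}|lborel. E_map ?\<psi> u * g u) = (LINT u:{1<..}|lborel. (- half_integral ?\<psi>) * (g u / of_real u))"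
    by (rule set_lebesgue_integral_cong) (auto simp: E_map_ge_1[OF S'] half_integral_def)
  also have "\<dots> = - half_integral ?\<psi> * c" unfolding c_def by (rule set_integral_mult_right)
  finally show ?thesis using tot by (simp add: eq_neg_iff_add_eq_0[symmetric] add_eq_0_iff)
qed

lemma E_prod_measurable:
  assumes S: "\<phi> \<in> S_le1"
  shows "(\<lambda>(w, u). indicator {0<..<1} u *\<^sub>R (E_map \<phi> (u * w) * g u)) \<in> borel_measurable (lborel \<Otimes>\<^sub>M lborel)"
proof -
  have m [measurable]: "E_map \<phi> \<in> borel_measurable borel" by (rule E_map_measurable[OF S_le1_measurable[OF S]])
  show ?thesis by measurable
qed

lemma T_measurable: "\<phi> \<in> S_le1 \<Longrightarrow> T \<phi> \<in> borel_measurable borel"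
proof -
  assume S: "\<phi> \<in> S_le1"
  have "(\<lambda>w. LINT u|lborel. indicator {0<..<1} u *\<^sub>R (E_map \<phi> (u * w) * g u)) \<in> borel_measurable lborel"
    by (rule lborel.borel_measurable_lebesgue_integral) (use E_prod_measurable[OF S] in simp)
  then show ?thesis unfolding T_def[abs_def] set_lebesgue_integral_def by simp
qed

lemma T_bound:
  assumes S: "\<phi> \<in> S_le1" and bd: "\<And>u. u > 0 \<Longrightarrow> norm (E_map \<phi> u) \<le> C" and w: "w > 0"
  shows "norm (T \<phi> w) \<le> C * G1"
proof -
  have m [measurable]: "E_map \<phi> \<in> borel_measurable borel" by (rule E_map_measurable[OF S_le1_measurable[OF S]])
  have i2: "set_integrable lborel {0<..<1} (\<lambda>u. C * norm (g u))" by (intro set_integrable_mult_right g_integrable)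
  have le: "norm (E_map \<phi> (u * w) * g u) \<le> C * norm (g u)" if "0 < u" for u
    unfolding norm_mult using bd[of "u * w"] that w by (intro mult_right_mono) auto
  have i1: "set_integrable lborel {0<..<1} (\<lambda>u. E_map \<phi> (u * w) * g u)"
    by (rule set_integrable_bound[OF i2]) (auto simp: set_borel_measurable_def intro!: order_trans[OF le])
  have "norm (T \<phi> w) \<le> (LINT u:{0<..<1}|lborel. C * norm (g u))"
    unfolding T_def set_lebesgue_integral_def
    by (rule Bochner_Integration.integral_norm_bound_integral)
       (use i1 i2 le in \<open>auto simp: set_integrable_def indicator_def\<close>)
  then show ?thesis by (simp add: G1_def)
qed

lemma mellin01_T_holomorphic:
  assumes S: "\<phi> \<in> S_le1" shows "mellin01 (T \<phi>) holomorphic_on {s. Re s > 0}"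
proof -
  obtain C where C: "C \<ge> 0" "\<And>u. u > 0 \<Longrightarrow> norm (E_map \<phi> u) \<le> C" using E_map_bounded[OF S] by blast
  have T: "norm (T \<phi> w) \<le> C * G1 * w powr 0" if "w > 0" for w using T_bound[OF S C(2) that] that by simp
  show ?thesis
    by (rule mellin01_holomorphic[OF T_measurable[OF S] bounded_mellin01_integrable[OF T_measurable[OF S] T]]) auto
qed

text \<open>\<open>T \<phi>\<close> is a multiplicative convolution, so its Mellin transform over
  the whole half-line is \<open>k s\<close> times that of \<open>E_map \<phi>\<close>. The latter
  converges for \<open>0 < Re s < 1\<close>, as \<open>E_map \<phi>\<close> is bounded at 0 and of
  order \<open>1 / u\<close> at infinity, while \<open>k\<close> needs \<open>Re s < 1/2\<close>.
  The parts beyond 1 of both transforms are explicit and become the \<open>half_integral\<close>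
  terms.\<close>

lemma main_identity:
  assumes S: "\<phi> \<in> S_le1" and s: "0 < Re s" "Re s < 1/2"
  shows "(s - 1) * mellin01 (T \<phi>) s - c * half_integral \<phi> = k s * ((s - 1) * mellin01 (E_map \<phi>) s + half_integral \<phi>)"
proof -
  have m [measurable]: "E_map \<phi> \<in> borel_measurable borel" by (rule E_map_measurable[OF S_le1_measurable[OF S]])
  note Tm [measurable] = T_measurable[OF S]
  have s1: "s \<noteq> 1" using s by auto
  obtain C where C: "C \<ge> 0" "\<And>u. u > 0 \<Longrightarrow> norm (E_map \<phi> u) \<le> C" "\<And>u. u \<ge> 1 \<Longrightarrow> norm (E_map \<phi> u) \<le> C / u"
    using E_map_decay[OF S] by blast
  have tail: "(LINT v:{1<..}|lborel. (b / of_real v) * of_real v powr (s - 1)) = - b / (s - 1)" for b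
  proof -
    have "(LINT v:{1<..}|lborel. (b / of_real v) * of_real v powr (s - 1)) = (LINT v:{1<..}|lborel. b * of_real v powr (s - 2))"
    proof (rule set_lebesgue_integral_cong, simp, intro allI impI)
      fix v :: real assume v: "v \<in> {1<..}"
      have "of_real v powr (s - 2) = (of_real v powr ((s - 1) - 1) :: complex)" by (simp add: algebra_simps)
      also have "\<dots> = of_real v powr (s - 1) / of_real v" using v by (subst powr_diff) auto
      finally show "(b / of_real v) * of_real v powr (s - 1) = b * of_real v powr (s - 2)" by simp
    qed
    also have "\<dots> = b * (LINT v:{1<..}|lborel. of_real v powr (s - 2))" by (rule set_integral_mult_right)
    also have "(LINT v:{1<..}|lborel. of_real v powr (s - 2)) = - 1 / (s - 1)"
      using integral_cpowr_1_inf[of "s - 2"] s by simp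
    finally show ?thesis by simp
  qed
  define a where "a v = indicator {0<..} v *\<^sub>R (E_map \<phi> v * of_real v powr (s - 1))" for v
  have am [measurable]: "a \<in> borel_measurable borel" unfolding a_def by measurable
  have aset: "set_integrable lborel {0<..} (\<lambda>v. E_map \<phi> v * of_real v powr (s - 1))"
  proof (rule set_integrable_half_line[where C = C and a = "Re s - 1" and b = "Re s - 2"])
    show "norm (E_map \<phi> u * of_real u powr (s - 1)) \<le> C * u powr (Re s - 1)" if "0 < u" for u
      unfolding norm_mult using norm_powr_of_real[OF that, of "s - 1"] C(2)[OF that] by (simp add: mult_right_mono)
    show "norm (E_map \<phi> u * of_real u powr (s - 1)) \<le> C * u powr (Re s - 2)" if "1 \<le> u" for u
    proof -
      have "norm (E_map \<phi> u * of_real u powr (s - 1)) = norm (E_map \<phi> u) * u powr (Re s - 1)"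
        using norm_powr_of_real[of u "s - 1"] that by (simp add: norm_mult)
      also have "\<dots> \<le> C / u * u powr (Re s - 1)" by (intro mult_right_mono C(3) that) simp
      also have "\<dots> = C * u powr (Re s - 1 - 1)" using that by (subst powr_diff) auto
      also have "Re s - 1 - 1 = Re s - 2" by simp
      finally show ?thesis .
    qed
  qed (use s in auto)
  have ai: "integrable lborel a" using aset by (simp add: a_def[abs_def] set_integrable_def)
  define A where "A = integral\<^sup>L lborel a"
  have A: "A = mellin01 (E_map \<phi>) s + half_integral \<phi> / (s - 1)"
  proof -
    have "A = (LINT v:{0<..}|lborel. E_map \<phi> v * of_real v powr (s - 1))"
      by (simp add: A_def a_def[abs_def] set_lebesgue_integral_def)
    also have "\<dots> = mellin01 (E_map \<phi>) s + (LINT v:{1<..}|lborel. E_map \<phi> v * of_real v powr (s - 1))"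
      unfolding mellin01_def by (rule set_integral_half_line[OF aset])
    also have "(LINT v:{1<..}|lborel. E_map \<phi> v * of_real v powr (s - 1)) = (LINT v:{1<..}|lborel. (- half_integral \<phi> / of_real v) * of_real v powr (s - 1))"
      by (rule set_lebesgue_integral_cong) (auto simp: E_map_ge_1[OF S] half_integral_def)
    also have "\<dots> = half_integral \<phi> / (s - 1)" unfolding tail by simp
    finally show ?thesis .
  qed
  define H where "H u w = indicator {0<..<1} u *\<^sub>R (indicator {0<..} w *\<^sub>R (E_map \<phi> (u * w) * g u * of_real w powr (s - 1)))" for u w :: real
  \<comment> \<open>For \<open>v = u * w\<close>, the power \<open>w powr (s - 1)\<close> splits
    into \<open>u powr (1 - s)\<close> and \<open>v powr (s - 1)\<close>. For fixed \<open>u\<close>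
    the kernel is thus a constant multiple of a dilate of \<open>a\<close>; the dilation supplies
    the remaining factor \<open>1 / u\<close>.\<close>
  have Ha: "H u w = (indicator {0<..<1} u *\<^sub>R (g u * of_real u powr (1 - s))) * a (0 + u * w)" for u w
  proof (cases "0 < u \<and> 0 < w")
    case True
    have "of_real (u * w) powr (s - 1) = (of_real u powr (s - 1) * of_real w powr (s - 1) :: complex)"
      using True by (simp add: powr_times_real)
    moreover have "of_real u powr (1 - s) * of_real u powr (s - 1) = (1 :: complex)"
      using True by (simp add: powr_add[symmetric])
    then have "of_real u powr (1 - s) * (of_real u powr (s - 1) * X) = X" for X :: complex
      by (metis mult.assoc mult_1)
    ultimately show ?thesis using True by (simp add: H_def a_def mult_ac del: of_real_mult)
  next
    case False
    then show ?thesis by (auto simp: H_def a_def indicator_def zero_less_mult_iff)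
  qed
  have HM: "(\<lambda>(u, w). H u w) \<in> borel_measurable (lborel \<Otimes>\<^sub>M lborel)" unfolding H_def by measurable
  have Hw: "integrable lborel (H u)" for u
  proof (cases "u > 0")
    case True
    show ?thesis unfolding Ha[abs_def] by (intro integrable_mult_right lborel_integrable_real_affine ai) (use True in simp)
  qed (simp add: H_def[abs_def])
  have scal: "(LINT w|lborel. f (0 + u * w)) = (1 / u) *\<^sub>R integral\<^sup>L lborel f" if "u > 0" for u and f :: "real \<Rightarrow> 'x::{banach, second_countable_topology}"
    using lborel_integral_real_affine[of u f 0] that by simp
  have gk: "set_integrable lborel {0<..<1} (\<lambda>u. norm (g u) * u powr (- Re s))"
    using g_mellin01_integrable[of "1 - Re s"] s by simp
  have normH: "(LINT w|lborel. norm (H u w)) = (indicator {0<..<1} u *\<^sub>R (norm (g u) * u powr (- Re s))) * (LINT v|lborel. norm (a v))" for u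
  proof (cases "u \<in> {0<..<1}")
    case True
    have "(LINT w|lborel. norm (H u w)) = norm (g u) * u powr (1 - Re s) * (LINT w|lborel. norm (a (0 + u * w)))"
      unfolding Ha norm_mult using True norm_powr_of_real[of u "1 - s"] by (simp add: norm_mult)
    also have "(LINT w|lborel. norm (a (0 + u * w))) = (1 / u) * (LINT v|lborel. norm (a v))"
      using scal[of u "\<lambda>v. norm (a v)"] True by simp
    also have "u powr (1 - Re s) = u powr (- Re s) * u" using True by (simp add: powr_diff powr_minus divide_inverse)
    finally show ?thesis using True by simp
  qed (simp add: H_def)
  have HI: "integrable (lborel \<Otimes>\<^sub>M lborel) (case_prod H)"
  proof (rule lborel_pair.Fubini_integrable)
    show "integrable lborel (\<lambda>u. LINT w|lborel. norm (case_prod H (u, w)))"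
      unfolding case_prod_conv normH using gk by (intro integrable_mult_left) (simp add: set_integrable_def)
  qed (use HM Hw in auto)
  have "(LINT w|lborel. LINT u|lborel. H u w) = (LINT u|lborel. LINT w|lborel. H u w)"
    by (rule lborel_pair.Fubini_integral[OF HI])
  moreover have "(LINT u|lborel. LINT w|lborel. H u w) = k s * A"
  proof -
    have "(LINT w|lborel. H u w) = (indicator {0<..<1} u *\<^sub>R (g u * of_real u powr ((1 - s) - 1))) * A" for u
    proof (cases "u \<in> {0<..<1}")
      case True
      have "(LINT w|lborel. H u w) = g u * of_real u powr (1 - s) * (LINT w|lborel. a (0 + u * w))"
        unfolding Ha using True by simp
      also have "(LINT w|lborel. a (0 + u * w)) = A / of_real u"
        using scal[of u a] True by (simp add: A_def scaleR_conv_of_real)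
      also have "of_real u powr ((1 - s) - 1) = (of_real u powr (1 - s) / of_real u :: complex)"
        using True by (subst powr_diff) auto
      ultimately show ?thesis using True by simp
    qed (simp add: H_def)
    note hw = this
    show ?thesis unfolding hw integral_mult_left_zero k_def mellin01_def set_lebesgue_integral_def ..
  qed
  moreover have "(LINT w|lborel. LINT u|lborel. H u w) = mellin01 (T \<phi>) s - half_integral \<phi> * c / (s - 1)"
  proof -
    have HT: "(LINT u|lborel. H u w) = indicator {0<..} w *\<^sub>R (T \<phi> w * of_real w powr (s - 1))" for w
    proof -
      have "(LINT u|lborel. H u w) = (LINT u|lborel. (indicator {0<..} w *\<^sub>R of_real w powr (s - 1)) * (indicator {0<..<1} u *\<^sub>R (E_map \<phi> (u * w) * g u)))"
        by (rule Bochner_Integration.integral_cong) (auto simp: H_def indicator_def)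
      also have "\<dots> = (indicator {0<..} w *\<^sub>R of_real w powr (s - 1)) * T \<phi> w"
        unfolding integral_mult_right_zero T_def set_lebesgue_integral_def ..
      finally show ?thesis by (simp add: mult.commute)
    qed
    have Tset: "set_integrable lborel {0<..} (\<lambda>w. T \<phi> w * of_real w powr (s - 1))"
      using lborel_pair.integrable_snd[OF HI] unfolding HT by (simp add: set_integrable_def)
    have "(LINT w|lborel. LINT u|lborel. H u w) = (LINT w:{0<..}|lborel. T \<phi> w * of_real w powr (s - 1))"
      unfolding HT set_lebesgue_integral_def ..
    also have "\<dots> = mellin01 (T \<phi>) s + (LINT w:{1<..}|lborel. T \<phi> w * of_real w powr (s - 1))"
      unfolding mellin01_def by (rule set_integral_half_line[OF Tset])
    also have "(LINT w:{1<..}|lborel. T \<phi> w * of_real w powr (s - 1)) = (LINT w:{1<..}|lborel. (half_integral \<phi> * c / of_real w) * of_real w powr (s - 1))"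
      by (rule set_lebesgue_integral_cong) (auto simp: T_tail[OF S])
    also have "\<dots> = - (half_integral \<phi> * c) / (s - 1)" by (rule tail)
    finally show ?thesis by simp
  qed
  ultimately have e: "mellin01 (T \<phi>) s - half_integral \<phi> * c / (s - 1) = k s * (mellin01 (E_map \<phi>) s + half_integral \<phi> / (s - 1))"
    unfolding A by simp
  have "(s - 1) * mellin01 (T \<phi>) s - c * half_integral \<phi> = (s - 1) * (mellin01 (T \<phi>) s - half_integral \<phi> * c / (s - 1))"
    using s1 by (simp add: right_diff_distrib mult.commute)
  also have "\<dots> = k s * ((s - 1) * (mellin01 (E_map \<phi>) s + half_integral \<phi> / (s - 1)))" unfolding e by (rule mult.left_commute)
  also have "(s - 1) * (mellin01 (E_map \<phi>) s + half_integral \<phi> / (s - 1)) = (s - 1) * mellin01 (E_map \<phi>) s + half_integral \<phi>"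
    using s1 by (simp add: distrib_left)
  finally show ?thesis .
qed

end

text \<open>The terms from 2 on are at most half of those of the Basel series, so they sum to at
  most \<open>(pi\<^sup>2 / 6 - 1) / 2\<close>. The crude \<open>pi < 4\<close> makes this
  \<open>5/6\<close>, against the leading term 1.\<close>

lemma norm_dirichlet_lower:
  assumes s: "Re s \<ge> 3"
  shows "norm (\<Sum>n. 1 / of_nat (Suc n) powr s :: complex) \<ge> 1/6"
proof -
  define f where "f n = (1 / of_nat (Suc n) powr s :: complex)" for n
  define q where "q n = 1 / (real (Suc n))\<^sup>2" for n
  have q: "q sums (pi\<^sup>2 / 6)" using inverse_squares_sums by (simp add: q_def[abs_def] add.commute)
  then have q1: "(\<lambda>n. q (Suc n)) sums (pi\<^sup>2 / 6 - q 0)" by (subst sums_Suc_iff) simp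
  have le: "norm (f (Suc n)) \<le> (1/2) * q (Suc n)" for n
  proof -
    have "norm (f (Suc n)) = 1 / real (Suc (Suc n)) powr Re s"
      using norm_powr_of_real[of "real (Suc (Suc n))" s] by (simp add: f_def norm_divide)
    also have "\<dots> \<le> 1 / real (Suc (Suc n)) powr 3"
      using s by (intro divide_left_mono powr_mono) auto
    also have "\<dots> = 1 / real (Suc (Suc n)) * q (Suc n)"
    proof -
      have "real (Suc (Suc n)) powr 3 = real (Suc (Suc n)) ^ 3" by (rule powr_numeral) simp
      then show ?thesis by (simp add: q_def power3_eq_cube power2_eq_square)
    qed
    also have "\<dots> \<le> (1/2) * q (Suc n)" by (intro mult_right_mono) (auto simp: q_def)
    finally show ?thesis .
  qed
  have sm: "summable (\<lambda>n. (1/2) * q (Suc n))" using q1 by (intro summable_mult) (simp add: sums_iff)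
  have sf1: "summable (\<lambda>n. f (Suc n))" by (rule summable_comparison_test'[OF sm]) (rule le)
  then have sf: "summable f" by (simp add: summable_Suc_iff)
  have "norm (\<Sum>n. f (Suc n)) \<le> (\<Sum>n. (1/2) * q (Suc n))" by (rule norm_suminf_le[OF le sm])
  also have "\<dots> = (1/2) * (pi\<^sup>2 / 6 - 1)" using q1 by (subst suminf_mult) (auto simp: sums_iff q_def)
  also have "\<dots> \<le> 5/6"
  proof -
    have "pi\<^sup>2 \<le> 4\<^sup>2" using pi_less_4 by (intro power_mono) auto
    then show ?thesis by simp
  qed
  finally have "norm (\<Sum>n. f (Suc n)) \<le> 5/6" .
  moreover have "(\<Sum>n. f n) = f 0 + (\<Sum>n. f (Suc n))" using suminf_split_head[OF sf] by simp
  moreover have "f 0 = 1" by (simp add: f_def)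
  ultimately have "norm (\<Sum>n. f n) \<ge> 1/6"
    using norm_triangle_ineq2[of 1 "- (\<Sum>n. f (Suc n))"] by simp
  then show ?thesis by (simp add: f_def)
qed

text \<open>Two demands on the width \<open>\<eta>\<close> pull in opposite directions: it must be
  small for the transform at \<open>s\<close> not to be exponentially small in \<open>Re s\<close>,
  and large for the derivative, which controls \<open>E_map\<close>, to stay small. Width of order
  \<open>1 / (1 + norm s)\<close> keeps both losses linear.\<close>

lemma polynomial_growth_bump:
  assumes s: "Re s \<ge> 1/8"
  obtains \<phi> where "\<phi> \<in> S_le1" "norm (mellin01 \<phi> s) \<ge> exp (-6) / (24 * (1 + norm s))"
    "\<And>u. u > 0 \<Longrightarrow> norm (E_map \<phi> u) \<le> 72 * (1 + norm s)" "norm (half_integral \<phi>) \<le> 1"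
proof -
  define R where "R = 1 + norm s"
  have R: "R \<ge> 1" by (simp add: R_def)
  define n where "n = nat \<lceil>norm s\<rceil>"
  have n: "norm s \<le> real n" "real n \<le> R" proof -
    have "real n = of_int \<lceil>norm s\<rceil>" unfolding n_def by (rule of_nat_nat) (use ceiling_mono[OF norm_ge_zero[of s]] in simp)
    then show "norm s \<le> real n" "real n \<le> R" using ceiling_correct[of "norm s"] by (auto simp: R_def)
  qed
  \<comment> \<open>Bernoulli's inequality gives \<open>(1 - \<eta>) ^ n \<ge> 1/2\<close>. With
    \<open>R = 1 + norm s\<close>, \<open>1 / \<eta> \<le> 4 * R\<close> gives the constant
    \<open>24 = 3 * 4 * 2\<close>, and the derivative bound \<open>16 * R + 2 * R = 18 * R\<close>,
    times 4 for \<open>pi\<close>, gives 72.\<close>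
  define \<eta> where "\<eta> = 1 / (2 * (real n + 1))"
  have \<eta>: "0 < \<eta>" "\<eta> \<le> 1/2" by (auto simp: \<eta>_def field_simps)
  define \<phi> where "\<phi> = bump \<eta> (Im s)"
  have S: "\<phi> \<in> S_le1" unfolding \<phi>_def by (rule bump_in_S_le1[OF \<eta>])
  have "Re s \<le> real n + 1" using complex_Re_le_cmod[of s] n by linarith
  from bump_mellin01_lower[OF \<eta> this]
  have l1: "norm (mellin01 \<phi> s) \<ge> \<eta> / 3 * exp (-6) * (1 - \<eta>) ^ n" by (simp add: \<phi>_def)
  have l2: "(1 - \<eta>) ^ n \<ge> 1/2"
  proof -
    have "1 + real n * (- \<eta>) \<le> (1 + (- \<eta>)) ^ n" by (rule Bernoulli_inequality) (use \<eta> in simp)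
    moreover have "real n * \<eta> \<le> 1/2" by (simp add: \<eta>_def field_simps)
    ultimately show ?thesis by simp
  qed
  have l3: "\<eta> \<ge> 1 / (4 * R)" unfolding \<eta>_def using n R by (intro divide_left_mono) auto
  have "1 / (4 * R) / 3 * exp (-6) * (1/2) \<le> \<eta> / 3 * exp (-6) * (1 - \<eta>) ^ n"
    using l2 l3 \<eta> R by (intro mult_mono divide_right_mono) auto
  moreover have "1 / (4 * R) / 3 * exp (-6) * (1/2) = exp (-6) / (24 * R)" by simp
  ultimately have lower: "norm (mellin01 \<phi> s) \<ge> exp (-6) / (24 * R)" using l1 by linarith
  obtain D where D: "D 0 = \<phi>" "\<And>n x. (D n has_vector_derivative D (Suc n) x) (at x)"
    "\<And>n x. 1 \<le> \<bar>x\<bar> \<Longrightarrow> D n x = 0" using S_le1_derivs[OF S] by metis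
  have d: "(\<phi> has_vector_derivative D 1 x) (at x)" for x using D(2)[of 0 x] D(1) by simp
  have db: "norm (D 1 x) \<le> 18 * R" for x
  proof -
    have "norm (D 1 x) \<le> 4 / \<eta> + 2 * \<bar>Im s\<bar>" by (rule bump_derivative[OF \<eta> d[unfolded \<phi>_def]])
    also have "4 / \<eta> = 8 * (real n + 1)" by (simp add: \<eta>_def)
    also have "8 * (real n + 1) + 2 * \<bar>Im s\<bar> \<le> 18 * R"
      using n R abs_Im_le_cmod[of s] by (simp add: R_def)
    finally show ?thesis .
  qed
  have Eb: "norm (E_map \<phi> u) \<le> 72 * R" if "u > 0" for u
  proof -
    have "norm (E_map \<phi> u) \<le> 18 * R * pi" by (rule E_map_bound[OF S d db that])
    also have "\<dots> \<le> 18 * R * 4" using R pi_less_4 by (intro mult_left_mono) auto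
    finally show ?thesis by simp
  qed
  have "norm (mellin01 \<phi> 1) \<le> 1 / Re 1"
    by (rule bounded_mellin01_norm[OF S_le1_measurable[OF S]]) (auto simp: \<phi>_def norm_bump_le_1[OF \<eta>])
  then have "norm (half_integral \<phi>) \<le> 1" using mellin01_1[OF S] by simp
  then show ?thesis using that[OF S lower[unfolded R_def] Eb[unfolded R_def]] by simp
qed

text \<open>The identity is evaluated at the bump adapted to \<open>s\<close>: its left side is of
  order \<open>R ^ 2\<close> and the transform by which \<open>X\<close> is multiplied is at least
  of order \<open>1 / R\<close>. It is applied with \<open>E_map\<close> and \<open>X = Z s\<close>,
  and with \<open>T\<close> and \<open>X = K s * Z s\<close>. The constant 576 is
  \<open>72 * 8\<close>, with 8 from \<open>Re s \<ge> 1/8\<close>.\<close>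

lemma polynomial_growth_factor:
  assumes s: "Re s \<ge> 1/8" and eq: "\<And>\<phi>. \<phi> \<in> S_le1 \<Longrightarrow> (s - 1) * mellin01 (F \<phi>) s + a * half_integral \<phi> = X * mellin01 \<phi> s"
    and F: "\<And>\<phi>. \<phi> \<in> S_le1 \<Longrightarrow> F \<phi> \<in> borel_measurable borel"
    and Fb: "\<And>\<phi> C u. \<phi> \<in> S_le1 \<Longrightarrow> (\<And>u. u > 0 \<Longrightarrow> norm (E_map \<phi> u) \<le> C) \<Longrightarrow> u > 0 \<Longrightarrow> norm (F \<phi> u) \<le> C * G"
    and G: "G \<ge> 0"
  shows "norm X \<le> 24 * exp 6 * (576 * G + norm a) * (1 + norm s) ^ 3"
proof -
  define R where "R = 1 + norm s"
  have R: "R \<ge> 1" by (simp add: R_def)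
  obtain \<phi> where S: "\<phi> \<in> S_le1" and l: "norm (mellin01 \<phi> s) \<ge> exp (-6) / (24 * R)"
    and E: "\<And>u. u > 0 \<Longrightarrow> norm (E_map \<phi> u) \<le> 72 * R" and t: "norm (half_integral \<phi>) \<le> 1"
    using polynomial_growth_bump[OF s] unfolding R_def by blast
  have "norm (mellin01 (F \<phi>) s) \<le> (72 * R * G) / Re s"
    by (rule bounded_mellin01_norm[OF F[OF S]]) (use s Fb[OF S E] in auto)
  also have "\<dots> \<le> (72 * R * G) / (1/8)" using s R G by (intro divide_left_mono) auto
  finally have m: "norm (mellin01 (F \<phi>) s) \<le> 576 * G * R" by (simp add: mult_ac)
  have "norm (s - 1) \<le> R" using norm_triangle_ineq4[of s 1] by (simp add: R_def)
  then have "norm ((s - 1) * mellin01 (F \<phi>) s) \<le> R * (576 * G * R)"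
    unfolding norm_mult using m R by (intro mult_mono) auto
  moreover have "norm (a * half_integral \<phi>) \<le> norm a * 1" unfolding norm_mult using t by (intro mult_left_mono) auto
  ultimately have "norm (X * mellin01 \<phi> s) \<le> R * (576 * G * R) + norm a * 1"
    unfolding eq[OF S, symmetric] by (rule norm_triangle_le[OF add_mono])
  also have "\<dots> \<le> (576 * G + norm a) * R\<^sup>2"
  proof -
    have "norm a * 1 \<le> norm a * R\<^sup>2" using R by (intro mult_left_mono one_le_power) auto
    then show ?thesis by (simp add: power2_eq_square algebra_simps)
  qed
  finally have 1: "norm X * norm (mellin01 \<phi> s) \<le> (576 * G + norm a) * R\<^sup>2" by (simp add: norm_mult)
  have "norm X * (exp (-6) / (24 * R)) \<le> (576 * G + norm a) * R\<^sup>2"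
    by (rule order_trans[OF mult_left_mono[OF l] 1]) simp
  then have "norm X * exp (-6) \<le> (576 * G + norm a) * R\<^sup>2 * (24 * R)"
    using R by (simp add: pos_divide_le_eq)
  then have "norm X * exp (-6) * exp 6 \<le> (576 * G + norm a) * R\<^sup>2 * (24 * R) * exp 6"
    by (intro mult_right_mono) auto
  moreover have "norm X * exp (-6) * exp 6 = norm X" unfolding mult.assoc mult_exp_exp by simp
  ultimately have "norm X \<le> (576 * G + norm a) * R\<^sup>2 * (24 * R) * exp 6" by (simp only:)
  also have "\<dots> = 24 * exp 6 * (576 * G + norm a) * R ^ 3"
    by (simp only: power2_eq_square power3_eq_cube mult_ac)
  finally show ?thesis by (simp only: R_def)
qed

text \<open>By Liouville's theorem \<open>K\<close> is a polynomial; a nonconstant one is large near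
  infinity in every direction, in particular along the negative real axis.\<close>

lemma entire_polynomial_growth_zero:
  assumes K: "K holomorphic_on UNIV" and bd: "\<And>z. norm (K z) \<le> B * (1 + norm z) ^ n"
    and lim: "((\<lambda>x. K (of_real (- x))) \<longlongrightarrow> 0) at_top"
  shows "K z = 0"
proof -
  have bd': "norm (K z) \<le> (B * 2 ^ n) * norm z ^ n" if "1 \<le> norm z" for z
  proof -
    have B: "B \<ge> 0" using order_trans[OF norm_ge_zero bd[of 0]] by simp
    have "B * (1 + norm z) ^ n \<le> B * (2 * norm z) ^ n" using that B by (intro mult_left_mono power_mono) auto
    then show ?thesis using bd[of z] by (simp add: power_mult_distrib mult.assoc)
  qed
  define a where "a k = (deriv ^^ k) K 0 / fact k" for k
  have P: "K \<xi> = (\<Sum>k\<le>n. a k * \<xi> ^ k)" for \<xi>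
    unfolding a_def by (rule Liouville_polynomial[OF K bd'])
  have inf: "filterlim (\<lambda>x. complex_of_real (- x)) at_infinity at_top"
    unfolding filterlim_at_infinity_conv_norm_at_top by (simp add: filterlim_abs_real)
  have a0: "a k = 0" if "k \<noteq> 0" "k \<le> n" for k
  proof (rule ccontr)
    assume "a k \<noteq> 0"
    then have "eventually (\<lambda>z. norm (\<Sum>i\<le>n. a i * z ^ i) \<ge> 1) at_infinity"
      using that by (intro polyfun_extremal) auto
    then have "eventually (\<lambda>x. norm (K (of_real (- x))) \<ge> 1) at_top"
      using inf unfolding P filterlim_iff by blast
    moreover have "eventually (\<lambda>x. norm (K (of_real (- x))) < 1) at_top"
      using tendstoD[OF lim, of 1] by (simp add: dist_norm)
    ultimately have "eventually (\<lambda>x::real. False) at_top" by eventually_elim simp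
    then show False by simp
  qed
  have const: "K \<xi> = a 0" for \<xi>
  proof -
    have "(\<Sum>k\<le>n. a k * \<xi> ^ k) = (\<Sum>k\<in>{0}. a k * \<xi> ^ k)"
      by (rule sum.mono_neutral_right) (use a0 in auto)
    then show ?thesis by (simp add: P)
  qed
  then have "((\<lambda>x::real. a 0) \<longlongrightarrow> 0) at_top" using lim by simp
  then have "a 0 = 0" by (simp add: tendsto_const_iff)
  then show ?thesis using const by simp
qed

context orth_fun
begin

text \<open>The Mellin transforms of the functions \<open>T \<phi>\<close> continue
  \<open>k * Z\<close> to a function \<open>N\<close> on \<open>Re s > 0\<close>. The quotient
  \<open>N / Z\<close> there and \<open>k\<close> itself on \<open>Re s < 1/2\<close> agree on the
  strip in between, and together they cover the plane.\<close>

lemma k_quotient: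
  assumes Z: "Z holomorphic_on UNIV" "Z 1 = 1" and RH: "\<And>s. Re s > 1/2 \<Longrightarrow> Z s \<noteq> 0"
    and Zid: "\<And>\<phi> s. \<phi> \<in> S_le1 \<Longrightarrow> Re s > 0 \<Longrightarrow> (s - 1) * mellin01 (E_map \<phi>) s + half_integral \<phi> = Z s * mellin01 \<phi> s"
  obtains K where "K holomorphic_on UNIV" "\<And>s. Re s < 1/2 \<Longrightarrow> K s = k s"
    "\<And>\<phi> s. \<phi> \<in> S_le1 \<Longrightarrow> Re s > 0 \<Longrightarrow> (s - 1) * mellin01 (T \<phi>) s - c * half_integral \<phi> = K s * Z s * mellin01 \<phi> s"
proof -
  let ?U = "{s::complex. Re s > 0}"
  let ?V = "{s::complex. Re s > 0} \<inter> {s. Re s < 1/2}"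
  have U: "open ?U" "connected ?U" by (auto intro: open_halfspace_Re_gt convex_connected convex_halfspace_Re_gt)
  have oV: "open ?V" by (intro open_Int open_halfspace_Re_gt open_halfspace_Re_lt)
  have Vne: "1/4 \<in> ?V" by simp
  have Vne': "?V \<noteq> {}" using Vne by blast
  have "\<exists>N. N holomorphic_on ?U \<and> (\<forall>s\<in>?V. N s = k s * Z s) \<and>
     (\<forall>\<phi>\<in>S_le1. \<forall>s\<in>?U. (s - 1) * mellin01 (T \<phi>) s - c * half_integral \<phi> = N s * mellin01 \<phi> s)"
  proof (rule glue_holomorphic[OF U oV Vne'])
    show "\<exists>\<phi>\<in>S_le1. mellin01 \<phi> s \<noteq> 0" for s
      by (rule bexI[of _ "bump (1/2) (Im s)"]) (use bump_mellin01_nonzero[of "1/2" s] in \<open>auto intro: bump_in_S_le1\<close>)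
    show "(s - 1) * mellin01 (T \<phi>) s - c * half_integral \<phi> = k s * Z s * mellin01 \<phi> s" if "\<phi> \<in> S_le1" "s \<in> ?V" for \<phi> s
      using main_identity[OF that(1), of s] Zid[OF that(1), of s] that(2) by (simp add: mult.assoc)
    show "(\<lambda>s. (s - 1) * mellin01 (T \<phi>) s - c * half_integral \<phi>) holomorphic_on ?U" if "\<phi> \<in> S_le1" for \<phi>
      by (intro holomorphic_intros mellin01_T_holomorphic that)
    show "mellin01 \<phi> holomorphic_on ?U" if "\<phi> \<in> S_le1" for \<phi> by (rule mellin01_S_holomorphic[OF that])
  qed auto
  then obtain N where N: "N holomorphic_on ?U" "\<And>s. s \<in> ?V \<Longrightarrow> N s = k s * Z s"
    "\<And>\<phi> s. \<phi> \<in> S_le1 \<Longrightarrow> Re s > 0 \<Longrightarrow> (s - 1) * mellin01 (T \<phi>) s - c * half_integral \<phi> = N s * mellin01 \<phi> s" by auto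
  have ZU: "Z holomorphic_on ?U" using Z(1) holomorphic_on_subset by blast
  have "\<exists>Q. Q holomorphic_on ?U \<and> (\<forall>s\<in>?U. N s = Q s * Z s)"
  proof (rule holomorphic_quotient_extend[OF N(1) ZU U])
    show "\<exists>z\<in>?U. Z z \<noteq> 0" using Z(2) by (intro bexI[of _ 1]) auto
    fix a assume a: "a \<in> ?U" "Z a = 0"
    have ra: "Re a \<le> 1/2" using RH[of a] a by (meson not_le)
    \<comment> \<open>The zero has real part at most \<open>1/2\<close>, so points approaching it
      horizontally from the left lie in the strip where \<open>N\<close> is \<open>k * Z\<close> and
      \<open>k_bound\<close> applies. The bound costs at most \<open>\<epsilon> powr (-1/2)\<close>
      at distance \<open>\<epsilon>\<close>, which the factor \<open>z - a\<close>
      outweighs.\<close>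
    define F where "F = filtermap (\<lambda>\<epsilon>. a - of_real \<epsilon>) (at_right (0::real))"
    have "F \<noteq> bot" by (simp add: F_def filtermap_bot_iff)
    moreover have "F \<le> at a"
    proof -
      have "filterlim (\<lambda>\<epsilon>. a - complex_of_real \<epsilon>) (at a) (at_right 0)"
        unfolding filterlim_at
      proof
        show "\<forall>\<^sub>F \<epsilon> in at_right 0. a - complex_of_real \<epsilon> \<in> UNIV \<and> a - complex_of_real \<epsilon> \<noteq> a"
          using eventually_at_right_less[of "0::real"] by eventually_elim auto
        have "((\<lambda>\<epsilon>. a - complex_of_real \<epsilon>) \<longlongrightarrow> a - of_real 0) (at_right 0)" by (intro tendsto_intros)
        then show "((\<lambda>\<epsilon>. a - complex_of_real \<epsilon>) \<longlongrightarrow> a) (at_right 0)" by simp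
      qed
      then show ?thesis by (simp add: F_def filterlim_def)
    qed
    moreover have "((\<lambda>z. (z - a) * (N z / Z z)) \<longlongrightarrow> 0) F"
    proof -
      have "((\<lambda>\<epsilon>. ((a - of_real \<epsilon>) - a) * (N (a - of_real \<epsilon>) / Z (a - of_real \<epsilon>))) \<longlongrightarrow> 0) (at_right 0)"
      proof (rule Lim_null_comparison)
        have "eventually (\<lambda>\<epsilon>. \<epsilon> \<in> {0<..<Re a}) (at_right 0)" by (rule eventually_at_right_real) (use a in simp)
        then show "\<forall>\<^sub>F \<epsilon> in at_right 0. norm (((a - of_real \<epsilon>) - a) * (N (a - of_real \<epsilon>) / Z (a - of_real \<epsilon>))) \<le> sqrt (G2 * \<epsilon>)"
        proof eventually_elim
          case (elim \<epsilon>)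
          define z where "z = a - of_real \<epsilon>"
          have z: "z \<in> ?V" "1 - 2 * Re z \<ge> 2 * \<epsilon>" "\<epsilon> > 0" using elim ra by (auto simp: z_def)
          \<comment> \<open>If \<open>Z z = 0\<close>, the quotient is 0 by convention and the
            inequality still holds.\<close>
          have "norm (N z / Z z) \<le> norm (k z)" using N(2)[OF z(1)] by (cases "Z z = 0") auto
          also have "\<dots> \<le> sqrt (G2 / (1 - 2 * Re z))" by (rule k_bound) (use z in simp)
          also have "\<dots> \<le> sqrt (G2 / \<epsilon>)" using z G2_nonneg by (intro real_sqrt_le_mono divide_left_mono) auto
          finally have "norm ((z - a) * (N z / Z z)) \<le> \<epsilon> * sqrt (G2 / \<epsilon>)"
            unfolding norm_mult using z by (intro mult_mono) (auto simp: z_def)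
          also have "\<dots> = sqrt (G2 * \<epsilon>)"
          proof -
            have "\<epsilon> * sqrt (G2 / \<epsilon>) = sqrt (\<epsilon>\<^sup>2 * (G2 / \<epsilon>))" unfolding real_sqrt_mult using z by simp
            also have "\<epsilon>\<^sup>2 * (G2 / \<epsilon>) = G2 * \<epsilon>" using z by (simp add: power2_eq_square)
            finally show ?thesis .
          qed
          finally show ?case by (simp add: z_def)
        qed
        have "((\<lambda>\<epsilon>. sqrt (G2 * \<epsilon>)) \<longlongrightarrow> sqrt (G2 * 0)) (at_right 0)" by (intro tendsto_intros)
        then show "((\<lambda>\<epsilon>. sqrt (G2 * \<epsilon>)) \<longlongrightarrow> 0) (at_right 0)" by simp
      qed
      then show ?thesis unfolding F_def filterlim_filtermap by (simp only:)
    qed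
    ultimately show "\<exists>F. F \<noteq> bot \<and> F \<le> at a \<and> ((\<lambda>z. (z - a) * (N z / Z z)) \<longlongrightarrow> 0) F" by blast
  qed
  then obtain Q where Q: "Q holomorphic_on ?U" "\<And>s. Re s > 0 \<Longrightarrow> N s = Q s * Z s" by auto
  have kV: "k holomorphic_on ?V" by (rule holomorphic_on_subset[OF k_holomorphic]) auto
  have QV: "Q holomorphic_on ?V" by (rule holomorphic_on_subset[OF Q(1)]) auto
  have cV: "connected ?V" by (intro convex_connected convex_Int convex_halfspace_Re_gt convex_halfspace_Re_lt)
  \<comment> \<open>Cancelling \<open>Z\<close> gives the equality only off its zeros; the identity
    theorem extends it to the strip. The set of nonzeros is nonempty, as otherwise \<open>Z\<close>
    would vanish identically, contrary to \<open>Z 1 = 1\<close>.\<close>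
  have Qk: "Q s = k s" if s: "s \<in> ?V" for s
  proof (rule analytic_continuation_open[of "{z\<in>?V. Z z \<noteq> 0}" ?V Q k])
    have "open (?V \<inter> Z -` (- {0}))"
      by (rule continuous_open_preimage) (use oV Z(1) holomorphic_on_imp_continuous_on continuous_on_subset in blast)+
    moreover have "?V \<inter> Z -` (- {0}) = {z\<in>?V. Z z \<noteq> 0}" by auto
    ultimately show "open {z\<in>?V. Z z \<noteq> 0}" by simp
    show "{z\<in>?V. Z z \<noteq> 0} \<noteq> {}"
    proof
      assume e: "{z\<in>?V. Z z \<noteq> 0} = {}"
      have "Z 1 = 0"
        by (rule analytic_continuation_open[of ?V UNIV Z "\<lambda>_. 0"]) (use oV Vne' Z(1) e in auto)
      then show False using Z(2) by simp
    qed
    show "Q z = k z" if "z \<in> {z\<in>?V. Z z \<noteq> 0}" for z using Q(2)[of z] N(2)[of z] that by simp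
  qed (use oV cV QV kV s in auto)
  define K where "K s = (if Re s < 1/2 then k s else Q s)" for s
  have K1: "K holomorphic_on {s. Re s < 1/2}"
    using k_holomorphic by (rule holomorphic_transform) (simp add: K_def)
  have KQ: "K s = Q s" if "Re s > 0" for s using Qk[of s] that by (simp add: K_def)
  have K2: "K holomorphic_on ?U" using Q(1) by (rule holomorphic_transform) (simp add: KQ)
  have "K holomorphic_on {s. Re s < 1/2} \<union> ?U"
    by (rule holomorphic_on_Un[OF K1 K2 open_halfspace_Re_lt open_halfspace_Re_gt])
  moreover have "{s. Re s < 1/2} \<union> ?U = UNIV" by auto
  ultimately have Kh: "K holomorphic_on UNIV" by simp
  show ?thesis
  proof (rule that[OF Kh])
    show "(s - 1) * mellin01 (T \<phi>) s - c * half_integral \<phi> = K s * Z s * mellin01 \<phi> s" if "\<phi> \<in> S_le1" "Re s > 0" for \<phi> s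
      using N(3)[OF that] Q(2)[OF that(2)] KQ[OF that(2)] by simp
  qed (simp add: K_def)
qed

theorem zero_on_unit_interval:
  assumes rh: riemann_hypothesis
  shows "AE u in lborel. 0 < u \<longrightarrow> u < 1 \<longrightarrow> g u = 0"
proof -
  obtain Z where Z: "Z holomorphic_on UNIV" "Z 1 = 1" "\<And>s. s \<noteq> 1 \<Longrightarrow> riemann_zeta s = Z s / (s - 1)"
    "\<And>s. Re s > 1 \<Longrightarrow> Z s = (s - 1) * (\<Sum>n. 1 / of_nat (Suc n) powr s)"
    "\<And>\<phi> s. \<phi> \<in> S_le1 \<Longrightarrow> Re s > 0 \<Longrightarrow> (s - 1) * mellin01 (E_map \<phi>) s + half_integral \<phi> = Z s * mellin01 \<phi> s"
    using zeta_continuation by blast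
  have nz: "Z s \<noteq> 0" if "Re s > 1/2" for s
  proof (cases "s = 1")
    case False
    then have "riemann_zeta s \<noteq> 0" using rh that unfolding riemann_hypothesis_def by blast
    then show ?thesis using Z(3)[OF False] by auto
  qed (simp add: Z(2))
  obtain K where K: "K holomorphic_on UNIV" "\<And>s. Re s < 1/2 \<Longrightarrow> K s = k s"
    "\<And>\<phi> s. \<phi> \<in> S_le1 \<Longrightarrow> Re s > 0 \<Longrightarrow> (s - 1) * mellin01 (T \<phi>) s - c * half_integral \<phi> = K s * Z s * mellin01 \<phi> s"
    using k_quotient[OF Z(1,2) nz Z(5)] by blast
  \<comment> \<open>One constant for both applications of \<open>polynomial_growth_factor\<close>:
    \<open>G = 1\<close>, \<open>a = 1\<close> for \<open>Z\<close>, and \<open>G = G1\<close>,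
    \<open>a = - c\<close> for \<open>K * Z\<close>.\<close>
  define B where "B = 24 * exp 6 * (576 * (1 + G1) + norm c + 1)"
  have B1: "B \<ge> 1"
  proof -
    have "1 * 1 \<le> (24 * exp 6) * (576 * (1 + G1) + norm c + 1)"
    proof (rule mult_mono)
      have "1 \<le> exp (6 :: real)" by simp
      then show "1 \<le> 24 * exp (6 :: real)" by linarith
      show "1 \<le> 576 * (1 + G1) + norm c + 1"
      proof -
        have "0 \<le> 576 * (1 + G1) + norm c"
          by (intro add_nonneg_nonneg mult_nonneg_nonneg G1_nonneg norm_ge_zero) auto
        then show ?thesis by simp
      qed
    qed auto
    then show ?thesis by (simp add: B_def)
  qed
  have Zb: "norm (Z s) \<le> B * (1 + norm s) ^ 3" if s: "Re s \<ge> 1/8" for s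
  proof -
    have "norm (Z s) \<le> 24 * exp 6 * (576 * 1 + norm (1::complex)) * (1 + norm s) ^ 3"
      by (rule polynomial_growth_factor[OF s, where F = E_map])
         (use s Z(5) E_map_measurable S_le1_measurable in auto)
    also have "\<dots> \<le> B * (1 + norm s) ^ 3" unfolding B_def using G1_nonneg by (intro mult_right_mono mult_left_mono) auto
    finally show ?thesis .
  qed
  have Nb: "norm (K s * Z s) \<le> B * (1 + norm s) ^ 3" if s: "Re s \<ge> 1/8" for s
  proof -
    have "norm (K s * Z s) \<le> 24 * exp 6 * (576 * G1 + norm (- c)) * (1 + norm s) ^ 3"
    proof (rule polynomial_growth_factor[OF s, where F = T])
      show "(s - 1) * mellin01 (T \<phi>) s + - c * half_integral \<phi> = K s * Z s * mellin01 \<phi> s" if "\<phi> \<in> S_le1" for \<phi>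
        using K(3)[OF that, of s] s by simp
      show "norm (T \<phi> u) \<le> C * G1" if "\<phi> \<in> S_le1" "\<And>u. u > 0 \<Longrightarrow> norm (E_map \<phi> u) \<le> C" "u > 0" for \<phi> C u
        by (rule T_bound[OF that])
    qed (use T_measurable G1_nonneg in auto)
    also have "\<dots> \<le> B * (1 + norm s) ^ 3" unfolding B_def using G1_nonneg by (intro mult_right_mono mult_left_mono) auto
    finally show ?thesis .
  qed
  have Zl: "norm (Z s) \<ge> 1/6" if s: "Re s \<ge> 3" for s
  proof -
    have "1 \<le> norm (s - 1)" using complex_Re_le_cmod[of "s - 1"] s by simp
    then have "1 * (1/6) \<le> norm (s - 1) * norm (\<Sum>n. 1 / of_nat (Suc n) powr s :: complex)"
      using norm_dirichlet_lower[OF s] by (intro mult_mono) auto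
    then show ?thesis using Z(4)[of s] s by (simp add: norm_mult)
  qed
  \<comment> \<open>In the strip between \<open>1/4\<close> and 3 the disc estimate yields
    \<open>6 * X * (6 * X * exp 1) ^ 184\<close> with \<open>X = 343 * B * R ^ 3\<close>, where
    \<open>184 = 8 / (1 - 22/23)\<close>. Collecting powers of \<open>R\<close> gives the exponent
    \<open>3 + 3 * 184 = 555\<close>. The summand \<open>sqrt (2 * G2)\<close> covers
    \<open>Re s \<le> 1/4\<close>.\<close>
  define C where "C = 6 * 343 * B * (6 * 343 * B * exp 1) ^ 184 + sqrt (2 * G2)"
  have growth: "norm (K s) \<le> C * (1 + norm s) ^ 555" for s
  proof -
    define R where "R = 1 + norm s"
    have R: "R \<ge> 1" by (simp add: R_def)
    consider "Re s \<le> 1/4" | "1/4 < Re s" "Re s < 3" | "3 \<le> Re s" by linarith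
    then show ?thesis
    proof cases
      case 1
      have "norm (K s) \<le> sqrt (G2 / (1 - 2 * Re s))" using K(2)[of s] k_bound[of s] 1 by simp
      also have "\<dots> \<le> sqrt (G2 / (1/2))" using 1 G2_nonneg by (intro real_sqrt_le_mono divide_left_mono) auto
      also have "\<dots> \<le> C * 1" using B1 by (simp add: C_def mult.commute)
      also have "\<dots> \<le> C * R ^ 555" using R B1 G2_nonneg by (intro mult_left_mono one_le_power) (auto simp: C_def)
      finally show ?thesis by (simp add: R_def)
    next
      case 3
      have "norm (K s) * (1/6) \<le> norm (K s) * norm (Z s)" using Zl[OF 3] by (intro mult_left_mono) auto
      also have "\<dots> \<le> B * R ^ 3" using Nb[of s] 3 by (simp add: norm_mult R_def)
      finally have "norm (K s) \<le> 6 * B * R ^ 3" by simp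
      also have "\<dots> \<le> C * R ^ 555"
      proof (intro mult_mono)
        have "1 * 1 \<le> (6 * 343 * B) * exp 1" using B1 by (intro mult_mono) auto
        then have "1 \<le> (6 * 343 * B * exp 1) ^ 184" by (intro one_le_power) simp
        then have "6 * B * 1 \<le> 6 * 343 * B * (6 * 343 * B * exp 1) ^ 184"
          using B1 by (intro mult_mono) auto
        moreover have "0 \<le> sqrt (2 * G2)" using G2_nonneg by simp
        ultimately show "6 * B \<le> C" unfolding C_def by linarith
        show "R ^ 3 \<le> R ^ 555" using R by (intro power_increasing) auto
      qed (use B1 R G2_nonneg in \<open>auto simp: C_def\<close>)
      finally show ?thesis by (simp add: R_def)
    next
      case 2
      \<comment> \<open>The disc about \<open>3 + i * Im s\<close> of radius \<open>23/8\<close>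
        stays in \<open>Re z \<ge> 1/8\<close>, where both growth bounds hold, and \<open>s\<close>
        is within \<open>11/4 = 22/23 * 23/8\<close> of the centre. On the disc
        \<open>1 + norm z \<le> 7 * R\<close>, which explains \<open>343 = 7 ^ 3\<close>.\<close>
      define z0 where "z0 = Complex 3 (Im s)"
      define X where "X = 343 * B * R ^ 3"
      have X: "X \<ge> 1"
      proof -
        have "1 * 1 \<le> (343 * B) * R ^ 3" using B1 R by (intro mult_mono one_le_power) auto
        then show ?thesis by (simp add: X_def)
      qed
      have "s - z0 = of_real (Re s - 3)" by (simp add: z0_def complex_eq_iff)
      then have "norm (s - z0) = \<bar>Re s - 3\<bar>" by (simp only: norm_of_real)
      then have sz: "dist z0 s = 3 - Re s" using 2 by (simp add: dist_norm norm_minus_commute[of z0])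
      have disc: "Re z \<ge> 1/8 \<and> B * (1 + norm z) ^ 3 \<le> X" if "dist z0 z \<le> 23/8" for z
      proof
        have "\<bar>Re (z0 - z)\<bar> \<le> 23/8" using that abs_Re_le_cmod[of "z0 - z"] by (simp add: dist_norm)
        then have "\<bar>3 - Re z\<bar> \<le> 23/8" by (simp add: z0_def)
        then show "Re z \<ge> 1/8" by linarith
        have "dist s z \<le> 23/4" using dist_triangle3[of s z z0] sz that 2 by simp
        then have "norm z \<le> norm s + 23/4" using norm_triangle_ineq2[of z s] by (simp add: dist_norm norm_minus_commute)
        then have "1 + norm z \<le> 7 * R" by (simp add: R_def) (use norm_ge_zero[of s] in linarith)
        then have "(1 + norm z) ^ 3 \<le> (7 * R) ^ 3" by (intro power_mono) auto
        then have "B * (1 + norm z) ^ 3 \<le> B * (7 * R) ^ 3" using B1 by (intro mult_left_mono) auto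
        also have "\<dots> = X" by (simp add: X_def power_mult_distrib)
        finally show "B * (1 + norm z) ^ 3 \<le> X" .
      qed
      have "norm (K s) \<le> X * exp (8 / (1 - 22/23) * (ln (X / (1/6)) + 1)) / (1/6)"
      proof (rule quotient_growth[where S = UNIV and c = z0 and R = "23/8" and r = "22/23" and Z = Z and K = K])
        show "norm (K z * Z z) \<le> X" if "dist z0 z \<le> 23/8" for z using Nb[of z] disc[OF that] by linarith
        show "norm (Z z) \<le> X" if "dist z0 z \<le> 23/8" for z using Zb[of z] disc[OF that] by linarith
        show "norm (Z z0) \<ge> 1/6" by (rule Zl) (simp add: z0_def)
        show "dist z0 s \<le> 22/23 * (23/8)" using sz 2 by simp
      qed (use K(1) Z(1) in auto)
      also have "8 / (1 - 22/23) * (ln (X / (1/6)) + 1) = real 184 * ln (6 * X * exp 1)"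
        using X by (simp add: ln_mult)
      also have "exp (real 184 * ln (6 * X * exp 1)) = (6 * X * exp 1) ^ 184"
        using X by (subst exp_of_nat_mult) simp
      also have "X * (6 * X * exp 1) ^ 184 / (1/6) = 6 * 343 * B * (6 * 343 * B * exp 1) ^ 184 * (R ^ 3 * (R ^ 3) ^ 184)"
      proof -
        have "6 * X * exp 1 = (6 * 343 * B * exp 1) * R ^ 3" by (simp only: X_def mult_ac)
        then have pw: "(6 * X * exp 1) ^ 184 = (6 * 343 * B * exp 1) ^ 184 * (R ^ 3) ^ 184"
          by (simp only: power_mult_distrib)
        have "X * (p * q) / (1/6) = 6 * 343 * B * p * (R ^ 3 * q)" for p q by (simp add: X_def)
        then show ?thesis unfolding pw .
      qed
      also have "R ^ 3 * (R ^ 3) ^ 184 = R ^ 555"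
        unfolding power_mult[symmetric] power_add[symmetric] by (rule arg_cong[where f = "(^) R"]) simp
      also have "6 * 343 * B * (6 * 343 * B * exp 1) ^ 184 * R ^ 555 \<le> C * R ^ 555"
        using R G2_nonneg by (intro mult_right_mono) (auto simp: C_def)
      finally show ?thesis by (simp add: R_def)
    qed
  qed
  have lim: "((\<lambda>x. K (of_real (- x))) \<longlongrightarrow> 0) at_top"
  proof (rule Lim_null_comparison)
    show "\<forall>\<^sub>F x in at_top. norm (K (of_real (- x))) \<le> sqrt (G2 / (1 + 2 * x))"
      using eventually_gt_at_top[of "0::real"]
    proof eventually_elim
      case (elim x)
      then show ?case using K(2)[of "of_real (- x)"] k_bound[of "of_real (- x)"] by simp
    qed
    show "((\<lambda>x. sqrt (G2 / (1 + 2 * x))) \<longlongrightarrow> 0) at_top"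
    proof -
      have "filterlim (\<lambda>x::real. 1 + 2 * x) at_top at_top"
        by (intro filterlim_tendsto_add_at_top[OF tendsto_const] filterlim_tendsto_pos_mult_at_top[OF tendsto_const] filterlim_ident) simp
      then have "((\<lambda>x. G2 / (1 + 2 * x)) \<longlongrightarrow> 0) at_top"
        by (rule real_tendsto_divide_at_top[OF tendsto_const])
      from tendsto_real_sqrt[OF this] show ?thesis by simp
    qed
  qed
  have k0: "k s = 0" if "Re s < 1/2" for s
    using entire_polynomial_growth_zero[OF K(1) growth lim, of s] K(2)[OF that] by simp
  show ?thesis
  proof (rule moments_zero)
    show "set_integrable lborel {0<..<1} g"
      by (rule set_integrable_bound[OF g_integrable]) (auto simp: set_borel_measurable_def)
    show "(LINT u:{0<..<1}|lborel. g u * of_real (u ^ n)) = 0" for n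
    proof -
      have "(LINT u:{0<..<1}|lborel. g u * of_real (u ^ n)) = k (- of_nat n)"
        unfolding k_def mellin01_def
        by (rule set_lebesgue_integral_cong) (auto simp: powr_nat')
      also have "\<dots> = 0" by (rule k0) simp
      finally show ?thesis .
    qed
  qed
qed

end

section \<open>The inversion of the half-line, Borel representatives, and the proof of the
  inclusion\<close>

lemma integral_inversion:
  fixes F :: "real \<Rightarrow> complex"
  assumes m: "F \<in> borel_measurable borel"
  shows "set_integrable lborel {0<..} (\<lambda>u. F (1 / u) / of_real (u\<^sup>2)) \<longleftrightarrow> set_integrable lborel {0<..} F"
    "(LINT u:{0<..}|lborel. F (1 / u) / of_real (u\<^sup>2)) = (LINT u:{0<..}|lborel. F u)"
proof -
  have m': "(\<lambda>u. F (1 / u) / of_real (u\<^sup>2)) \<in> borel_measurable borel" using m by measurable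
  have leb: "set_integrable lebesgue {0<..} f \<longleftrightarrow> set_integrable lborel {0<..} f"
    "(LINT u:{0<..}|lebesgue. f u) = (LINT u:{0<..}|lborel. f u)"
    if "f \<in> borel_measurable borel" for f :: "real \<Rightarrow> complex"
  proof -
    have "(\<lambda>u. indicator {0<..} u *\<^sub>R f u) \<in> borel_measurable lborel" using that by measurable
    then show "set_integrable lebesgue {0<..} f \<longleftrightarrow> set_integrable lborel {0<..} f"
      "(LINT u:{0<..}|lebesgue. f u) = (LINT u:{0<..}|lborel. f u)"
      unfolding set_integrable_def set_lebesgue_integral_def by (rule integrable_completion, intro integral_completion)
  qed
  have im: "(\<lambda>u. 1 / u) ` {0<..} = {0::real<..}"
  proof (intro set_eqI iffI)
    fix x :: real assume "x \<in> {0<..}"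
    then show "x \<in> (\<lambda>u. 1 / u) ` {0<..}" by (intro image_eqI[of _ _ "1 / x"]) auto
  qed auto
  have inj: "inj_on (\<lambda>u::real. 1 / u) {0<..}" by (auto simp: inj_on_def)
  have der: "((\<lambda>u. 1 / u) has_field_derivative - (1 / x\<^sup>2)) (at x within {0<..})" if "x \<in> {0<..}" for x :: real
    using that by (auto intro!: derivative_eq_intros simp: power2_eq_square)
  have S: "{0::real<..} \<in> sets lebesgue" by simp
  have eq: "(\<lambda>u. \<bar>- (1 / u\<^sup>2)\<bar> *\<^sub>R F (1 / u)) = (\<lambda>u. F (1 / u) / of_real (u\<^sup>2))"
    by (simp add: fun_eq_iff scaleR_conv_of_real)
  have key: "(\<lambda>u. F (1 / u) / of_real (u\<^sup>2)) absolutely_integrable_on {0<..} \<and> integral {0<..} (\<lambda>u. F (1 / u) / of_real (u\<^sup>2)) = b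
      \<longleftrightarrow> F absolutely_integrable_on {0<..} \<and> integral {0<..} F = b" for b
    using has_absolute_integral_change_of_variables_real[OF S der inj, of F b] unfolding im eq by simp
  then have iff: "(\<lambda>u. F (1 / u) / of_real (u\<^sup>2)) absolutely_integrable_on {0<..} \<longleftrightarrow> F absolutely_integrable_on {0<..}"
    by blast
  then show i: "set_integrable lborel {0<..} (\<lambda>u. F (1 / u) / of_real (u\<^sup>2)) \<longleftrightarrow> set_integrable lborel {0<..} F"
    unfolding leb(1)[OF m] leb(1)[OF m'] .
  show "(LINT u:{0<..}|lborel. F (1 / u) / of_real (u\<^sup>2)) = (LINT u:{0<..}|lborel. F u)"
  proof (cases "set_integrable lborel {0<..} F")
    case True
    then have a: "F absolutely_integrable_on {0<..}" "(\<lambda>u. F (1 / u) / of_real (u\<^sup>2)) absolutely_integrable_on {0<..}"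
      using iff unfolding leb(1)[OF m] by auto
    have "integral {0<..} (\<lambda>u. F (1 / u) / of_real (u\<^sup>2)) = integral {0<..} F" using key a by blast
    then show ?thesis
      unfolding leb(2)[OF m, symmetric] leb(2)[OF m', symmetric]
      using set_lebesgue_integral_eq_integral(2)[OF a(1)] set_lebesgue_integral_eq_integral(2)[OF a(2)] by simp
  next
    \<comment> \<open>Neither side is integrable then, and both integrals are 0 by
      convention.\<close>
    case False
    then show ?thesis using i by (simp add: set_integrable_def set_lebesgue_integral_def not_integrable_integral_eq)
  qed
qed

text \<open>Elements of \<open>L2h\<close> are only Lebesgue measurable, whereas
  \<open>orth_fun\<close> requires a Borel function, as the Fubini argument uses joint measurability
  over the product of Borel spaces.\<close>

lemma L2h_borel_version:
  assumes f: "f \<in> L2h"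
  obtains f' where "f' \<in> borel_measurable borel" "AE x in lebesgue_on {0<..}. f x = f' x"
proof -
  have S: "{0<..} \<inter> space lebesgue \<in> sets (lebesgue :: real measure)" by simp
  have m: "(\<lambda>x. indicator {0<..} x *\<^sub>R f x) \<in> borel_measurable lebesgue"
    using L2_measurable[OF f] by (subst (asm) borel_measurable_restrict_space_iff[OF S])
  have "(\<lambda>x. Re (indicator {0<..} x *\<^sub>R f x)) \<in> borel_measurable lebesgue"
    "(\<lambda>x. Im (indicator {0<..} x *\<^sub>R f x)) \<in> borel_measurable lebesgue"
    using measurable_compose[OF m borel_measurable_Re] measurable_compose[OF m borel_measurable_Im] by (simp_all only:)
  from this[THEN completion_ex_borel_measurable_real]
  obtain a b where ab: "a \<in> borel_measurable lborel" "AE x in lborel. Re (indicator {0<..} x *\<^sub>R f x) = a x"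
    "b \<in> borel_measurable lborel" "AE x in lborel. Im (indicator {0<..} x *\<^sub>R f x) = b x" by blast
  have "(\<lambda>x. Complex (a x) (b x)) \<in> borel_measurable borel"
    unfolding Complex_eq using ab by measurable
  moreover have "AE x in lborel. indicator {0<..} x *\<^sub>R f x = Complex (a x) (b x)"
    using ab(2,4) by eventually_elim (auto simp: complex_eq_iff)
  then have "AE x in lebesgue. indicator {0<..} x *\<^sub>R f x = Complex (a x) (b x)" by (rule AE_completion)
  then have "AE x in lebesgue_on {0<..}. f x = Complex (a x) (b x)"
    unfolding AE_restrict_space_iff[OF S] by eventually_elim auto
  ultimately show ?thesis by (rule that)
qed

lemma L2_cong_AE:
  assumes f: "f \<in> L2 M" and g: "g \<in> borel_measurable M" and eq: "AE x in M. f x = g x"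
  shows "g \<in> L2 M" "h \<in> borel_measurable M \<Longrightarrow> L2_inner M h f = L2_inner M h g" "h \<in> borel_measurable M \<Longrightarrow> L2_inner M f h = L2_inner M g h"
proof -
  note [measurable] = L2_measurable[OF f] g
  have "integrable M (\<lambda>x. (norm (g x))\<^sup>2)"
    by (rule integrable_cong_AE_imp[OF L2_square_integrable[OF f]]) (use eq in auto)
  then show "g \<in> L2 M" using g by (simp add: L2_def)
  assume [measurable]: "h \<in> borel_measurable M"
  show "L2_inner M h f = L2_inner M h g" "L2_inner M f h = L2_inner M g h"
    unfolding L2_inner_def by (rule integral_cong_AE; use eq in auto)+
qed

lemma E_map_linear:
  assumes S: "\<phi> \<in> S_le1" "\<psi> \<in> S_le1" and u: "u > 0"
  shows "E_map (\<lambda>x. \<phi> x + \<psi> x) u = E_map \<phi> u + E_map \<psi> u"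
    "E_map (\<lambda>x. a * \<phi> x) u = a * E_map \<phi> u"
proof -
  obtain N where N: "real N * u \<ge> 1" using u by (metis reals_Archimedean3 less_imp_le)
  have i: "\<phi> integrable_on {0..1}" "\<psi> integrable_on {0..1}"
    by (intro integrable_continuous_real S_le1_continuous S)+
  have t: "(LINT x:{0<..}|lborel. f x) = integral {0..1} f" if "f \<in> S_le1" for f
    by (rule S_le1_integral[OF that]) simp
  show "E_map (\<lambda>x. \<phi> x + \<psi> x) u = E_map \<phi> u + E_map \<psi> u"
    unfolding E_map_finite[OF S(1) u N] E_map_finite[OF S(2) u N] E_map_finite[OF S_le1_add[OF S] u N]
      t[OF S(1)] t[OF S(2)] t[OF S_le1_add[OF S]] Henstock_Kurzweil_Integration.integral_add[OF i]
    by (simp add: sum.distrib add_divide_distrib)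
  show "E_map (\<lambda>x. a * \<phi> x) u = a * E_map \<phi> u"
    unfolding E_map_finite[OF S(1) u N] E_map_finite[OF S_le1_cmult[OF S(1)] u N]
      t[OF S(1)] t[OF S_le1_cmult[OF S(1)]] integral_mult_right
    by (simp add: sum_distrib_left right_diff_distrib)
qed

lemma orth_fun_cnj:
  assumes m [measurable]: "f \<in> borel_measurable borel" and f: "f \<in> L2h"
    and o: "\<And>\<phi>. \<phi> \<in> S_le1 \<Longrightarrow> L2_inner (lebesgue_on {0<..}) (E_map \<phi>) f = 0"
  shows "orth_fun (\<lambda>u. cnj (f u))"
proof
  show "set_integrable lborel {0<..} (\<lambda>u. (norm (cnj (f u)))\<^sup>2)" using f borel_L2h_iff[OF m] by simp
  show "(LINT u:{0<..}|lborel. E_map \<phi> u * cnj (f u)) = 0" if "\<phi> \<in> S_le1" for \<phi>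
    using o[OF that] L2_inner_borel[OF E_map_measurable[OF S_le1_measurable[OF that]] m] by simp
qed measurable

lemma RH_imp_inclusion:
  assumes rh: riemann_hypothesis
  shows "L2_orth (lebesgue_on {0<..}) (E_map ` S_le1) \<subseteq> L2_closure (lebesgue_on {0<..}) (E_map ` fourier ` S_le1)"
proof
  let ?M = "lebesgue_on {0<..} :: real measure"
  fix h assume h: "h \<in> L2_orth ?M (E_map ` S_le1)"
  then have hL: "h \<in> L2h" and ho: "\<And>\<phi>. \<phi> \<in> S_le1 \<Longrightarrow> L2_inner ?M (E_map \<phi>) h = 0"
    by (auto simp: L2_orth_def)
  \<comment> \<open>\<open>E_map\<close> is not linear at nonpositive arguments, where its series may diverge; hence the elements of
    \<open>X\<close> are unconstrained there.\<close>
  define X where "X = {f \<in> L2h. \<exists>\<phi>\<in>S_le1. \<forall>u>0. f u = E_map (fourier \<phi>) u}"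
  have Em: "E_map \<phi> \<in> borel_measurable borel" if "\<phi> \<in> S_le1" for \<phi>
    by (rule E_map_measurable[OF S_le1_measurable[OF that]])
  have eX: "E_map (fourier \<phi>) \<in> X" if "\<phi> \<in> S_le1" for \<phi>
    using that E_map_fourier_L2h by (auto simp: X_def)
  show "h \<in> L2_closure ?M (E_map ` fourier ` S_le1)"
  proof (rule ccontr)
    assume notin: "h \<notin> L2_closure ?M (E_map ` fourier ` S_le1)"
    have "h \<notin> L2_closure ?M X"
    proof
      assume hX: "h \<in> L2_closure ?M X"
      have "\<exists>f\<in>E_map ` fourier ` S_le1. L2_norm ?M (\<lambda>x. h x - f x) < \<epsilon>" if \<epsilon>: "\<epsilon> > 0" for \<epsilon>
      proof -
        obtain f where f: "f \<in> X" "L2_norm ?M (\<lambda>x. h x - f x) < \<epsilon>"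
        proof -
          have "\<exists>f\<in>X. L2_norm ?M (\<lambda>x. h x - f x) < \<epsilon>" using hX \<epsilon> by (simp add: L2_closure_def)
          then show ?thesis using that by blast
        qed
        then obtain \<phi> where \<phi>: "\<phi> \<in> S_le1" "\<And>u. u > 0 \<Longrightarrow> f u = E_map (fourier \<phi>) u"
          unfolding X_def by blast
        have "L2_norm ?M (\<lambda>x. h x - f x) = L2_norm ?M (\<lambda>x. h x - E_map (fourier \<phi>) x)"
          unfolding L2_norm_def by (rule arg_cong[where f = sqrt], rule Bochner_Integration.integral_cong) (auto simp: \<phi>)
        then show ?thesis using f(2) \<phi>(1) by auto
      qed
      then show False using notin hL by (simp add: L2_closure_def)
    qed
    \<comment> \<open>If \<open>h\<close> were not in the closure, the projection theorem would give
      a \<open>q\<close> orthogonal to all \<open>E_map (fourier \<phi>)\<close> but not to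
      \<open>h\<close>. The rest shows that \<open>h\<close> and \<open>q\<close> have disjoint
      supports up to null sets.\<close>
    obtain q where q: "q \<in> L2_orth ?M X" "L2_inner ?M h q \<noteq> 0"
    proof (rule L2_projection[of X ?M h])
      show "X \<subseteq> L2h" by (auto simp: X_def)
      have "bump (1/2) 0 \<in> S_le1" by (rule bump_in_S_le1) auto
      then show "X \<noteq> {}" using eX by blast
      show "(\<lambda>x. f x + g x) \<in> X" if fg: "f \<in> X" "g \<in> X" for f g
      proof -
        obtain \<phi> \<psi> where 1: "\<phi> \<in> S_le1" "\<And>u. u > 0 \<Longrightarrow> f u = E_map (fourier \<phi>) u"
          and 2: "\<psi> \<in> S_le1" "\<And>u. u > 0 \<Longrightarrow> g u = E_map (fourier \<psi>) u" using fg unfolding X_def by blast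
        have "f u + g u = E_map (fourier (\<lambda>x. \<phi> x + \<psi> x)) u" if "u > 0" for u
          using that 1 2 E_map_linear(1)[OF 1(1) 2(1), of "1 / u"]
          by (simp add: E_map_fourier S_le1_add add_divide_distrib)
        then show ?thesis unfolding X_def using L2_add fg S_le1_add[OF 1(1) 2(1)] by (auto simp: X_def)
      qed
      show "(\<lambda>x. a * f x) \<in> X" if fg: "f \<in> X" for a f
      proof -
        obtain \<phi> where 1: "\<phi> \<in> S_le1" "\<And>u. u > 0 \<Longrightarrow> f u = E_map (fourier \<phi>) u"
          using fg unfolding X_def by blast
        have "a * f u = E_map (fourier (\<lambda>x. a * \<phi> x)) u" if "u > 0" for u
          using that 1 E_map_linear(2)[OF 1(1) 1(1), of "1 / u" a]
          by (simp add: E_map_fourier S_le1_cmult)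
        then show ?thesis unfolding X_def using L2_cmult fg S_le1_cmult[OF 1(1)] by (auto simp: X_def)
      qed
    qed (use hL \<open>h \<notin> L2_closure ?M X\<close> in auto)
    have qL: "q \<in> L2h" using q(1) by (simp add: L2_orth_def)
    obtain h' where h'm [measurable]: "h' \<in> borel_measurable borel" and hh': "AE x in ?M. h x = h' x"
      using L2h_borel_version[OF hL] by blast
    obtain q' where q'm [measurable]: "q' \<in> borel_measurable borel" and qq': "AE x in ?M. q x = q' x"
      using L2h_borel_version[OF qL] by blast
    have toM: "f \<in> borel_measurable borel \<Longrightarrow> f \<in> borel_measurable ?M" for f :: "real \<Rightarrow> complex"
      by (intro measurable_restrict_space1) (simp add: measurable_completion)
    have h'L: "h' \<in> L2h" by (rule L2_cong_AE(1)[OF hL toM[OF h'm] hh'])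
    have q'L: "q' \<in> L2h" by (rule L2_cong_AE(1)[OF qL toM[OF q'm] qq'])
    have "L2_inner ?M h q = L2_inner ?M h' q'"
      using L2_cong_AE(3)[OF hL toM[OF h'm] hh' L2_measurable[OF qL]] L2_cong_AE(2)[OF qL toM[OF q'm] qq' toM[OF h'm]] by simp
    then have nz: "L2_inner ?M h' q' \<noteq> 0" using q(2) by simp
    have "orth_fun (\<lambda>u. cnj (h' u))"
      by (rule orth_fun_cnj[OF h'm h'L]) (use L2_cong_AE(2)[OF hL toM[OF h'm] hh' toM[OF Em]] ho in simp)
    from orth_fun.zero_on_unit_interval[OF this rh]
    have h0: "AE u in lborel. 0 < u \<longrightarrow> u < 1 \<longrightarrow> h' u = 0" by simp
    \<comment> \<open>The unitary inversion applied to \<open>q'\<close>. It exchanges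
      \<open>E_map (fourier \<phi>)\<close> with \<open>E_map \<phi>\<close>, so \<open>r\<close> is
      orthogonal to the latter; that \<open>r\<close> vanishes on the unit interval means that
      \<open>q'\<close> vanishes beyond 1.\<close>
    define r where "r u = q' (1 / u) / of_real u" for u :: real
    have rm [measurable]: "r \<in> borel_measurable borel" unfolding r_def by measurable
    have rL: "r \<in> L2h"
    proof -
      have cr: "set_integrable lborel {0<..} (\<lambda>u. complex_of_real (f u)) \<longleftrightarrow> set_integrable lborel {0<..} f" for f
      proof -
        have "(\<lambda>u. indicator {0<..} u *\<^sub>R complex_of_real (f u)) = (\<lambda>u. complex_of_real (indicator {0<..} u *\<^sub>R f u))"
          by (simp add: scaleR_conv_of_real)
        then show ?thesis unfolding set_integrable_def by (simp only: complex_of_real_integrable_eq)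
      qed
      have "set_integrable lborel {0<..} (\<lambda>u. complex_of_real ((norm (q' u))\<^sup>2))"
        unfolding cr using q'L borel_L2h_iff[OF q'm] by simp
      then have "set_integrable lborel {0<..} (\<lambda>u. complex_of_real ((norm (q' (1 / u)))\<^sup>2) / of_real (u\<^sup>2))"
        by (subst integral_inversion(1)) (use q'm in measurable)
      then have "set_integrable lborel {0<..} (\<lambda>u. complex_of_real ((norm (r u))\<^sup>2))"
        by (simp add: r_def norm_divide power_divide)
      then have "set_integrable lborel {0<..} (\<lambda>u. (norm (r u))\<^sup>2)" unfolding cr .
      then show ?thesis using borel_L2h_iff[OF rm] by simp
    qed
    have "orth_fun (\<lambda>u. cnj (r u))"
    proof (rule orth_fun_cnj[OF rm rL])
      fix \<phi> assume S: "\<phi> \<in> S_le1"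
      note [measurable] = Em[OF S]
      have em [measurable]: "E_map (fourier \<phi>) \<in> borel_measurable borel"
        by (rule E_map_measurable[OF fourier_measurable[OF S]])
      have "0 = L2_inner ?M (E_map (fourier \<phi>)) q" using q(1) eX[OF S] by (simp add: L2_orth_def)
      also have "\<dots> = L2_inner ?M (E_map (fourier \<phi>)) q'" by (rule L2_cong_AE(2)[OF qL toM[OF q'm] qq' toM[OF em]])
      also have "\<dots> = (LINT u:{0<..}|lborel. E_map (fourier \<phi>) u * cnj (q' u))" by (rule L2_inner_borel[OF em q'm])
      also have "\<dots> = (LINT u:{0<..}|lborel. E_map (fourier \<phi>) (1 / u) * cnj (q' (1 / u)) / of_real (u\<^sup>2))"
        by (rule integral_inversion(2)[symmetric]) measurable
      also have "\<dots> = (LINT u:{0<..}|lborel. E_map \<phi> u * cnj (r u))"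
        by (rule set_lebesgue_integral_cong) (auto simp: E_map_fourier[OF S] r_def power2_eq_square)
      also have "\<dots> = L2_inner ?M (E_map \<phi>) r" by (rule L2_inner_borel[OF Em[OF S] rm, symmetric])
      finally show "L2_inner ?M (E_map \<phi>) r = 0" by simp
    qed
    from orth_fun.zero_on_unit_interval[OF this rh]
    have r0: "AE u in lborel. 0 < u \<longrightarrow> u < 1 \<longrightarrow> r u = 0" by simp
    have int: "set_integrable lborel {0<..} (\<lambda>u. h' u * cnj (q' u))"
      using L2_prod_integrable[OF h'L q'L] by (subst (asm) lebesgue_on_borel(2)) auto
    have "(LINT u:{0<..<1}|lborel. h' u * cnj (q' u)) = (LINT u:{0<..<1::real}|lborel. 0)"
      unfolding set_lebesgue_integral_def
      by (rule integral_cong_AE) (use h0 in \<open>auto elim!: eventually_mono simp: indicator_def\<close>)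
    moreover have "(LINT u:{1<..}|lborel. h' u * cnj (q' u)) = 0"
    proof -
      \<comment> \<open>Writing the domain as an indicator inside an integral over the whole
        half-line makes the inversion applicable; afterwards the indicator restricts to
        \<open>u < 1\<close>, where \<open>r\<close> is 0.\<close>
      have "(LINT u:{1<..}|lborel. h' u * cnj (q' u)) = (LINT u:{0<..}|lborel. indicator {1<..} u *\<^sub>R (h' u * cnj (q' u)))"
        unfolding set_lebesgue_integral_def by (rule Bochner_Integration.integral_cong) (auto simp: indicator_def)
      also have "\<dots> = (LINT u:{0<..}|lborel. indicator {1<..} (1 / u) *\<^sub>R (h' (1 / u) * cnj (q' (1 / u))) / of_real (u\<^sup>2))"
        by (rule integral_inversion(2)[symmetric]) measurable
      also have "\<dots> = (LINT u:{0::real<..}|lborel. 0)"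
        unfolding set_lebesgue_integral_def
      proof (rule integral_cong_AE)
        show "AE u in lborel. indicator {0<..} u *\<^sub>R (indicator {1<..} (1 / u) *\<^sub>R (h' (1 / u) * cnj (q' (1 / u))) / of_real (u\<^sup>2)) = indicator {0<..} u *\<^sub>R 0"
          using r0 by eventually_elim (auto simp: indicator_def r_def)
      qed measurable
      finally show ?thesis by simp
    qed
    ultimately have "L2_inner ?M h' q' = 0"
      unfolding L2_inner_borel[OF h'm q'm] set_integral_half_line[OF int] by simp
    then show False using nz by simp
  qed
qed

theorem theorem2p8:
  "L2_orth (lebesgue_on {0<..}) (E_map ` S_le1)
     \<subseteq> L2_closure (lebesgue_on {0<..}) (E_map ` fourier ` S_le1)
   \<longleftrightarrow> riemann_hypothesis"
  using RH_imp_inclusion inclusion_imp_no_zero unfolding riemann_hypothesis_def by blast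

end
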